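(* Let $\mathfrak{h}$ be a vector space over $\mathbb{C}$ equipped with a nondegenerate bilinear form $(\cdot,\cdot)$, and let $M$ be a left $T(\mathfrak{h})$-module. Let $\mathbf{k}$ act on $M$ as $1$ and let the elements of $\hat{\mathfrak{h}}_{+}$ act on $M$ as $0$, so that $M$ is a left module for the subalgebra $N(\hat{\mathfrak{h}}_{+}\oplus\hat{\mathfrak{h}}_{0})$ of $N(\hat{\mathfrak{h}})$ generated by the elements of $\hat{\mathfrak{h}}_{+}$ and $\hat{\mathfrak{h}}_{0}$. Then the induced left $N(\hat{\mathfrak{h}})$-module $N(\hat{\mathfrak{h}})\otimes_{N(\hat{\mathfrak{h}}_{+}\oplus\hat{\mathfrak{h}}_{0})}M$ is linearly isomorphic to $T(\hat{\mathfrak{h}}_{-})\otimes M$.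
   Context: All vector spaces are over $\mathbb{C}$; $T(X)$ denotes the tensor algebra of a vector space $X$; $\mathbb{Z}_{+}$ is the set of positive integers. Let $\hat{\mathfrak{h}}=\mathfrak{h}\otimes\mathbb{C}[t,t^{-1}]\oplus\mathbb{C}\mathbf{k}$ (as a vector space), $\hat{\mathfrak{h}}_{+}=\mathfrak{h}\otimes t\mathbb{C}[t]$, $\hat{\mathfrak{h}}_{-}=\mathfrak{h}\otimes t^{-1}\mathbb{C}[t^{-1}]$, $\hat{\mathfrak{h}}_{0}=\mathfrak{h}\otimes t^{0}\oplus\mathbb{C}\mathbf{k}$, and identify $\mathfrak{h}$ with $\mathfrak{h}\otimes t^{0}$. Let $N(\hat{\mathfrak{h}})=T(\hat{\mathfrak{h}})/I$, where $I$ is the two-sided ideal generated by the elements $(a\otimes t^{m})\otimes(b\otimes t^{n})-(b\otimes t^{n})\otimes(a\otimes t^{m})-m(a,b)\delta_{m+n,0}\mathbf{k}$ for $m\in\mathbb{Z}_{+}$, $n\in-\mathbb{Z}_{+}$; $(a\otimes t^{k})\otimes(b\otimes t^{0})-(b\otimes t^{0})\otimes(a\otimes t^{k})$ for $k\in\mathbb{Z}\setminus\{0\}$; and $(a\otimes t^{k})\otimes\mathbf{k}-\mathbf{k}\otimes(a\otimes t^{k})$ for $k\in\mathbb{Z}$; here $a,b\in\mathfrak{h}$. *)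

theory Defs
  imports Complex_Main "HOL-Library.Poly_Mapping" "HOL-Algebra.Algebra"
    "HOL-Algebra.Algebraic_Closure_Type"
begin

section \<open>Complex vector spaces as records\<close>

text \<open>
  A complex vector space is a record \<open>V\<close> with \<open>module \<complex>\<F> V\<close>.  The record type
  also has ring fields \<open>mult\<close> and \<open>one\<close>; they are meaningful only for the records below that
  are associative algebras, and are \<open>undefined\<close> or ignored otherwise.
\<close>

abbreviation complex_field :: "complex ring"  (\<open>\<complex>\<F>\<close>)
  where "\<complex>\<F> \<equiv> ring_of_type_algebra"

definition lin_span :: "(complex, 'v) module \<Rightarrow> 'v set \<Rightarrow> 'v set"
  where "lin_span V S = \<Inter>{W. submodule W \<complex>\<F> V \<and> S \<subseteq> W}"

text \<open>
  The quotient by \<open>W\<close>: for \<open>W\<close> a subspace of a vector space the quotient space (the library's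
  construction supplies carrier, addition and zero), for \<open>W\<close> a two-sided ideal of an
  algebra the quotient algebra.
\<close>

definition quotient_space :: "(complex, 'v) module \<Rightarrow> 'v set \<Rightarrow> (complex, 'v set) module"
  where "quotient_space V W =
    ring.extend (V Quot W)
      (module.fields (\<lambda>c Y. \<Union>x\<in>Y. W +>\<^bsub>V\<^esub> (c \<odot>\<^bsub>V\<^esub> x)))"

definition direct_sum ::
  "(complex, 'v) module \<Rightarrow> (complex, 'w) module \<Rightarrow> (complex, 'v \<times> 'w) module"
  where "direct_sum V W =
    \<lparr>carrier = carrier V \<times> carrier W, monoid.mult = undefined, one = undefined,
     ring.zero = (\<zero>\<^bsub>V\<^esub>, \<zero>\<^bsub>W\<^esub>),
     add = (\<lambda>(v, w) (v', w'). (v \<oplus>\<^bsub>V\<^esub> v', w \<oplus>\<^bsub>W\<^esub> w')),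
     module.smult = (\<lambda>c (v, w). (c \<odot>\<^bsub>V\<^esub> v, c \<odot>\<^bsub>W\<^esub> w))\<rparr>"

definition complex_line :: "(complex, complex) module"
  where "complex_line = ring.extend \<complex>\<F> (module.fields (*))"

definition free_space :: "'x set \<Rightarrow> (complex, 'x \<Rightarrow>\<^sub>0 complex) module"
  where "free_space Y =
    \<lparr>carrier = {f. Poly_Mapping.keys f \<subseteq> Y}, monoid.mult = undefined, one = undefined,
     ring.zero = 0, add = (+), module.smult = (\<lambda>c. Poly_Mapping.map ((*) c))\<rparr>"

definition lin_isomorphic :: "(complex, 'v) module \<Rightarrow> (complex, 'w) module \<Rightarrow> bool"
  where "lin_isomorphic V W \<longleftrightarrow>
    (\<exists>f. bij_betw f (carrier V) (carrier W) \<and>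
      (\<forall>x\<in>carrier V. \<forall>y\<in>carrier V. f (x \<oplus>\<^bsub>V\<^esub> y) = f x \<oplus>\<^bsub>W\<^esub> f y) \<and>
      (\<forall>c. \<forall>x\<in>carrier V. f (c \<odot>\<^bsub>V\<^esub> x) = c \<odot>\<^bsub>W\<^esub> f x))"

locale nondegenerate_form =
  fixes V :: "(complex, 'v) module" and B :: "'v \<Rightarrow> 'v \<Rightarrow> complex"
  assumes vector_space: "module \<complex>\<F> V"
    and add_left: "\<lbrakk>x \<in> carrier V; y \<in> carrier V; z \<in> carrier V\<rbrakk> \<Longrightarrow>
      B (x \<oplus>\<^bsub>V\<^esub> y) z = B x z + B y z"
    and add_right: "\<lbrakk>x \<in> carrier V; y \<in> carrier V; z \<in> carrier V\<rbrakk> \<Longrightarrow>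
      B x (y \<oplus>\<^bsub>V\<^esub> z) = B x y + B x z"
    and smult_left: "\<lbrakk>x \<in> carrier V; y \<in> carrier V\<rbrakk> \<Longrightarrow> B (c \<odot>\<^bsub>V\<^esub> x) y = c * B x y"
    and smult_right: "\<lbrakk>x \<in> carrier V; y \<in> carrier V\<rbrakk> \<Longrightarrow> B x (c \<odot>\<^bsub>V\<^esub> y) = c * B x y"
    and nondegenerate_left:
      "\<lbrakk>x \<in> carrier V; \<And>y. y \<in> carrier V \<Longrightarrow> B x y = 0\<rbrakk> \<Longrightarrow> x = \<zero>\<^bsub>V\<^esub>"
    and nondegenerate_right:
      "\<lbrakk>y \<in> carrier V; \<And>x. x \<in> carrier V \<Longrightarrow> B x y = 0\<rbrakk> \<Longrightarrow> y = \<zero>\<^bsub>V\<^esub>"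


section \<open>Tensor products of vector spaces\<close>

definition tensor_relations ::
  "(complex, 'v) module \<Rightarrow> (complex, 'w) module \<Rightarrow> ('v \<times> 'w \<Rightarrow>\<^sub>0 complex) set"
  where "tensor_relations V W =
    {Poly_Mapping.single (v \<oplus>\<^bsub>V\<^esub> v', w) 1 - Poly_Mapping.single (v, w) 1
        - Poly_Mapping.single (v', w) 1
      | v v' w. v \<in> carrier V \<and> v' \<in> carrier V \<and> w \<in> carrier W} \<union>
    {Poly_Mapping.single (v, w \<oplus>\<^bsub>W\<^esub> w') 1 - Poly_Mapping.single (v, w) 1
        - Poly_Mapping.single (v, w') 1
      | v w w'. v \<in> carrier V \<and> w \<in> carrier W \<and> w' \<in> carrier W} \<union>
    {Poly_Mapping.single (c \<odot>\<^bsub>V\<^esub> v, w) 1 - Poly_Mapping.single (v, w) c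
      | c v w. v \<in> carrier V \<and> w \<in> carrier W} \<union>
    {Poly_Mapping.single (v, c \<odot>\<^bsub>W\<^esub> w) 1 - Poly_Mapping.single (v, w) c
      | c v w. v \<in> carrier V \<and> w \<in> carrier W}"

definition tensor_kernel ::
  "(complex, 'v) module \<Rightarrow> (complex, 'w) module \<Rightarrow> ('v \<times> 'w \<Rightarrow>\<^sub>0 complex) set"
  where "tensor_kernel V W =
    lin_span (free_space (carrier V \<times> carrier W)) (tensor_relations V W)"

definition tensor ::
  "(complex, 'v) module \<Rightarrow> (complex, 'w) module \<Rightarrow>
    (complex, ('v \<times> 'w \<Rightarrow>\<^sub>0 complex) set) module"
  where "tensor V W =
    quotient_space (free_space (carrier V \<times> carrier W)) (tensor_kernel V W)"

definition pure_tensor ::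
  "(complex, 'v) module \<Rightarrow> (complex, 'w) module \<Rightarrow> 'v \<Rightarrow> 'w \<Rightarrow>
    ('v \<times> 'w \<Rightarrow>\<^sub>0 complex) set"
  where "pure_tensor V W v w =
    tensor_kernel V W +>\<^bsub>free_space (carrier V \<times> carrier W)\<^esub> Poly_Mapping.single (v, w) 1"


section \<open>The tensor algebra\<close>

text \<open>
  Words under concatenation form the free monoid, written additively so that the
  convolution product of \<^typ>\<open>'x list \<Rightarrow>\<^sub>0 complex\<close> is the product of the free algebra.
\<close>

instantiation list :: (type) monoid_add
begin
definition zero_list :: "'a list" where "zero_list = []"
definition plus_list :: "'a list \<Rightarrow> 'a list \<Rightarrow> 'a list" where "plus_list = (@)"
instance by standard (simp_all add: zero_list_def plus_list_def)
end

definition free_algebra :: "'x set \<Rightarrow> (complex, 'x list \<Rightarrow>\<^sub>0 complex) module"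
  where "free_algebra Y =
    \<lparr>carrier = {f. Poly_Mapping.keys f \<subseteq> lists Y}, monoid.mult = (*), one = 1,
     ring.zero = 0, add = (+), module.smult = (\<lambda>c. Poly_Mapping.map ((*) c))\<rparr>"

definition tensor_algebra_ideal :: "(complex, 'v) module \<Rightarrow> ('v list \<Rightarrow>\<^sub>0 complex) set"
  where "tensor_algebra_ideal V = Idl\<^bsub>free_algebra (carrier V)\<^esub>
    ({Poly_Mapping.single [v \<oplus>\<^bsub>V\<^esub> w] 1 - Poly_Mapping.single [v] 1 - Poly_Mapping.single [w] 1
        | v w. v \<in> carrier V \<and> w \<in> carrier V} \<union>
     {Poly_Mapping.single [c \<odot>\<^bsub>V\<^esub> v] 1 - Poly_Mapping.single [v] c | c v. v \<in> carrier V})"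

definition tensor_algebra ::
  "(complex, 'v) module \<Rightarrow> (complex, ('v list \<Rightarrow>\<^sub>0 complex) set) module"
  where "tensor_algebra V = quotient_space (free_algebra (carrier V)) (tensor_algebra_ideal V)"

definition tensor_incl :: "(complex, 'v) module \<Rightarrow> 'v \<Rightarrow> ('v list \<Rightarrow>\<^sub>0 complex) set"
  where "tensor_incl V v =
    tensor_algebra_ideal V +>\<^bsub>free_algebra (carrier V)\<^esub> Poly_Mapping.single [v] 1"


section \<open>Modules over associative algebras\<close>

text \<open>
  The library's \<^locale>\<open>module\<close> requires a commutative ring, so left modules over a
  noncommutative unital algebra are introduced here.
\<close>

locale left_module =
  fixes A :: "(complex, 'a) module" and M :: "(complex, 'm) module"
    and act :: "'a \<Rightarrow> 'm \<Rightarrow> 'm"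
  assumes vector_space: "module \<complex>\<F> M"
    and act_closed: "\<lbrakk>a \<in> carrier A; x \<in> carrier M\<rbrakk> \<Longrightarrow> act a x \<in> carrier M"
    and act_add_left: "\<lbrakk>a \<in> carrier A; b \<in> carrier A; x \<in> carrier M\<rbrakk> \<Longrightarrow>
      act (a \<oplus>\<^bsub>A\<^esub> b) x = act a x \<oplus>\<^bsub>M\<^esub> act b x"
    and act_add_right: "\<lbrakk>a \<in> carrier A; x \<in> carrier M; y \<in> carrier M\<rbrakk> \<Longrightarrow>
      act a (x \<oplus>\<^bsub>M\<^esub> y) = act a x \<oplus>\<^bsub>M\<^esub> act a y"
    and act_smult_left: "\<lbrakk>a \<in> carrier A; x \<in> carrier M\<rbrakk> \<Longrightarrow>
      act (c \<odot>\<^bsub>A\<^esub> a) x = c \<odot>\<^bsub>M\<^esub> act a x"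
    and act_smult_right: "\<lbrakk>a \<in> carrier A; x \<in> carrier M\<rbrakk> \<Longrightarrow>
      act a (c \<odot>\<^bsub>M\<^esub> x) = c \<odot>\<^bsub>M\<^esub> act a x"
    and act_mult: "\<lbrakk>a \<in> carrier A; b \<in> carrier A; x \<in> carrier M\<rbrakk> \<Longrightarrow>
      act (a \<otimes>\<^bsub>A\<^esub> b) x = act a (act b x)"
    and act_one: "x \<in> carrier M \<Longrightarrow> act \<one>\<^bsub>A\<^esub> x = x"

definition generated_subalgebra :: "(complex, 'a) module \<Rightarrow> 'a set \<Rightarrow> 'a set"
  where "generated_subalgebra A S = \<Inter>{P. subring P A \<and> submodule P \<complex>\<F> A \<and> S \<subseteq> P}"

text \<open>
  The underlying vector space of \<open>A \<otimes>\<^sub>P M\<close> for a subalgebra \<open>P\<close> of \<open>A\<close> acting on \<open>M\<close> by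
  \<open>act\<close>, obtained from the tensor product over \<open>\<complex>\<close> by imposing \<open>ap \<otimes> x = a \<otimes> px\<close>.
  Its scalar multiplication is the restriction of the left \<open>A\<close>-action on the first factor.
\<close>

definition induced_module ::
  "(complex, 'a) module \<Rightarrow> 'a set \<Rightarrow> (complex, 'm) module \<Rightarrow> ('a \<Rightarrow> 'm \<Rightarrow> 'm) \<Rightarrow>
    (complex, ('a \<times> 'm \<Rightarrow>\<^sub>0 complex) set set) module"
  where "induced_module A P M act =
    quotient_space (tensor A M) (lin_span (tensor A M)
      {pure_tensor A M (a \<otimes>\<^bsub>A\<^esub> p) x \<ominus>\<^bsub>tensor A M\<^esub> pure_tensor A M a (act p x)
        | a p x. a \<in> carrier A \<and> p \<in> P \<and> x \<in> carrier M})"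


section \<open>The algebra \<open>N(\<hat>\<h>)\<close>\<close>

text \<open>\<open>\<complex>[t, t\<^sup>-\<^sup>1]\<close> is the vector space with basis \<open>t\<^sup>n\<close> for integers \<open>n\<close>.\<close>

definition laurent :: "(complex, int \<Rightarrow>\<^sub>0 complex) module"
  where "laurent = free_space UNIV"

type_synonym 'h hat = "('h \<times> (int \<Rightarrow>\<^sub>0 complex) \<Rightarrow>\<^sub>0 complex) set \<times> complex"

definition hat :: "(complex, 'h) module \<Rightarrow> (complex, 'h hat) module"
  where "hat H = direct_sum (tensor H laurent) complex_line"

definition hat_tensor :: "(complex, 'h) module \<Rightarrow> 'h \<Rightarrow> (int \<Rightarrow>\<^sub>0 complex) \<Rightarrow> 'h hat"
  where "hat_tensor H a f = (pure_tensor H laurent a f, 0)"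

abbreviation hat_elem :: "(complex, 'h) module \<Rightarrow> 'h \<Rightarrow> int \<Rightarrow> 'h hat"
  where "hat_elem H a n \<equiv> hat_tensor H a (Poly_Mapping.single n 1)"

definition hat_k :: "(complex, 'h) module \<Rightarrow> 'h hat"
  where "hat_k H = (\<zero>\<^bsub>tensor H laurent\<^esub>, 1)"

definition hat_plus :: "(complex, 'h) module \<Rightarrow> 'h hat set"
  where "hat_plus H = lin_span (hat H)
    {hat_tensor H a f | a f. a \<in> carrier H \<and> Poly_Mapping.keys f \<subseteq> {0<..}}"

definition hat_minus :: "(complex, 'h) module \<Rightarrow> 'h hat set"
  where "hat_minus H = lin_span (hat H)
    {hat_tensor H a f | a f. a \<in> carrier H \<and> Poly_Mapping.keys f \<subseteq> {..<0}}"

definition hat_zero :: "(complex, 'h) module \<Rightarrow> 'h hat set"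
  where "hat_zero H = lin_span (hat H) ({hat_elem H a 0 | a. a \<in> carrier H} \<union> {hat_k H})"

definition N_relations ::
  "(complex, 'h) module \<Rightarrow> ('h \<Rightarrow> 'h \<Rightarrow> complex) \<Rightarrow> ('h hat list \<Rightarrow>\<^sub>0 complex) set set"
  where "N_relations H B =
    (let T = tensor_algebra (hat H); \<iota> = tensor_incl (hat H);
         e = (\<lambda>a n. \<iota> (hat_elem H a n)); k = \<iota> (hat_k H)
     in {(e a m \<otimes>\<^bsub>T\<^esub> e b n) \<ominus>\<^bsub>T\<^esub> (e b n \<otimes>\<^bsub>T\<^esub> e a m)
           \<ominus>\<^bsub>T\<^esub> ((of_int m * B a b * (if m + n = 0 then 1 else 0)) \<odot>\<^bsub>T\<^esub> k)
          | a b m n. a \<in> carrier H \<and> b \<in> carrier H \<and> m > 0 \<and> n < 0} \<union>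
        {(e a j \<otimes>\<^bsub>T\<^esub> e b 0) \<ominus>\<^bsub>T\<^esub> (e b 0 \<otimes>\<^bsub>T\<^esub> e a j)
          | a b j. a \<in> carrier H \<and> b \<in> carrier H \<and> j \<noteq> 0} \<union>
        {(e a j \<otimes>\<^bsub>T\<^esub> k) \<ominus>\<^bsub>T\<^esub> (k \<otimes>\<^bsub>T\<^esub> e a j) | a j. a \<in> carrier H})"

definition N_ideal ::
  "(complex, 'h) module \<Rightarrow> ('h \<Rightarrow> 'h \<Rightarrow> complex) \<Rightarrow> ('h hat list \<Rightarrow>\<^sub>0 complex) set set"
  where "N_ideal H B = Idl\<^bsub>tensor_algebra (hat H)\<^esub> (N_relations H B)"

definition N_algebra ::
  "(complex, 'h) module \<Rightarrow> ('h \<Rightarrow> 'h \<Rightarrow> complex) \<Rightarrow>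
    (complex, ('h hat list \<Rightarrow>\<^sub>0 complex) set set) module"
  where "N_algebra H B = quotient_space (tensor_algebra (hat H)) (N_ideal H B)"

definition N_incl ::
  "(complex, 'h) module \<Rightarrow> ('h \<Rightarrow> 'h \<Rightarrow> complex) \<Rightarrow> 'h hat \<Rightarrow>
    ('h hat list \<Rightarrow>\<^sub>0 complex) set set"
  where "N_incl H B x = N_ideal H B +>\<^bsub>tensor_algebra (hat H)\<^esub> tensor_incl (hat H) x"

definition N_nonneg ::
  "(complex, 'h) module \<Rightarrow> ('h \<Rightarrow> 'h \<Rightarrow> complex) \<Rightarrow>
    ('h hat list \<Rightarrow>\<^sub>0 complex) set set set"
  where "N_nonneg H B =
    generated_subalgebra (N_algebra H B) (N_incl H B ` (hat_plus H \<union> hat_zero H))"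

text \<open>
  \<open>act\<close> extends the \<open>T(\<h>)\<close>-action \<open>\<tau>\<close> on \<open>M\<close> to the subalgebra \<open>N_nonneg H B\<close>, with \<open>\<^bold>k\<close>
  acting as \<open>1\<close> and the positive part as \<open>0\<close>.
\<close>

definition extends_action ::
  "(complex, 'h) module \<Rightarrow> ('h \<Rightarrow> 'h \<Rightarrow> complex) \<Rightarrow> (complex, 'm) module \<Rightarrow>
    (('h list \<Rightarrow>\<^sub>0 complex) set \<Rightarrow> 'm \<Rightarrow> 'm) \<Rightarrow>
    (('h hat list \<Rightarrow>\<^sub>0 complex) set set \<Rightarrow> 'm \<Rightarrow> 'm) \<Rightarrow> bool"
  where "extends_action H B M \<tau> act \<longleftrightarrow>
    left_module ((N_algebra H B)\<lparr>carrier := N_nonneg H B\<rparr>) M act \<and>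
    (\<forall>x\<in>carrier M. act (N_incl H B (hat_k H)) x = x) \<and>
    (\<forall>u\<in>hat_plus H. \<forall>x\<in>carrier M. act (N_incl H B u) x = \<zero>\<^bsub>M\<^esub>) \<and>
    (\<forall>a\<in>carrier H. \<forall>x\<in>carrier M.
      act (N_incl H B (hat_elem H a 0)) x = \<tau> (tensor_incl H a) x)"

end

theory Submission
  imports Defs
begin

text \<open>
  The space \<open>T(\<h>\<^sub>-) \<otimes> M\<close> carries a Fock-type representation of \<open>N(\<hat>\<h>)\<close>: negative modes multiply on
  the left, zero modes act on \<open>M\<close>, \<open>\<^bold>k\<close> acts as \<open>1\<close>, and \<open>a \<otimes> t\<^sup>m\<close> with \<open>m > 0\<close> acts by the
  operator \<open>D\<close> with \<open>D(1) = 0\<close> and \<open>D(v u) = d(v) u + v D(u)\<close>, where \<open>d(b \<otimes> t\<^sup>n) = m (a, b)\<close> if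
  \<open>m + n = 0\<close> and \<open>d(b \<otimes> t\<^sup>n) = 0\<close> otherwise. The nonnegative subalgebra preserves the copy
  \<open>1 \<otimes> M\<close> of \<open>M\<close>, which yields the required action on \<open>M\<close>. For the induced module,
  \<open>n \<otimes> x \<mapsto> n (1 \<otimes> x)\<close> and \<open>u \<otimes> x \<mapsto> u \<otimes> x\<close> are mutually inverse: the representation shows that
  the second map is injective, and commuting nonnegative modes to the right shows that it is
  surjective.
\<close>

section \<open>Complex vector spaces\<close>

text \<open>The relations impose nothing between two negative, two positive or two zero modes. Hence
  a tensor algebra appears instead of a symmetric one, and \<open>M\<close> may be any module over
  the tensor algebra of \<open>H\<close>. The rule for \<open>D\<close> restates the relation
  between a positive mode and the leading negative mode \<open>v\<close>, with the central element
  acting as 1; it makes \<open>D\<close> the derivation of the tensor algebra with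
  \<open>D(v) = d(v) 1\<close>.

  All objects are quotients of free ones. Maps out of them come from universal properties, but their
  elements have no normal form to compute with, so identities are proved on a spanning set, or at 1
  and then under left multiplication by generators. A presentation alone cannot show that distinct
  tensors stay distinct in the induced module; that is what the representation supplies.

  The subalgebra of nonnegative modes is given by generators without a presentation. Its action on
  \<open>M\<close> therefore cannot be prescribed on generators and is cut out of a representation
  of the whole algebra.\<close>

abbreviation vs :: "(complex, 'v) module \<Rightarrow> bool"
  where "vs V \<equiv> module \<complex>\<F> V"

lemma complex_field_simps [simp]:
  "carrier \<complex>\<F> = UNIV" "\<zero>\<^bsub>\<complex>\<F>\<^esub> = 0" "\<one>\<^bsub>\<complex>\<F>\<^esub> = 1" "a \<oplus>\<^bsub>\<complex>\<F>\<^esub> b = a + b" "a \<otimes>\<^bsub>\<complex>\<F>\<^esub> b = a * b"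
  by (simp_all add: ring_of_type_algebra_def)

lemma cring_complex_field: "cring \<complex>\<F>"
  by (rule cring_from_type_algebra)

lemma uminus_complex_field [simp]: "\<ominus>\<^bsub>\<complex>\<F>\<^esub> a = - a"
proof -
  interpret cring "\<complex>\<F>" by (rule cring_complex_field)
  show ?thesis by (rule minus_equality) simp_all
qed

text \<open>The law \<open>0 \<odot> x = \<zero>\<close> stands in for the axiom on additive
  inverses: distributivity makes \<open>(-1) \<odot> x\<close> the negative of
  \<open>x\<close>.\<close>

lemma vsI:
  fixes V (structure)
  assumes "\<And>x y. x \<in> carrier V \<Longrightarrow> y \<in> carrier V \<Longrightarrow> x \<oplus> y \<in> carrier V"
    and "\<zero> \<in> carrier V"
    and "\<And>c x. x \<in> carrier V \<Longrightarrow> c \<odot> x \<in> carrier V"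
    and "\<And>x y z. x \<in> carrier V \<Longrightarrow> y \<in> carrier V \<Longrightarrow> z \<in> carrier V \<Longrightarrow>
      x \<oplus> y \<oplus> z = x \<oplus> (y \<oplus> z)"
    and "\<And>x y. x \<in> carrier V \<Longrightarrow> y \<in> carrier V \<Longrightarrow> x \<oplus> y = y \<oplus> x"
    and "\<And>x. x \<in> carrier V \<Longrightarrow> \<zero> \<oplus> x = x"
    and "\<And>x. x \<in> carrier V \<Longrightarrow> 0 \<odot> x = \<zero>"
    and "\<And>x. x \<in> carrier V \<Longrightarrow> 1 \<odot> x = x"
    and "\<And>c x y. x \<in> carrier V \<Longrightarrow> y \<in> carrier V \<Longrightarrow> c \<odot> (x \<oplus> y) = c \<odot> x \<oplus> c \<odot> y"
    and "\<And>c d x. x \<in> carrier V \<Longrightarrow> (c + d) \<odot> x = c \<odot> x \<oplus> d \<odot> x"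
    and "\<And>c d x. x \<in> carrier V \<Longrightarrow> (c * d) \<odot> x = c \<odot> (d \<odot> x)"
  shows "vs V"
proof (rule moduleI)
  show "abelian_group V"
  proof (rule abelian_groupI)
    fix x assume x: "x \<in> carrier V"
    have "(-1) \<odot> x \<oplus> x = \<zero>"
      using assms(10)[of x "-1" 1] assms(7,8) x by simp
    then show "\<exists>y\<in>carrier V. y \<oplus> x = \<zero>"
      using x assms(3) by blast
  qed (use assms in auto)
qed (use assms cring_complex_field in auto)

text \<open>Stated with \<open>vs V\<close> as a premise rather than by interpretation, because
  later proofs handle several spaces at once and pass the facts to \<open>simp\<close> instance by
  instance.\<close>

lemma vs_closed:
  fixes V (structure)
  assumes "vs V"
  shows "\<And>x y. x \<in> carrier V \<Longrightarrow> y \<in> carrier V \<Longrightarrow> x \<oplus> y \<in> carrier V"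
    and "\<zero> \<in> carrier V"
    and "\<And>c x. x \<in> carrier V \<Longrightarrow> c \<odot> x \<in> carrier V"
proof -
  interpret V: module "\<complex>\<F>" V by fact
  show "\<And>x y. x \<in> carrier V \<Longrightarrow> y \<in> carrier V \<Longrightarrow> x \<oplus> y \<in> carrier V"
    "\<zero> \<in> carrier V" "\<And>c x. x \<in> carrier V \<Longrightarrow> c \<odot> x \<in> carrier V" by simp_all
qed

lemma vs_smult:
  fixes V (structure)
  assumes "vs V"
  shows "x \<in> carrier V \<Longrightarrow> 0 \<odot> x = \<zero>" "x \<in> carrier V \<Longrightarrow> 1 \<odot> x = x"
    "x \<in> carrier V \<Longrightarrow> (c + d) \<odot> x = c \<odot> x \<oplus> d \<odot> x"
    "x \<in> carrier V \<Longrightarrow> (c * d) \<odot> x = c \<odot> (d \<odot> x)"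
    "x \<in> carrier V \<Longrightarrow> y \<in> carrier V \<Longrightarrow> c \<odot> (x \<oplus> y) = c \<odot> x \<oplus> c \<odot> y"
    "c \<odot> \<zero> = \<zero>" "x \<in> carrier V \<Longrightarrow> \<ominus> x = (-1) \<odot> x"
proof -
  interpret V: module "\<complex>\<F>" V by fact
  show "c \<odot> \<zero> = \<zero>" using V.smult_r_null by simp
  assume x: "x \<in> carrier V"
  show "0 \<odot> x = \<zero>" "1 \<odot> x = x" using V.smult_l_null V.smult_one x by simp_all
  show "(c + d) \<odot> x = c \<odot> x \<oplus> d \<odot> x" "(c * d) \<odot> x = c \<odot> (d \<odot> x)"
    using V.smult_l_distr[of c d x] V.smult_assoc1[of c d x] x by simp_all
  show "y \<in> carrier V \<Longrightarrow> c \<odot> (x \<oplus> y) = c \<odot> x \<oplus> c \<odot> y"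
    using V.smult_r_distr[of c x y] x by simp
  show "\<ominus> x = (-1) \<odot> x"
    using V.smult_l_minus[of 1 x] V.smult_one x by simp
qed

lemma vs_minus:
  fixes V (structure)
  assumes "vs V" "x \<in> carrier V" "y \<in> carrier V"
  shows "x \<ominus> y = x \<oplus> (-1) \<odot> y"
  using assms by (simp add: a_minus_def vs_smult)

lemma vs_add_ac:
  fixes V (structure)
  assumes "vs V"
  shows "x \<in> carrier V \<Longrightarrow> y \<in> carrier V \<Longrightarrow> x \<oplus> y = y \<oplus> x"
    "x \<in> carrier V \<Longrightarrow> \<zero> \<oplus> x = x" "x \<in> carrier V \<Longrightarrow> x \<oplus> \<zero> = x"
    "x \<in> carrier V \<Longrightarrow> y \<in> carrier V \<Longrightarrow> z \<in> carrier V \<Longrightarrow> x \<oplus> y \<oplus> z = x \<oplus> (y \<oplus> z)"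
    "x \<in> carrier V \<Longrightarrow> y \<in> carrier V \<Longrightarrow> z \<in> carrier V \<Longrightarrow> x \<oplus> (y \<oplus> z) = y \<oplus> (x \<oplus> z)"
proof -
  interpret V: module "\<complex>\<F>" V by fact
  assume x: "x \<in> carrier V"
  show "\<zero> \<oplus> x = x" "x \<oplus> \<zero> = x" using x by simp_all
  assume y: "y \<in> carrier V"
  show "x \<oplus> y = y \<oplus> x" using x y by (simp add: V.a_ac)
  assume z: "z \<in> carrier V"
  show "x \<oplus> y \<oplus> z = x \<oplus> (y \<oplus> z)" "x \<oplus> (y \<oplus> z) = y \<oplus> (x \<oplus> z)"
    using x y z by (simp_all add: V.a_ac)
qed

lemma vs_diff:
  fixes V (structure)
  assumes "vs V"
  shows "x \<in> carrier V \<Longrightarrow> x \<ominus> x = \<zero>"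
    "x \<in> carrier V \<Longrightarrow> y \<in> carrier V \<Longrightarrow> x \<oplus> y \<ominus> x \<ominus> y = \<zero>"
    "x \<in> carrier V \<Longrightarrow> y \<in> carrier V \<Longrightarrow> x \<ominus> y = \<zero> \<longleftrightarrow> x = y"
    "x \<in> carrier V \<Longrightarrow> y \<in> carrier V \<Longrightarrow> z \<in> carrier V \<Longrightarrow>
      x \<ominus> y \<ominus> z = \<zero> \<longleftrightarrow> x = y \<oplus> z"
proof -
  interpret V: module "\<complex>\<F>" V by fact
  have 0: "x \<ominus> x = \<zero>" if "x \<in> carrier V" for x
    using that by (simp add: a_minus_def V.r_neg)
  assume x: "x \<in> carrier V"
  show "x \<ominus> x = \<zero>" using 0 x .
  assume y: "y \<in> carrier V"
  have "x \<oplus> y \<ominus> x \<ominus> y = (x \<oplus> y) \<ominus> (x \<oplus> y)"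
    using x y by (simp add: a_minus_def V.minus_add V.a_assoc)
  then show "x \<oplus> y \<ominus> x \<ominus> y = \<zero>" using 0 x y by simp
  have 1: "x \<ominus> y = \<zero> \<longleftrightarrow> x = y" if x: "x \<in> carrier V" and y: "y \<in> carrier V" for x y
  proof -
    have "(x \<ominus> y) \<oplus> y = x" using x y by (simp add: a_minus_def V.a_assoc V.l_neg)
    then show ?thesis using x y 0 by auto
  qed
  show "x \<ominus> y = \<zero> \<longleftrightarrow> x = y" by (rule 1[OF x y])
  assume z: "z \<in> carrier V"
  have "x \<ominus> y \<ominus> z = x \<ominus> (y \<oplus> z)"
    using x y z by (simp add: a_minus_def V.minus_add V.a_assoc)
  then show "x \<ominus> y \<ominus> z = \<zero> \<longleftrightarrow> x = y \<oplus> z" using 1 x y z by simp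
qed

section \<open>Subspaces and generation\<close>

text \<open>Negation is scaling by -1, so no clause for it is needed. The predicate looks only at
  the carrier and the linear operations, and so transfers between records that share them.\<close>

definition subsp :: "(complex, 'v) module \<Rightarrow> 'v set \<Rightarrow> bool"
  where "subsp V S \<longleftrightarrow> S \<subseteq> carrier V \<and> \<zero>\<^bsub>V\<^esub> \<in> S \<and> (\<forall>x\<in>S. \<forall>y\<in>S. x \<oplus>\<^bsub>V\<^esub> y \<in> S) \<and>
    (\<forall>c. \<forall>x\<in>S. c \<odot>\<^bsub>V\<^esub> x \<in> S)"

lemma subspI:
  assumes "S \<subseteq> carrier V" "\<zero>\<^bsub>V\<^esub> \<in> S" "\<And>x y. x \<in> S \<Longrightarrow> y \<in> S \<Longrightarrow> x \<oplus>\<^bsub>V\<^esub> y \<in> S"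
    "\<And>c x. x \<in> S \<Longrightarrow> c \<odot>\<^bsub>V\<^esub> x \<in> S"
  shows "subsp V S"
  using assms by (auto simp: subsp_def)

lemma subspD:
  assumes "subsp V S"
  shows "S \<subseteq> carrier V" "\<zero>\<^bsub>V\<^esub> \<in> S" "\<And>x y. x \<in> S \<Longrightarrow> y \<in> S \<Longrightarrow> x \<oplus>\<^bsub>V\<^esub> y \<in> S"
    "\<And>c x. x \<in> S \<Longrightarrow> c \<odot>\<^bsub>V\<^esub> x \<in> S"
  using assms by (auto simp: subsp_def)

lemma submodule_iff_subsp:
  assumes "vs V" shows "submodule S \<complex>\<F> V \<longleftrightarrow> subsp V S"
proof
  interpret V: module "\<complex>\<F>" V by fact
  show "subsp V S" if "submodule S \<complex>\<F> V"
    using V.submoduleE[OF that] that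
    by (intro subspI) (auto simp: submodule_def subgroup_def)
  show "submodule S \<complex>\<F> V" if S: "subsp V S"
  proof (rule V.submoduleI)
    fix a assume "a \<in> S"
    then show "\<ominus>\<^bsub>V\<^esub> a \<in> S"
      using subspD[OF S] vs_smult(7)[OF assms, of a] by auto
  qed (use subspD[OF S] in auto)
qed

lemma subsp_carrier: "vs V \<Longrightarrow> subsp V (carrier V)"
  by (intro subspI) (auto simp: vs_closed)

lemma subsp_lin_span:
  assumes "vs V" "S \<subseteq> carrier V"
  shows "subsp V (lin_span V S)" "S \<subseteq> lin_span V S"
  using subsp_carrier[OF assms(1)] assms(2)
  unfolding lin_span_def submodule_iff_subsp[OF assms(1)] subsp_def by blast+

lemma lin_span_minimal:
  assumes "vs V" "subsp V W" "S \<subseteq> W" shows "lin_span V S \<subseteq> W"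
  using assms unfolding lin_span_def submodule_iff_subsp[OF assms(1)] by blast

lemma vs_restrict:
  assumes "vs V" "subsp V S" shows "vs (V\<lparr>carrier := S\<rparr>)"
  using submodule.submodule_is_module[of S "\<complex>\<F>" V] assms by (simp add: submodule_iff_subsp)

text \<open>Spanning is phrased as an induction principle: a property that defines a subspace and
  holds on \<open>G\<close> holds everywhere. This avoids explicit finite linear
  combinations.\<close>

definition spans :: "(complex, 'v) module \<Rightarrow> 'v set \<Rightarrow> bool"
  where "spans V G \<longleftrightarrow> G \<subseteq> carrier V \<and> (\<forall>S. subsp V S \<longrightarrow> G \<subseteq> S \<longrightarrow> carrier V \<subseteq> S)"

lemma spansD: "spans V G \<Longrightarrow> subsp V S \<Longrightarrow> G \<subseteq> S \<Longrightarrow> x \<in> carrier V \<Longrightarrow> x \<in> S"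
  by (auto simp: spans_def)

section \<open>Linear and bilinear maps\<close>

definition lin :: "(complex, 'v) module \<Rightarrow> (complex, 'w) module \<Rightarrow> ('v \<Rightarrow> 'w) \<Rightarrow> bool"
  where "lin V W f \<longleftrightarrow> (\<forall>x\<in>carrier V. f x \<in> carrier W) \<and>
    (\<forall>x\<in>carrier V. \<forall>y\<in>carrier V. f (x \<oplus>\<^bsub>V\<^esub> y) = f x \<oplus>\<^bsub>W\<^esub> f y) \<and>
    (\<forall>c. \<forall>x\<in>carrier V. f (c \<odot>\<^bsub>V\<^esub> x) = c \<odot>\<^bsub>W\<^esub> f x)"

lemma linI:
  assumes "\<And>x. x \<in> carrier V \<Longrightarrow> f x \<in> carrier W"
    "\<And>x y. x \<in> carrier V \<Longrightarrow> y \<in> carrier V \<Longrightarrow> f (x \<oplus>\<^bsub>V\<^esub> y) = f x \<oplus>\<^bsub>W\<^esub> f y"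
    "\<And>c x. x \<in> carrier V \<Longrightarrow> f (c \<odot>\<^bsub>V\<^esub> x) = c \<odot>\<^bsub>W\<^esub> f x"
  shows "lin V W f"
  using assms by (auto simp: lin_def)

lemma linD:
  assumes "lin V W f"
  shows "\<And>x. x \<in> carrier V \<Longrightarrow> f x \<in> carrier W"
    "\<And>x y. x \<in> carrier V \<Longrightarrow> y \<in> carrier V \<Longrightarrow> f (x \<oplus>\<^bsub>V\<^esub> y) = f x \<oplus>\<^bsub>W\<^esub> f y"
    "\<And>c x. x \<in> carrier V \<Longrightarrow> f (c \<odot>\<^bsub>V\<^esub> x) = c \<odot>\<^bsub>W\<^esub> f x"
  using assms by (auto simp: lin_def)

lemma lin_zero:
  assumes "vs V" "vs W" "lin V W f" shows "f \<zero>\<^bsub>V\<^esub> = \<zero>\<^bsub>W\<^esub>"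
  using linD(3)[OF assms(3), of "\<zero>\<^bsub>V\<^esub>" 0] linD(1)[OF assms(3)] vs_closed(2)[OF assms(1)]
    vs_smult(1)[OF assms(1)] vs_smult(1)[OF assms(2)] by simp

lemma lin_minus:
  assumes "vs V" "vs W" "lin V W f" "x \<in> carrier V" "y \<in> carrier V"
  shows "f (x \<ominus>\<^bsub>V\<^esub> y) = f x \<ominus>\<^bsub>W\<^esub> f y"
  using assms by (simp add: vs_minus linD vs_closed)

lemma lin_cong:
  assumes "vs V" "lin V W f" "\<And>x. x \<in> carrier V \<Longrightarrow> f x = g x"
  shows "lin V W g"
  using assms(2) vs_closed[OF assms(1)] unfolding lin_def by (simp add: assms(3))

lemma lin_id: "lin V V (\<lambda>x. x)"
  by (rule linI) simp_all

lemma lin_comp: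
  assumes "lin V W f" "lin W U g" shows "lin V U (\<lambda>x. g (f x))"
  by (rule linI) (simp_all add: linD[OF assms(1)] linD[OF assms(2)])

lemma lin_const_zero: "vs W \<Longrightarrow> lin V W (\<lambda>x. \<zero>\<^bsub>W\<^esub>)"
  by (rule linI) (simp_all add: vs_closed vs_smult vs_add_ac)

lemma vs_add_swap:
  fixes V (structure)
  assumes "vs V" "a \<in> carrier V" "b \<in> carrier V" "c \<in> carrier V" "d \<in> carrier V"
  shows "(a \<oplus> b) \<oplus> (c \<oplus> d) = (a \<oplus> c) \<oplus> (b \<oplus> d)"
proof -
  interpret V: module "\<complex>\<F>" V by fact
  show ?thesis using assms by (simp add: V.a_ac)
qed

lemma lin_plus:
  assumes "vs W" "lin V W f" "lin V W g" shows "lin V W (\<lambda>x. f x \<oplus>\<^bsub>W\<^esub> g x)"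
  by (rule linI) (simp_all add: linD[OF assms(2)] linD[OF assms(3)] vs_closed[OF assms(1)]
      vs_add_swap[OF assms(1)] vs_smult(5)[OF assms(1)])

lemma lin_scale:
  assumes "vs W" "lin V W f" shows "lin V W (\<lambda>x. c \<odot>\<^bsub>W\<^esub> f x)"
proof (rule linI)
  fix d x assume x: "x \<in> carrier V"
  have "c \<odot>\<^bsub>W\<^esub> (d \<odot>\<^bsub>W\<^esub> f x) = d \<odot>\<^bsub>W\<^esub> (c \<odot>\<^bsub>W\<^esub> f x)"
    using vs_smult(4)[OF assms(1) linD(1)[OF assms(2) x]] by (metis mult.commute)
  then show "c \<odot>\<^bsub>W\<^esub> f (d \<odot>\<^bsub>V\<^esub> x) = d \<odot>\<^bsub>W\<^esub> (c \<odot>\<^bsub>W\<^esub> f x)"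
    by (simp add: linD[OF assms(2)] x)
qed (simp_all add: linD[OF assms(2)] vs_closed[OF assms(1)] vs_smult(5)[OF assms(1)])

lemma lin_smult_vec:
  assumes "vs W" "w \<in> carrier W" "lin V complex_line f"
  shows "lin V W (\<lambda>x. f x \<odot>\<^bsub>W\<^esub> w)"
  using assms linD[OF assms(3)]
  by (intro linI) (simp_all add: vs_closed vs_smult complex_line_def ring.defs module.defs)

text \<open>Supplies the closure half of an induction along \<open>spansD\<close> when the goal is
  that a linear map sends everything into \<open>S\<close>.\<close>

lemma subsp_vimage:
  assumes "vs V" "vs W" "lin V W f" "subsp W S"
  shows "subsp V {x \<in> carrier V. f x \<in> S}"
  using subspD[OF assms(4)] linD[OF assms(3)] lin_zero[OF assms(1-3)] vs_closed[OF assms(1)]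
  by (intro subspI) auto

lemma subsp_image:
  assumes "vs V" "vs W" "lin V W f"
  shows "subsp W (f ` carrier V)"
proof (rule subspI)
  show "\<zero>\<^bsub>W\<^esub> \<in> f ` carrier V"
    using lin_zero[OF assms] vs_closed(2)[OF assms(1)] by (metis imageI)
qed (use linD[OF assms(3)] vs_closed[OF assms(1)] in \<open>auto simp flip: linD(2,3)[OF assms(3)]\<close>)

lemma subsp_zero: "vs V \<Longrightarrow> subsp V {\<zero>\<^bsub>V\<^esub>}"
  by (rule subspI) (auto simp: vs_closed vs_add_ac vs_smult)

lemma subsp_equalizer:
  assumes "vs V" "vs W" "lin V W f" "lin V W g"
  shows "subsp V {x \<in> carrier V. f x = g x}"
  using linD[OF assms(3)] linD[OF assms(4)] lin_zero[OF assms(1-3)] lin_zero[OF assms(1,2,4)]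
    vs_closed[OF assms(1)]
  by (intro subspI) auto

lemma lin_eq_on_spans:
  assumes "vs V" "vs W" "lin V W f" "lin V W g" "spans V G" "\<And>x. x \<in> G \<Longrightarrow> f x = g x"
    "x \<in> carrier V"
  shows "f x = g x"
  using spansD[OF assms(5) subsp_equalizer[OF assms(1-4)]] assms(5-7) by (auto simp: spans_def)

lemma spans_lin_image:
  assumes "vs V" "vs W" "lin V W f" "spans V G" "f ` carrier V = carrier W"
  shows "spans W (f ` G)"
  unfolding spans_def
proof (intro conjI allI impI)
  show "f ` G \<subseteq> carrier W" using assms by (auto simp: spans_def)
  fix S assume S: "subsp W S" "f ` G \<subseteq> S"
  have "carrier V \<subseteq> {x \<in> carrier V. f x \<in> S}"
    using spansD[OF assms(4) subsp_vimage[OF assms(1-3) S(1)]] S(2) assms(4)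
    by (auto simp: spans_def)
  then have "f ` carrier V \<subseteq> S" by auto
  then show "carrier W \<subseteq> S" using assms(5) by simp
qed

section \<open>Bilinear maps\<close>

definition bilin ::
  "(complex, 'v) module \<Rightarrow> (complex, 'w) module \<Rightarrow> (complex, 'u) module \<Rightarrow> ('v \<Rightarrow> 'w \<Rightarrow> 'u) \<Rightarrow> bool"
  where "bilin V W U b \<longleftrightarrow> (\<forall>v\<in>carrier V. lin W U (b v)) \<and> (\<forall>w\<in>carrier W. lin V U (\<lambda>v. b v w))"

lemma bilinI:
  assumes "\<And>v. v \<in> carrier V \<Longrightarrow> lin W U (b v)" "\<And>w. w \<in> carrier W \<Longrightarrow> lin V U (\<lambda>v. b v w)"
  shows "bilin V W U b"
  using assms by (simp add: bilin_def)

lemma bilinD: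
  assumes "bilin V W U b"
  shows "\<And>v. v \<in> carrier V \<Longrightarrow> lin W U (b v)" "\<And>w. w \<in> carrier W \<Longrightarrow> lin V U (\<lambda>v. b v w)"
    "\<And>v w. v \<in> carrier V \<Longrightarrow> w \<in> carrier W \<Longrightarrow> b v w \<in> carrier U"
  using assms by (auto simp: bilin_def dest: linD)

text \<open>For fixed \<open>w\<close> and \<open>w'\<close> both sides of the additivity law are
  linear in \<open>v\<close>, so the law need only be checked on \<open>G\<close>; likewise for
  scalars. This repairs maps obtained by choosing, for each \<open>w\<close>, a linear map in
  \<open>v\<close>, whose dependence on \<open>w\<close> is not linear by construction.\<close>

lemma lin_on_spans:
  assumes "vs V" "vs W" "vs U" "spans V G" "\<And>w. w \<in> carrier W \<Longrightarrow> lin V U (\<lambda>v. b v w)"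
    "\<And>v. v \<in> G \<Longrightarrow> lin W U (b v)" "v \<in> carrier V"
  shows "lin W U (b v)"
proof -
  have G: "v \<in> carrier V" if "v \<in> G" for v using assms(4) that by (auto simp: spans_def)
  have cl: "b v w \<in> carrier U" if "v \<in> carrier V" "w \<in> carrier W" for v w
    using linD(1)[OF assms(5)] that by simp
  show ?thesis
  proof (rule linI)
    fix w w' assume w: "w \<in> carrier W" "w' \<in> carrier W"
    show "b v (w \<oplus>\<^bsub>W\<^esub> w') = b v w \<oplus>\<^bsub>U\<^esub> b v w'"
      by (rule lin_eq_on_spans[OF assms(1,3) assms(5) lin_plus[OF assms(3) assms(5) assms(5)]
            assms(4) _ assms(7)])
        (use w assms(6) in \<open>auto simp: vs_closed[OF assms(2)] linD\<close>)
  next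
    fix c w assume w: "w \<in> carrier W"
    show "b v (c \<odot>\<^bsub>W\<^esub> w) = c \<odot>\<^bsub>U\<^esub> b v w"
      by (rule lin_eq_on_spans[OF assms(1,3) assms(5) lin_scale[OF assms(3) assms(5)]
            assms(4) _ assms(7)])
        (use w assms(6) in \<open>auto simp: vs_closed[OF assms(2)] linD\<close>)
  qed (use cl assms(7) in auto)
qed

lemma bilin_on_spans:
  assumes "vs V" "vs W" "vs U" "spans V G" "\<And>w. w \<in> carrier W \<Longrightarrow> lin V U (\<lambda>v. b v w)"
    "\<And>v. v \<in> G \<Longrightarrow> lin W U (b v)"
  shows "bilin V W U b"
  using lin_on_spans[OF assms(1-4), of b] assms(5,6) by (auto intro: bilinI)

lemma bilin_comp_left:
  assumes "bilin V W U b" "lin V' V f" shows "bilin V' W U (\<lambda>v. b (f v))"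
  by (intro bilinI bilinD(1)[OF assms(1)] linD(1)[OF assms(2)]
      lin_comp[OF assms(2) bilinD(2)[OF assms(1)]])

lemma bilin_comp_right:
  assumes "bilin V W U b" "lin W' W f" shows "bilin V W' U (\<lambda>v w. b v (f w))"
  by (intro bilinI bilinD(2)[OF assms(1)] linD(1)[OF assms(2)]
      lin_comp[OF assms(2) bilinD(1)[OF assms(1)]])

lemma bilin_comp_target:
  assumes "bilin V W U b" "lin U U' f" shows "bilin V W U' (\<lambda>v w. f (b v w))"
  by (intro bilinI lin_comp[OF _ assms(2)] bilinD[OF assms(1)])

lemma bilin_plus:
  assumes "vs U" "bilin V W U b" "bilin V W U b'"
  shows "bilin V W U (\<lambda>v w. b v w \<oplus>\<^bsub>U\<^esub> b' v w)"
  by (intro bilinI lin_plus[OF assms(1)] bilinD[OF assms(2)] bilinD[OF assms(3)])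

section \<open>Quotients\<close>

lemma abelian_subgroup_subsp:
  assumes "vs V" "subsp V W" shows "abelian_subgroup W V"
proof -
  interpret V: module "\<complex>\<F>" V by fact
  show ?thesis
    using assms V.abelian_group_axioms
    by (intro abelian_subgroupI3) (simp_all add: additive_subgroup_def submodule.axioms(1)
        flip: submodule_iff_subsp)
qed

lemma coset_eq_iff:
  assumes "vs V" "subsp V W" "x \<in> carrier V" "y \<in> carrier V"
  shows "W +>\<^bsub>V\<^esub> x = W +>\<^bsub>V\<^esub> y \<longleftrightarrow> (\<exists>w\<in>W. x = w \<oplus>\<^bsub>V\<^esub> y)"
proof -
  interpret W: abelian_subgroup W V by (rule abelian_subgroup_subsp[OF assms(1,2)])
  have "x \<in> W +>\<^bsub>V\<^esub> y \<longleftrightarrow> (\<exists>w\<in>W. x = w \<oplus>\<^bsub>V\<^esub> y)"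
    by (auto simp: a_r_coset_def r_coset_def)
  then show ?thesis
    using W.a_repr_independence' W.a_rcos_self assms by metis
qed

lemma coset_zero:
  assumes "vs V" "subsp V W" shows "W +>\<^bsub>V\<^esub> \<zero>\<^bsub>V\<^esub> = W"
proof -
  interpret W: abelian_subgroup W V by (rule abelian_subgroup_subsp[OF assms])
  show ?thesis using W.a_rcos_const subspD(2)[OF assms(2)] by simp
qed

lemma quotient_space_simps:
  assumes "vs V" "subsp V W"
  shows "carrier (quotient_space V W) = (\<lambda>x. W +>\<^bsub>V\<^esub> x) ` carrier V"
    and "\<zero>\<^bsub>quotient_space V W\<^esub> = W +>\<^bsub>V\<^esub> \<zero>\<^bsub>V\<^esub>"
    and "\<lbrakk>x \<in> carrier V; y \<in> carrier V\<rbrakk> \<Longrightarrow>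
      (W +>\<^bsub>V\<^esub> x) \<oplus>\<^bsub>quotient_space V W\<^esub> (W +>\<^bsub>V\<^esub> y) = W +>\<^bsub>V\<^esub> (x \<oplus>\<^bsub>V\<^esub> y)"
    and "x \<in> carrier V \<Longrightarrow> c \<odot>\<^bsub>quotient_space V W\<^esub> (W +>\<^bsub>V\<^esub> x) = W +>\<^bsub>V\<^esub> (c \<odot>\<^bsub>V\<^esub> x)"
proof -
  interpret W: abelian_subgroup W V by (rule abelian_subgroup_subsp[OF assms])
  note * = quotient_space_def FactRing_def ring.defs module.defs
  show "carrier (quotient_space V W) = (\<lambda>x. W +>\<^bsub>V\<^esub> x) ` carrier V"
    by (auto simp: * A_RCOSETS_def RCOSETS_def a_r_coset_def)
  show "\<zero>\<^bsub>quotient_space V W\<^esub> = W +>\<^bsub>V\<^esub> \<zero>\<^bsub>V\<^esub>"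
    by (simp add: * coset_zero[OF assms])
  show "(W +>\<^bsub>V\<^esub> x) \<oplus>\<^bsub>quotient_space V W\<^esub> (W +>\<^bsub>V\<^esub> y) = W +>\<^bsub>V\<^esub> (x \<oplus>\<^bsub>V\<^esub> y)"
    if "x \<in> carrier V" "y \<in> carrier V"
    using that by (simp add: * W.a_rcos_sum)
  show "c \<odot>\<^bsub>quotient_space V W\<^esub> (W +>\<^bsub>V\<^esub> x) = W +>\<^bsub>V\<^esub> (c \<odot>\<^bsub>V\<^esub> x)" if x: "x \<in> carrier V"
  proof -
    \<comment> \<open>A scalar multiple of a coset is defined as a union over its representatives.
      All members of that union coincide, and the coset is nonempty, so the union is the single
      expected coset.\<close>
    have "W +>\<^bsub>V\<^esub> (c \<odot>\<^bsub>V\<^esub> z) = W +>\<^bsub>V\<^esub> (c \<odot>\<^bsub>V\<^esub> x)" if "z \<in> W +>\<^bsub>V\<^esub> x" for z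
    proof -
      from that obtain w where w: "w \<in> W" "z = w \<oplus>\<^bsub>V\<^esub> x"
        by (auto simp: a_r_coset_def r_coset_def)
      then have "c \<odot>\<^bsub>V\<^esub> z = (c \<odot>\<^bsub>V\<^esub> w) \<oplus>\<^bsub>V\<^esub> (c \<odot>\<^bsub>V\<^esub> x)"
        using x subspD(1)[OF assms(2)] by (auto simp: vs_smult(5)[OF assms(1)])
      then show ?thesis
        using w x subspD[OF assms(2)]
        by (subst coset_eq_iff[OF assms]) (auto simp: vs_closed[OF assms(1)])
    qed
    then have "(\<Union>z\<in>W +>\<^bsub>V\<^esub> x. W +>\<^bsub>V\<^esub> (c \<odot>\<^bsub>V\<^esub> z)) = W +>\<^bsub>V\<^esub> (c \<odot>\<^bsub>V\<^esub> x)"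
      using W.a_rcos_self[OF x] by blast
    then show ?thesis by (simp add: *)
  qed
qed

text \<open>The vector space laws pass along any surjection that respects the operations, without
  \<open>Q\<close> being known to be a space. With the coset map this treats quotients; with the
  identity it passes between records that differ only in \<open>mult\<close> and
  \<open>one\<close>.\<close>

lemma vs_image:
  fixes V (structure) and Q
  assumes V: "vs V"
    and q: "carrier Q = p ` carrier V" "\<zero>\<^bsub>Q\<^esub> = p \<zero>"
      "\<And>x y. \<lbrakk>x \<in> carrier V; y \<in> carrier V\<rbrakk> \<Longrightarrow> p x \<oplus>\<^bsub>Q\<^esub> p y = p (x \<oplus> y)"
      "\<And>c x. x \<in> carrier V \<Longrightarrow> c \<odot>\<^bsub>Q\<^esub> p x = p (c \<odot> x)"
  shows "vs Q"
proof -
  note a = q(2-) vs_closed[OF V] vs_add_ac[OF V] and m = q(2-) vs_closed[OF V] vs_smult[OF V]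
  show ?thesis
    apply (rule vsI; (unfold q(1))?)
              apply (elim imageE, hypsubst, simp add: q vs_closed[OF V] imageI)
             apply (simp add: q vs_closed[OF V] imageI)
            apply (elim imageE, hypsubst, simp add: q vs_closed[OF V] imageI)
           apply (elim imageE, hypsubst, simp add: a)
          apply (elim imageE, hypsubst, simp add: a)
         apply (elim imageE, hypsubst, simp add: a)
        apply (elim imageE, hypsubst, simp add: m)+
    done
qed

lemma vs_quotient_space:
  assumes "vs V" "subsp V W" shows "vs (quotient_space V W)"
  by (rule vs_image[OF assms(1) quotient_space_simps[OF assms]])

lemma lin_coset:
  assumes "vs V" "subsp V W" shows "lin V (quotient_space V W) (\<lambda>x. W +>\<^bsub>V\<^esub> x)"
  by (rule linI) (simp_all add: quotient_space_simps[OF assms])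

lemma spans_quotient_space:
  assumes "vs V" "subsp V W" "spans V G"
  shows "spans (quotient_space V W) ((\<lambda>x. W +>\<^bsub>V\<^esub> x) ` G)"
  using assms
  by (intro spans_lin_image[OF assms(1) vs_quotient_space lin_coset])
    (simp_all add: quotient_space_simps)

lemma lin_quotient_lift:
  assumes "vs V" "subsp V W" "vs U" "lin V U f" "\<And>w. w \<in> W \<Longrightarrow> f w = \<zero>\<^bsub>U\<^esub>"
  obtains g where "lin (quotient_space V W) U g" "\<And>x. x \<in> carrier V \<Longrightarrow> g (W +>\<^bsub>V\<^esub> x) = f x"
proof -
  define g where "g Y = f (SOME x. x \<in> carrier V \<and> W +>\<^bsub>V\<^esub> x = Y)" for Y
  have g: "g (W +>\<^bsub>V\<^esub> x) = f x" if x: "x \<in> carrier V" for x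
  proof -
    define y where "y = (SOME y. y \<in> carrier V \<and> W +>\<^bsub>V\<^esub> y = W +>\<^bsub>V\<^esub> x)"
    have y: "y \<in> carrier V" "W +>\<^bsub>V\<^esub> y = W +>\<^bsub>V\<^esub> x"
      using someI[of "\<lambda>y. y \<in> carrier V \<and> W +>\<^bsub>V\<^esub> y = W +>\<^bsub>V\<^esub> x" x] x
      unfolding y_def by auto
    then obtain w where w: "w \<in> W" "y = w \<oplus>\<^bsub>V\<^esub> x"
      using coset_eq_iff[OF assms(1,2)] x by blast
    have "f y = f x"
      using w x subspD(1)[OF assms(2)] linD(1)[OF assms(4) x]
      by (auto simp: linD(2)[OF assms(4)] assms(5) vs_add_ac(2)[OF assms(3)])
    then show ?thesis by (simp add: g_def y_def)
  qed
  show thesis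
  proof (rule that)
    show "lin (quotient_space V W) U g"
      by (rule linI)
        (auto simp: quotient_space_simps[OF assms(1,2)] g linD[OF assms(4)] vs_closed[OF assms(1)])
  qed (rule g)
qed

section \<open>Free spaces\<close>

lemma lookup_map_times [simp]:
  "Poly_Mapping.lookup (Poly_Mapping.map ((*) c) p) x = c * Poly_Mapping.lookup p x"
  for c :: complex
  by (simp add: Poly_Mapping.map.rep_eq when_def)

lemma keys_map_times: "Poly_Mapping.keys (Poly_Mapping.map ((*) c) p) \<subseteq> Poly_Mapping.keys p"
  for c :: complex
  by (auto simp: in_keys_iff)

lemma vs_free_space: "vs (free_space Y)"
proof (rule vsI)
  show "x \<oplus>\<^bsub>free_space Y\<^esub> y \<in> carrier (free_space Y)"
    if "x \<in> carrier (free_space Y)" "y \<in> carrier (free_space Y)" for x y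
    using that keys_add[of x y] by (auto simp: free_space_def)
  show "c \<odot>\<^bsub>free_space Y\<^esub> x \<in> carrier (free_space Y)"
    if "x \<in> carrier (free_space Y)" for c x
    using that keys_map_times[of c x] by (auto simp: free_space_def)
qed (auto simp: free_space_def lookup_add algebra_simps intro!: poly_mapping_eqI)

lemma spans_free_space: "spans (free_space Y) ((\<lambda>y. Poly_Mapping.single y 1) ` Y)"
  unfolding spans_def
proof (intro conjI allI impI subsetI)
  fix x assume "x \<in> (\<lambda>y. Poly_Mapping.single y (1::complex)) ` Y"
  then show "x \<in> carrier (free_space Y)" by (auto simp: free_space_def)
next
  fix S p
  assume S: "subsp (free_space Y) S" "(\<lambda>y. Poly_Mapping.single y 1) ` Y \<subseteq> S"
    and "p \<in> carrier (free_space Y)"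
  then have "Poly_Mapping.keys p \<subseteq> Y" by (simp add: free_space_def)
  then show "p \<in> S"
  proof (induction p rule: Poly_Mapping.update_induct)
    case const
    then show ?case using subspD(2)[OF S(1)] by (simp add: free_space_def)
  next
    case (update f a b)
    \<comment> \<open>The key \<open>a\<close> is fresh for \<open>f\<close>, so the update is a
      sum; this turns induction over the support into closure under addition and scaling.\<close>
    have "Poly_Mapping.update a b f = f + Poly_Mapping.map ((*) b) (Poly_Mapping.single a 1)"
      using update(1)
      by (intro poly_mapping_eqI)
        (auto simp: lookup_update lookup_add lookup_single when_def in_keys_iff)
    moreover have "a \<in> Y" "Poly_Mapping.keys f \<subseteq> Y"
      using update(1,2,4) by (auto simp: keys_update)
    moreover have "Poly_Mapping.single a 1 \<in> S" using \<open>a \<in> Y\<close> S(2) by auto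
    then have "Poly_Mapping.map ((*) b) (Poly_Mapping.single a 1) \<in> S"
      using subspD(4)[OF S(1)] by (simp add: free_space_def del: map_single)
    ultimately show ?case
      using update(3) subspD(3)[OF S(1)] by (simp add: free_space_def del: map_single)
  qed
qed

lemma lin_free_ext:
  assumes "vs W" "\<And>y. y \<in> Y \<Longrightarrow> g y \<in> carrier W"
  obtains f where "lin (free_space Y) W f" "\<And>y. y \<in> Y \<Longrightarrow> f (Poly_Mapping.single y 1) = g y"
proof -
  interpret W: module "\<complex>\<F>" W by fact
  define f where "f p = (\<Oplus>\<^bsub>W\<^esub>y\<in>Poly_Mapping.keys p. Poly_Mapping.lookup p y \<odot>\<^bsub>W\<^esub> g y)" for p
  \<comment> \<open>Enlarging the range of summation only adds zero terms. The sums for two elements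
    and for their sum can thus be compared over one common index set.\<close>
  have f: "f p = (\<Oplus>\<^bsub>W\<^esub>y\<in>A. Poly_Mapping.lookup p y \<odot>\<^bsub>W\<^esub> g y)"
    if "finite A" "Poly_Mapping.keys p \<subseteq> A" "A \<subseteq> Y" for p A
    unfolding f_def
    by (rule W.add.finprod_mono_neutral_cong_left)
      (use that assms(2) in \<open>auto simp: in_keys_iff vs_smult(1)[OF assms(1)] vs_closed[OF assms(1)]\<close>)
  show thesis
  proof (rule that)
    show "lin (free_space Y) W f"
    proof (rule linI)
      fix p assume p: "p \<in> carrier (free_space Y)"
      then show "f p \<in> carrier W"
        unfolding f_def using assms(2)
        by (intro W.finsum_closed) (auto simp: free_space_def vs_closed[OF assms(1)])
      fix c
      have pY: "Poly_Mapping.keys p \<subseteq> Y" using p by (simp add: free_space_def)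
      have gc: "(\<lambda>y. Poly_Mapping.lookup p y \<odot>\<^bsub>W\<^esub> g y) \<in> Poly_Mapping.keys p \<rightarrow> carrier W"
        using pY assms(2) by (auto simp: vs_closed[OF assms(1)])
      have "f (c \<odot>\<^bsub>free_space Y\<^esub> p) =
        (\<Oplus>\<^bsub>W\<^esub>y\<in>Poly_Mapping.keys p. (c * Poly_Mapping.lookup p y) \<odot>\<^bsub>W\<^esub> g y)"
        using pY keys_map_times[of c p] by (simp add: f[of "Poly_Mapping.keys p"] free_space_def)
      also have "\<dots> = (\<Oplus>\<^bsub>W\<^esub>y\<in>Poly_Mapping.keys p. c \<odot>\<^bsub>W\<^esub> (Poly_Mapping.lookup p y \<odot>\<^bsub>W\<^esub> g y))"
        using pY assms(2)
        by (intro W.finsum_cong') (auto simp: vs_smult(4)[OF assms(1)] vs_closed[OF assms(1)])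
      also have "\<dots> = c \<odot>\<^bsub>W\<^esub> f p"
        unfolding f_def using W.finsum_smult_ldistr[of "Poly_Mapping.keys p" c] gc by simp
      finally show "f (c \<odot>\<^bsub>free_space Y\<^esub> p) = c \<odot>\<^bsub>W\<^esub> f p" .
    next
      fix p q assume "p \<in> carrier (free_space Y)" "q \<in> carrier (free_space Y)"
      then have pY: "Poly_Mapping.keys p \<union> Poly_Mapping.keys q \<subseteq> Y" by (simp add: free_space_def)
      let ?A = "Poly_Mapping.keys p \<union> Poly_Mapping.keys q"
      have "f (p \<oplus>\<^bsub>free_space Y\<^esub> q) =
        (\<Oplus>\<^bsub>W\<^esub>y\<in>?A. (Poly_Mapping.lookup p y + Poly_Mapping.lookup q y) \<odot>\<^bsub>W\<^esub> g y)"
        using pY keys_add[of p q] by (simp add: f[of ?A] free_space_def lookup_add)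
      also have "\<dots> = (\<Oplus>\<^bsub>W\<^esub>y\<in>?A. Poly_Mapping.lookup p y \<odot>\<^bsub>W\<^esub> g y \<oplus>\<^bsub>W\<^esub>
          Poly_Mapping.lookup q y \<odot>\<^bsub>W\<^esub> g y)"
        using pY assms(2)
        by (intro W.finsum_cong') (auto simp: vs_smult(3)[OF assms(1)] vs_closed[OF assms(1)])
      also have "\<dots> = f p \<oplus>\<^bsub>W\<^esub> f q"
        using pY assms(2)
        by (subst W.finsum_addf) (auto simp: f[of ?A] vs_closed[OF assms(1)])
      finally show "f (p \<oplus>\<^bsub>free_space Y\<^esub> q) = f p \<oplus>\<^bsub>W\<^esub> f q" .
    qed
    show "f (Poly_Mapping.single y 1) = g y" if "y \<in> Y" for y
      using f[of "{y}" "Poly_Mapping.single y 1"] that assms(2)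
      by (simp add: vs_smult(2)[OF assms(1)])
  qed
qed

section \<open>Tensor products\<close>

lemma single_in_free_space: "y \<in> Y \<Longrightarrow> Poly_Mapping.single y c \<in> carrier (free_space Y)"
  by (auto simp: free_space_def)

lemma free_space_diff_closed:
  assumes "p \<in> carrier (free_space Y)" "q \<in> carrier (free_space Y)"
  shows "p - q \<in> carrier (free_space Y)"
  using assms keys_diff[of p q] by (auto simp: free_space_def)

lemma tensor_relations_closed:
  assumes "vs V" "vs W"
  shows "tensor_relations V W \<subseteq> carrier (free_space (carrier V \<times> carrier W))"
  unfolding tensor_relations_def
  by (auto intro!: free_space_diff_closed single_in_free_space
      simp: vs_closed[OF assms(1)] vs_closed[OF assms(2)])

lemma subsp_tensor_kernel:
  assumes "vs V" "vs W"
  shows "subsp (free_space (carrier V \<times> carrier W)) (tensor_kernel V W)"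
    "tensor_relations V W \<subseteq> tensor_kernel V W"
  unfolding tensor_kernel_def
  by (intro subsp_lin_span vs_free_space tensor_relations_closed assms)+

lemma vs_tensor: "vs V \<Longrightarrow> vs W \<Longrightarrow> vs (tensor V W)"
  unfolding tensor_def by (intro vs_quotient_space vs_free_space subsp_tensor_kernel)

lemma spans_tensor:
  assumes "vs V" "vs W"
  shows "spans (tensor V W) {pure_tensor V W v w | v w. v \<in> carrier V \<and> w \<in> carrier W}"
proof -
  have "{pure_tensor V W v w | v w. v \<in> carrier V \<and> w \<in> carrier W} =
    (\<lambda>x. tensor_kernel V W +>\<^bsub>free_space (carrier V \<times> carrier W)\<^esub> x) `
      (\<lambda>y. Poly_Mapping.single y 1) ` (carrier V \<times> carrier W)"
    by (auto simp: pure_tensor_def image_image)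
  then show ?thesis
    unfolding tensor_def
    using spans_quotient_space[OF vs_free_space subsp_tensor_kernel(1)[OF assms] spans_free_space]
    by simp
qed

text \<open>The four families of \<open>tensor_relations\<close> are the additivity and homogeneity
  laws of the two arguments, so each law amounts to two free vectors having the same coset.\<close>

lemma bilin_pure_tensor:
  assumes "vs V" "vs W" shows "bilin V W (tensor V W) (pure_tensor V W)"
proof -
  let ?F = "free_space (carrier V \<times> carrier W)"
  let ?K = "tensor_kernel V W"
  let ?s = "\<lambda>v w c. Poly_Mapping.single (v, w) c :: _ \<Rightarrow>\<^sub>0 complex"
  note K = vs_free_space subsp_tensor_kernel(1)[OF assms]
  have eq: "?K +>\<^bsub>?F\<^esub> x = ?K +>\<^bsub>?F\<^esub> y"
    if "x \<in> carrier ?F" "y \<in> carrier ?F" "x - y \<in> tensor_relations V W" for x y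
    unfolding coset_eq_iff[OF K that(1,2)]
    using that(3) subsp_tensor_kernel(2)[OF assms]
    by (intro bexI[of _ "x - y"]) (auto simp: free_space_def)
  have cl: "?s v w c \<in> carrier ?F" if "v \<in> carrier V" "w \<in> carrier W" for v w c
    using that by (simp add: single_in_free_space)
  have pc: "pure_tensor V W v w \<in> carrier (tensor V W)"
    if "v \<in> carrier V" "w \<in> carrier W" for v w
    using cl[OF that] unfolding pure_tensor_def tensor_def quotient_space_simps[OF K] by blast
  have plus: "pure_tensor V W v w \<oplus>\<^bsub>tensor V W\<^esub> pure_tensor V W v' w' =
      ?K +>\<^bsub>?F\<^esub> (?s v w 1 + ?s v' w' 1)"
    if "v \<in> carrier V" "w \<in> carrier W" "v' \<in> carrier V" "w' \<in> carrier W" for v w v' w'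
    using cl that unfolding pure_tensor_def tensor_def
    by (simp add: quotient_space_simps[OF K]) (simp add: free_space_def)
  have plus_cl: "?s v w 1 + ?s v' w' 1 \<in> carrier ?F"
    if "v \<in> carrier V" "w \<in> carrier W" "v' \<in> carrier V" "w' \<in> carrier W" for v w v' w'
    using vs_closed(1)[OF vs_free_space cl cl] that by (simp add: free_space_def)
  have scale: "c \<odot>\<^bsub>tensor V W\<^esub> pure_tensor V W v w = ?K +>\<^bsub>?F\<^esub> ?s v w c"
    if "v \<in> carrier V" "w \<in> carrier W" for c v w
    using cl that unfolding pure_tensor_def tensor_def
    by (simp add: quotient_space_simps[OF K]) (simp add: free_space_def)
  show ?thesis
  proof (intro bilinI linI)
    fix v w v' assume v: "w \<in> carrier W" "v \<in> carrier V" "v' \<in> carrier V"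
    have "?s (v \<oplus>\<^bsub>V\<^esub> v') w 1 - (?s v w 1 + ?s v' w 1) \<in> tensor_relations V W"
      using v unfolding tensor_relations_def by (auto simp: diff_diff_eq[symmetric])
    then show "pure_tensor V W (v \<oplus>\<^bsub>V\<^esub> v') w =
        pure_tensor V W v w \<oplus>\<^bsub>tensor V W\<^esub> pure_tensor V W v' w"
      using v cl plus_cl unfolding plus[OF v(2,1,3,1)] unfolding pure_tensor_def
      by (intro eq) (auto simp: vs_closed[OF assms(1)])
  next
    fix v w w' assume v: "v \<in> carrier V" "w \<in> carrier W" "w' \<in> carrier W"
    have "?s v (w \<oplus>\<^bsub>W\<^esub> w') 1 - (?s v w 1 + ?s v w' 1) \<in> tensor_relations V W"
      using v unfolding tensor_relations_def by (auto simp: diff_diff_eq[symmetric])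
    then show "pure_tensor V W v (w \<oplus>\<^bsub>W\<^esub> w') =
        pure_tensor V W v w \<oplus>\<^bsub>tensor V W\<^esub> pure_tensor V W v w'"
      using v cl plus_cl unfolding plus[OF v(1,2,1,3)] unfolding pure_tensor_def
      by (intro eq) (auto simp: vs_closed[OF assms(2)])
  next
    fix c v w assume v: "w \<in> carrier W" "v \<in> carrier V"
    have "?s (c \<odot>\<^bsub>V\<^esub> v) w 1 - ?s v w c \<in> tensor_relations V W"
      using v unfolding tensor_relations_def by blast
    then show "pure_tensor V W (c \<odot>\<^bsub>V\<^esub> v) w = c \<odot>\<^bsub>tensor V W\<^esub> pure_tensor V W v w"
      using v cl unfolding scale[OF v(2,1)] unfolding pure_tensor_def
      by (intro eq) (auto simp: vs_closed[OF assms(1)])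
  next
    fix c v w assume v: "v \<in> carrier V" "w \<in> carrier W"
    have "?s v (c \<odot>\<^bsub>W\<^esub> w) 1 - ?s v w c \<in> tensor_relations V W"
      using v unfolding tensor_relations_def by blast
    then show "pure_tensor V W v (c \<odot>\<^bsub>W\<^esub> w) = c \<odot>\<^bsub>tensor V W\<^esub> pure_tensor V W v w"
      using v cl unfolding scale[OF v] unfolding pure_tensor_def
      by (intro eq) (auto simp: vs_closed[OF assms(2)])
  qed (rule pc; assumption)+
qed

text \<open>The defining relations are written with the type class subtraction of finitely supported
  functions, whereas \<open>lin\<close> speaks of the record operations; this connects the
  two.\<close>

lemma lin_free_diff:
  assumes "vs U" "lin (free_space Y) U f" "p \<in> carrier (free_space Y)" "q \<in> carrier (free_space Y)"
  shows "f (p - q) = f p \<ominus>\<^bsub>U\<^esub> f q"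
proof -
  have "p - q = p \<ominus>\<^bsub>free_space Y\<^esub> q"
    unfolding vs_minus[OF vs_free_space assms(3,4)]
    by (auto simp: free_space_def lookup_minus lookup_add intro!: poly_mapping_eqI)
  then show ?thesis using lin_minus[OF vs_free_space assms(1,2)] assms by simp
qed

text \<open>The universal property of the tensor product: the linear extension of \<open>b\<close>
  to the free space kills the relations because \<open>b\<close> is bilinear, and hence kills their
  span.\<close>

lemma lin_tensor_ext:
  assumes "vs V" "vs W" "vs U" "bilin V W U b"
  obtains g where "lin (tensor V W) U g"
    "\<And>v w. v \<in> carrier V \<Longrightarrow> w \<in> carrier W \<Longrightarrow> g (pure_tensor V W v w) = b v w"
proof -
  let ?F = "free_space (carrier V \<times> carrier W)"
  have b_cl: "b v w \<in> carrier U" if "v \<in> carrier V" "w \<in> carrier W" for v w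
    using bilinD(3)[OF assms(4)] that .
  obtain f where f: "lin ?F U f"
      "\<And>y. y \<in> carrier V \<times> carrier W \<Longrightarrow> f (Poly_Mapping.single y 1) = b (fst y) (snd y)"
    by (rule lin_free_ext[OF assms(3), of "carrier V \<times> carrier W" "\<lambda>y. b (fst y) (snd y)"])
      (simp add: mem_Times_iff b_cl, blast)
  have f1: "f (Poly_Mapping.single (v, w) 1) = b v w"
    if "v \<in> carrier V" "w \<in> carrier W" for v w
    using f(2) that by simp
  have fc: "f (Poly_Mapping.single (v, w) c) = c \<odot>\<^bsub>U\<^esub> b v w"
    if "v \<in> carrier V" "w \<in> carrier W" for v w c
    using linD(3)[OF f(1), of "Poly_Mapping.single (v, w) 1" c] f1 that
    by (simp add: single_in_free_space) (simp add: free_space_def)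
  have sf: "Poly_Mapping.single (v, w) c \<in> carrier ?F"
    if "v \<in> carrier V" "w \<in> carrier W" for v w c
    using that by (simp add: single_in_free_space)
  note fs = lin_free_diff[OF assms(3) f(1)] free_space_diff_closed sf f1 fc b_cl
    vs_closed[OF assms(1)] vs_closed[OF assms(2)] linD[OF bilinD(1)[OF assms(4)]]
    linD[OF bilinD(2)[OF assms(4)]] vs_closed[OF assms(3)]
  have rel: "f r = \<zero>\<^bsub>U\<^esub>" if "r \<in> tensor_relations V W" for r
  proof -
    show ?thesis
      using that unfolding tensor_relations_def by (elim UnE CollectE exE conjE) (simp_all add: fs vs_smult(2)[OF assms(3)] vs_diff(1,2)[OF assms(3)])
  qed
  have "tensor_kernel V W \<subseteq> {x \<in> carrier ?F. f x \<in> {\<zero>\<^bsub>U\<^esub>}}"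
    unfolding tensor_kernel_def
    using rel tensor_relations_closed[OF assms(1,2)]
    by (intro lin_span_minimal vs_free_space subsp_vimage[OF vs_free_space assms(3) f(1)]
        subsp_zero assms) auto
  then have "f w = \<zero>\<^bsub>U\<^esub>" if "w \<in> tensor_kernel V W" for w using that by auto
  from lin_quotient_lift[OF vs_free_space subsp_tensor_kernel(1)[OF assms(1,2)] assms(3) f(1) this]
  obtain g where g: "lin (tensor V W) U g"
    "\<And>x. x \<in> carrier ?F \<Longrightarrow> g (tensor_kernel V W +>\<^bsub>?F\<^esub> x) = f x"
    unfolding tensor_def by blast
  show thesis
    by (rule that[OF g(1)]) (simp add: pure_tensor_def g(2) sf f1)
qed

lemma lin_eq_on_tensor:
  assumes "vs V" "vs W" "vs U" "lin (tensor V W) U f" "lin (tensor V W) U g"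
    "\<And>v w. v \<in> carrier V \<Longrightarrow> w \<in> carrier W \<Longrightarrow> f (pure_tensor V W v w) = g (pure_tensor V W v w)"
    "x \<in> carrier (tensor V W)"
  shows "f x = g x"
  by (rule lin_eq_on_spans[OF vs_tensor[OF assms(1,2)] assms(3-5) spans_tensor[OF assms(1,2)]])
    (use assms in auto)

text \<open>These are the operators \<open>b x \<otimes> id\<close>. The universal property yields
  one for each \<open>x\<close> separately, so linearity in \<open>x\<close> is recovered afterwards
  by testing it on pure tensors.\<close>

lemma bilin_tensor_map_left:
  assumes "vs Y" "vs V" "vs W" "vs V'" "bilin Y V V' b"
  obtains b' where "bilin Y (tensor V W) (tensor V' W) b'"
    "\<And>x v w. x \<in> carrier Y \<Longrightarrow> v \<in> carrier V \<Longrightarrow> w \<in> carrier W \<Longrightarrow>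
      b' x (pure_tensor V W v w) = pure_tensor V' W (b x v) w"
proof -
  note T' = vs_tensor[OF assms(4,3)] and T = vs_tensor[OF assms(2,3)]
  have "\<exists>g. lin (tensor V W) (tensor V' W) g \<and> (\<forall>v\<in>carrier V. \<forall>w\<in>carrier W.
      g (pure_tensor V W v w) = pure_tensor V' W (b x v) w)" if "x \<in> carrier Y" for x
    using lin_tensor_ext[OF assms(2,3) T' bilin_comp_left[OF bilin_pure_tensor[OF assms(4,3)]
          bilinD(1)[OF assms(5) that]]] by metis
  then obtain b' where b': "\<And>x. x \<in> carrier Y \<Longrightarrow> lin (tensor V W) (tensor V' W) (b' x)"
    "\<And>x v w. x \<in> carrier Y \<Longrightarrow> v \<in> carrier V \<Longrightarrow> w \<in> carrier W \<Longrightarrow>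
      b' x (pure_tensor V W v w) = pure_tensor V' W (b x v) w"
    by metis
  have "bilin (tensor V W) Y (tensor V' W) (\<lambda>t x. b' x t)"
  proof (rule bilin_on_spans[OF T assms(1) T' spans_tensor[OF assms(2,3)] b'(1)])
    fix t assume "t \<in> {pure_tensor V W v w | v w. v \<in> carrier V \<and> w \<in> carrier W}"
    then obtain v w where t: "t = pure_tensor V W v w" "v \<in> carrier V" "w \<in> carrier W" by auto
    show "lin Y (tensor V' W) (\<lambda>x. b' x t)"
      unfolding t(1)
      by (rule lin_cong[OF assms(1) lin_comp[OF bilinD(2)[OF assms(5) t(2)]
              bilinD(2)[OF bilin_pure_tensor[OF assms(4,3)] t(3)]]])
        (simp add: b' t)
  qed
  then have "bilin Y (tensor V W) (tensor V' W) b'" by (auto simp: bilin_def)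
  then show thesis using that b'(2) by blast
qed

lemma bilin_tensor_map_right:
  assumes "vs Y" "vs V" "vs W" "vs W'" "bilin Y W W' b"
  obtains b' where "bilin Y (tensor V W) (tensor V W') b'"
    "\<And>x v w. x \<in> carrier Y \<Longrightarrow> v \<in> carrier V \<Longrightarrow> w \<in> carrier W \<Longrightarrow>
      b' x (pure_tensor V W v w) = pure_tensor V W' v (b x w)"
proof -
  note T' = vs_tensor[OF assms(2,4)] and T = vs_tensor[OF assms(2,3)]
  have "\<exists>g. lin (tensor V W) (tensor V W') g \<and> (\<forall>v\<in>carrier V. \<forall>w\<in>carrier W.
      g (pure_tensor V W v w) = pure_tensor V W' v (b x w))" if "x \<in> carrier Y" for x
    using lin_tensor_ext[OF assms(2,3) T' bilin_comp_right[OF bilin_pure_tensor[OF assms(2,4)]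
          bilinD(1)[OF assms(5) that]]] by metis
  then obtain b' where b': "\<And>x. x \<in> carrier Y \<Longrightarrow> lin (tensor V W) (tensor V W') (b' x)"
    "\<And>x v w. x \<in> carrier Y \<Longrightarrow> v \<in> carrier V \<Longrightarrow> w \<in> carrier W \<Longrightarrow>
      b' x (pure_tensor V W v w) = pure_tensor V W' v (b x w)"
    by metis
  have "bilin (tensor V W) Y (tensor V W') (\<lambda>t x. b' x t)"
  proof (rule bilin_on_spans[OF T assms(1) T' spans_tensor[OF assms(2,3)] b'(1)])
    fix t assume "t \<in> {pure_tensor V W v w | v w. v \<in> carrier V \<and> w \<in> carrier W}"
    then obtain v w where t: "t = pure_tensor V W v w" "v \<in> carrier V" "w \<in> carrier W" by auto
    show "lin Y (tensor V W') (\<lambda>x. b' x t)"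
      unfolding t(1)
      by (rule lin_cong[OF assms(1) lin_comp[OF bilinD(2)[OF assms(5) t(3)]
              bilinD(1)[OF bilin_pure_tensor[OF assms(2,4)] t(2)]]])
        (simp add: b' t)
  qed
  then have "bilin Y (tensor V W) (tensor V W') b'" by (auto simp: bilin_def)
  then show thesis using that b'(2) by blast
qed

section \<open>Algebras and their left modules\<close>

definition complex_algebra :: "(complex, 'a) module \<Rightarrow> bool"
  where "complex_algebra A \<longleftrightarrow> ring A \<and> vs A \<and> bilin A A A (\<lambda>x y. x \<otimes>\<^bsub>A\<^esub> y)"

lemma complex_algebraD:
  assumes "complex_algebra A" shows "ring A" "vs A" "bilin A A A (\<lambda>x y. x \<otimes>\<^bsub>A\<^esub> y)"
  using assms by (auto simp: complex_algebra_def)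

lemma left_module_bilin:
  assumes "vs A" "left_module A M act" shows "bilin A M M act"
proof -
  interpret left_module A M act by fact
  show ?thesis
    by (intro bilinI linI) (simp_all add: act_closed act_add_left act_add_right act_smult_left
        act_smult_right)
qed

lemma left_module_of_bilin:
  assumes "vs M" "bilin A M M act"
    "\<And>a b x. a \<in> carrier A \<Longrightarrow> b \<in> carrier A \<Longrightarrow> x \<in> carrier M \<Longrightarrow>
      act (a \<otimes>\<^bsub>A\<^esub> b) x = act a (act b x)"
    "\<And>x. x \<in> carrier M \<Longrightarrow> act \<one>\<^bsub>A\<^esub> x = x"
  shows "left_module A M act"
  using assms bilinD(3)[OF assms(2)] linD[OF bilinD(1)[OF assms(2)]] linD[OF bilinD(2)[OF assms(2)]]
  by (auto simp: left_module_def)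

text \<open>Equivalent to generating \<open>A\<close> as a unital algebra, since the words in
  \<open>G\<close> are reached from 1 by multiplying on the left. This form fits maps that are known
  only by a recursion on the leftmost letter.\<close>

definition left_generates :: "(complex, 'a) module \<Rightarrow> 'a set \<Rightarrow> bool"
  where "left_generates A G \<longleftrightarrow> G \<subseteq> carrier A \<and> (\<forall>S. subsp A S \<longrightarrow> \<one>\<^bsub>A\<^esub> \<in> S \<longrightarrow>
    (\<forall>g\<in>G. \<forall>x\<in>S. g \<otimes>\<^bsub>A\<^esub> x \<in> S) \<longrightarrow> carrier A \<subseteq> S)"

lemma left_generatesD:
  assumes "left_generates A G" "subsp A S" "\<one>\<^bsub>A\<^esub> \<in> S"
    "\<And>g x. g \<in> G \<Longrightarrow> x \<in> S \<Longrightarrow> g \<otimes>\<^bsub>A\<^esub> x \<in> S" "a \<in> carrier A"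
  shows "a \<in> S"
  using assms unfolding left_generates_def by blast

lemma ideal_subsp:
  assumes "complex_algebra A" "ideal J A" shows "subsp A J"
proof -
  interpret J: ideal J A by fact
  note A = complex_algebraD[OF assms(1)]
  show ?thesis
  proof (rule subspI)
    fix c x assume x: "x \<in> J"
    then have xA: "x \<in> carrier A" by (rule J.a_Hcarr)
    have "c \<odot>\<^bsub>A\<^esub> x = (c \<odot>\<^bsub>A\<^esub> \<one>\<^bsub>A\<^esub>) \<otimes>\<^bsub>A\<^esub> x"
      using linD(3)[OF bilinD(2)[OF A(3) xA], of "\<one>\<^bsub>A\<^esub>" c] xA by simp
    then show "c \<odot>\<^bsub>A\<^esub> x \<in> J"
      using J.I_l_closed[OF x] vs_closed(3)[OF A(2)] by simp
  qed (auto simp: J.a_Hcarr J.zero_closed J.a_closed)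
qed

text \<open>Lets a module descend to a quotient by a generated ideal: once the generators act as 0,
  they lie in this ideal, and so does everything they generate.\<close>

lemma annihilator_ideal:
  assumes "complex_algebra A" "left_module A M act"
  shows "ideal {a \<in> carrier A. \<forall>x\<in>carrier M. act a x = \<zero>\<^bsub>M\<^esub>} A" (is "ideal ?J A")
proof -
  interpret A: ring A by (rule complex_algebraD[OF assms(1)])
  interpret M: left_module A M act by fact
  note b = left_module_bilin[OF complex_algebraD(2)[OF assms(1)] assms(2)]
  note Ac = vs_closed[OF complex_algebraD(2)[OF assms(1)]] and M0 = vs_closed(2)[OF M.vector_space]
  have "subsp A ?J"
  proof (rule subspI)
    show "\<zero>\<^bsub>A\<^esub> \<in> ?J"
      using lin_zero[OF complex_algebraD(2)[OF assms(1)] M.vector_space bilinD(2)[OF b]] Ac(2) by simp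
    show "x \<oplus>\<^bsub>A\<^esub> y \<in> ?J" if "x \<in> ?J" "y \<in> ?J" for x y
      using that by (simp add: Ac M.act_add_left vs_add_ac(2)[OF M.vector_space M0])
    show "c \<odot>\<^bsub>A\<^esub> x \<in> ?J" if "x \<in> ?J" for c x
      using that by (simp add: Ac M.act_smult_left vs_smult(6)[OF M.vector_space])
  qed auto
  then have "subgroup ?J (add_monoid A)"
    using submodule.axioms(1)[of ?J "\<complex>\<F>" A] submodule_iff_subsp[OF complex_algebraD(2)[OF assms(1)], of ?J]
    by fastforce
  then show ?thesis
  proof (rule idealI[OF A.ring_axioms])
    fix a x assume a: "a \<in> ?J" and x: "x \<in> carrier A"
    show "x \<otimes>\<^bsub>A\<^esub> a \<in> ?J"
      using a x lin_zero[OF M.vector_space M.vector_space bilinD(1)[OF b x]]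
      by (simp add: M.act_mult)
    show "a \<otimes>\<^bsub>A\<^esub> x \<in> ?J"
      using a x by (simp add: M.act_mult M.act_closed)
  qed
qed

lemma quotient_algebra:
  assumes "complex_algebra A" "R \<subseteq> carrier A"
  defines "J \<equiv> Idl\<^bsub>A\<^esub> R"
  shows "subsp A J" "R \<subseteq> J"
    "\<one>\<^bsub>quotient_space A J\<^esub> = J +>\<^bsub>A\<^esub> \<one>\<^bsub>A\<^esub>"
    "\<And>x y. x \<in> carrier A \<Longrightarrow> y \<in> carrier A \<Longrightarrow>
      (J +>\<^bsub>A\<^esub> x) \<otimes>\<^bsub>quotient_space A J\<^esub> (J +>\<^bsub>A\<^esub> y) = J +>\<^bsub>A\<^esub> (x \<otimes>\<^bsub>A\<^esub> y)"
    "complex_algebra (quotient_space A J)"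
proof -
  interpret A: ring A by (rule complex_algebraD[OF assms(1)])
  interpret J: ideal J A unfolding J_def by (rule A.genideal_ideal[OF assms(2)])
  note A = complex_algebraD[OF assms(1)]
  show J: "subsp A J" by (rule ideal_subsp[OF assms(1) J.ideal_axioms])
  show "R \<subseteq> J" unfolding J_def by (rule A.genideal_self[OF assms(2)])
  let ?Q = "quotient_space A J"
  show one: "\<one>\<^bsub>?Q\<^esub> = J +>\<^bsub>A\<^esub> \<one>\<^bsub>A\<^esub>"
    by (simp add: quotient_space_def FactRing_def ring.defs module.defs)
  show mult: "(J +>\<^bsub>A\<^esub> x) \<otimes>\<^bsub>?Q\<^esub> (J +>\<^bsub>A\<^esub> y) = J +>\<^bsub>A\<^esub> (x \<otimes>\<^bsub>A\<^esub> y)"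
    if "x \<in> carrier A" "y \<in> carrier A" for x y
    using J.rcoset_mult_add[OF that]
    by (simp add: quotient_space_def FactRing_def ring.defs module.defs)
  note q = quotient_space_simps[OF A(2) J]
  note simps = q(2-4) one mult vs_closed[OF A(2)]
  have vsQ: "vs ?Q" by (rule vs_quotient_space[OF A(2) J])
  have "ring ?Q"
  proof (rule ringI)
    show "abelian_group ?Q" using vsQ by (rule module.axioms(2))
    show "Group.monoid ?Q"
      by (rule monoidI; (unfold q(1))?; (elim imageE)?; hypsubst?; simp add: simps A.m_assoc)
  qed ((unfold q(1))?, (elim imageE)?, hypsubst?, simp add: simps A.l_distr A.r_distr)+
  moreover have "bilin ?Q ?Q ?Q (\<lambda>x y. x \<otimes>\<^bsub>?Q\<^esub> y)"
    by (intro bilinI linI; (unfold q(1))?; (elim imageE)?; hypsubst?;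
        simp add: simps A.l_distr A.r_distr linD[OF bilinD(1)[OF A(3)]] linD[OF bilinD(2)[OF A(3)]])
  ultimately show "complex_algebra ?Q" using vsQ by (simp add: complex_algebra_def)
qed

lemma left_generates_quotient:
  assumes "complex_algebra A" "R \<subseteq> carrier A" "left_generates A G"
  shows "left_generates (quotient_space A (Idl\<^bsub>A\<^esub> R)) ((\<lambda>x. Idl\<^bsub>A\<^esub> R +>\<^bsub>A\<^esub> x) ` G)"
  unfolding left_generates_def
proof (intro conjI allI impI)
  let ?J = "Idl\<^bsub>A\<^esub> R"
  let ?Q = "quotient_space A ?J"
  note A = complex_algebraD[OF assms(1)] and Q = quotient_algebra[OF assms(1,2)]
  note q = quotient_space_simps[OF A(2) Q(1)]
  have G: "G \<subseteq> carrier A" using assms(3) by (simp add: left_generates_def)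
  then show "(\<lambda>x. ?J +>\<^bsub>A\<^esub> x) ` G \<subseteq> carrier ?Q" by (auto simp: q(1))
  fix S assume S: "subsp ?Q S" "\<one>\<^bsub>?Q\<^esub> \<in> S"
    "\<forall>g\<in>(\<lambda>x. ?J +>\<^bsub>A\<^esub> x) ` G. \<forall>x\<in>S. g \<otimes>\<^bsub>?Q\<^esub> x \<in> S"
  have 1: "\<one>\<^bsub>A\<^esub> \<in> carrier A" using ring.ring_simprules(6)[OF A(1)] .
  have "x \<in> {x \<in> carrier A. ?J +>\<^bsub>A\<^esub> x \<in> S}" if "x \<in> carrier A" for x
  proof (rule left_generatesD[OF assms(3) subsp_vimage[OF A(2) vs_quotient_space[OF A(2) Q(1)]
          lin_coset[OF A(2) Q(1)] S(1)] _ _ that])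
    show "\<one>\<^bsub>A\<^esub> \<in> {x \<in> carrier A. ?J +>\<^bsub>A\<^esub> x \<in> S}" using S(2) 1 by (simp add: Q(3))
    fix g x assume g: "g \<in> G" and x: "x \<in> {x \<in> carrier A. ?J +>\<^bsub>A\<^esub> x \<in> S}"
    then have "(?J +>\<^bsub>A\<^esub> g) \<otimes>\<^bsub>?Q\<^esub> (?J +>\<^bsub>A\<^esub> x) \<in> S" using S(3) by blast
    then show "g \<otimes>\<^bsub>A\<^esub> x \<in> {x \<in> carrier A. ?J +>\<^bsub>A\<^esub> x \<in> S}"
      using g x G bilinD(3)[OF A(3)] by (auto simp: Q(4))
  qed
  then show "carrier ?Q \<subseteq> S" by (auto simp: q(1))
qed

lemma left_module_quotient:
  assumes "complex_algebra A" "R \<subseteq> carrier A" "left_module A M act"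
    "\<And>r x. r \<in> R \<Longrightarrow> x \<in> carrier M \<Longrightarrow> act r x = \<zero>\<^bsub>M\<^esub>"
  obtains act' where "left_module (quotient_space A (Idl\<^bsub>A\<^esub> R)) M act'"
    "\<And>a x. a \<in> carrier A \<Longrightarrow> x \<in> carrier M \<Longrightarrow> act' (Idl\<^bsub>A\<^esub> R +>\<^bsub>A\<^esub> a) x = act a x"
proof -
  let ?J = "Idl\<^bsub>A\<^esub> R"
  let ?Q = "quotient_space A ?J"
  interpret M: left_module A M act by fact
  interpret A: ring A by (rule complex_algebraD[OF assms(1)])
  note A = complex_algebraD[OF assms(1)] and Q = quotient_algebra[OF assms(1,2)]
  note b = left_module_bilin[OF A(2) assms(3)]
  have "?J \<subseteq> {a \<in> carrier A. \<forall>x\<in>carrier M. act a x = \<zero>\<^bsub>M\<^esub>}"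
    by (rule A.genideal_minimal[OF annihilator_ideal[OF assms(1,3)]]) (use assms(2,4) in auto)
  then have J0: "act a x = \<zero>\<^bsub>M\<^esub>" if "a \<in> ?J" "x \<in> carrier M" for a x using that by auto
  \<comment> \<open>The action is lifted for each vector \<open>x\<close> on its own. Linearity in
    \<open>x\<close> survives because every element of the quotient is the coset of some
    \<open>a\<close>, on which the old action is linear.\<close>
  have "\<exists>g. lin ?Q M g \<and> (\<forall>a\<in>carrier A. g (?J +>\<^bsub>A\<^esub> a) = act a x)" if "x \<in> carrier M" for x
    using lin_quotient_lift[OF A(2) Q(1) M.vector_space bilinD(2)[OF b that] J0[OF _ that]] by metis
  then obtain g where g: "\<And>x. x \<in> carrier M \<Longrightarrow> lin ?Q M (g x)"
    "\<And>x a. x \<in> carrier M \<Longrightarrow> a \<in> carrier A \<Longrightarrow> g x (?J +>\<^bsub>A\<^esub> a) = act a x" by metis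
  note q = quotient_space_simps[OF A(2) Q(1)]
  show thesis
  proof (rule that[of "\<lambda>a x. g x a"])
    show "left_module ?Q M (\<lambda>a x. g x a)"
    proof (rule left_module_of_bilin[OF M.vector_space])
      show "bilin ?Q M M (\<lambda>a x. g x a)"
      proof (intro bilinI g(1))
        fix a assume "a \<in> carrier ?Q"
        then obtain a' where a': "a' \<in> carrier A" "a = ?J +>\<^bsub>A\<^esub> a'" by (auto simp: q(1))
        show "lin M M (\<lambda>x. g x a)"
          using lin_cong[OF M.vector_space bilinD(1)[OF b a'(1)]] a' by (simp add: g(2))
      qed
      fix x assume x: "x \<in> carrier M"
      show "g x \<one>\<^bsub>?Q\<^esub> = x" using x by (simp add: Q(3) g(2) M.act_one)
      fix a a' assume "a \<in> carrier ?Q" "a' \<in> carrier ?Q"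
      then show "g x (a \<otimes>\<^bsub>?Q\<^esub> a') = g (g x a') a"
        using x by (auto simp: q(1) Q(4) g(2) M.act_mult M.act_closed)
    qed
  qed (simp add: g(2))
qed

section \<open>Free algebras\<close>

text \<open>Linearly a free algebra is the free space on words; only \<open>mult\<close> and
  \<open>one\<close> differ, and the linear notions ignore those fields.\<close>

lemma free_algebra_lin:
  "carrier (free_algebra Y) = carrier (free_space (lists Y))"
  "add (free_algebra Y) = add (free_space (lists Y))"
  "ring.zero (free_algebra Y) = ring.zero (free_space (lists Y))"
  "module.smult (free_algebra Y) = module.smult (free_space (lists Y))"
  "lin (free_algebra Y) W = lin (free_space (lists Y)) W"
  "subsp (free_algebra Y) = subsp (free_space (lists Y))"
  "spans (free_algebra Y) G = spans (free_space (lists Y)) G"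
  by (simp_all add: free_algebra_def free_space_def lin_def subsp_def spans_def fun_eq_iff)

lemma vs_free_algebra: "vs (free_algebra Y)"
  by (rule vs_image[OF vs_free_space[of "lists Y"], of _ "\<lambda>x. x"]) (simp_all add: free_algebra_lin)

lemma spans_free_algebra: "spans (free_algebra Y) ((\<lambda>w. Poly_Mapping.single w 1) ` lists Y)"
  unfolding free_algebra_lin by (rule spans_free_space)

lemma free_algebra_mult: "p \<otimes>\<^bsub>free_algebra Y\<^esub> q = p * q" "\<one>\<^bsub>free_algebra Y\<^esub> = 1"
  by (simp_all add: free_algebra_def)

lemma single_mult_word:
  "Poly_Mapping.single xs (a::complex) * Poly_Mapping.single ys b = Poly_Mapping.single (xs @ ys) (a * b)"
  by (simp add: mult_single plus_list_def)

lemma one_eq_single_Nil: "(1 :: 'x list \<Rightarrow>\<^sub>0 complex) = Poly_Mapping.single [] 1"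
  by (simp add: zero_list_def flip: single_one)

lemma complex_algebra_free_algebra: "complex_algebra (free_algebra Y)"
proof -
  let ?A = "free_algebra Y"
  have mult_closed: "p * q \<in> carrier ?A" if "p \<in> carrier ?A" "q \<in> carrier ?A" for p q
  proof -
    have "Poly_Mapping.keys (p * q) \<subseteq> {a + b |a b. a \<in> Poly_Mapping.keys p \<and> b \<in> Poly_Mapping.keys q}"
      by (rule keys_mult)
    also have "\<dots> \<subseteq> lists Y"
      using that by (fastforce simp: free_algebra_def plus_list_def simp del: in_lists_conv_set
          intro: append_in_lists_conv[THEN iffD2])
    finally show ?thesis by (simp add: free_algebra_def)
  qed
  \<comment> \<open>Here \<open>0\<close> is the empty word, so scalars become elements of the
    algebra and homogeneity becomes associativity.\<close>
  have scale: "c \<odot>\<^bsub>?A\<^esub> p = Poly_Mapping.single 0 c * p" for c p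
    by (simp add: free_algebra_def mult_map_scale_conv_mult)
  \<comment> \<open>Homogeneity in the right factor requires moving a scalar past the left factor.
    On words this is the neutrality of the empty word; linearity does the rest.\<close>
  have central: "Poly_Mapping.single 0 c * p = p * Poly_Mapping.single 0 c"
    if "p \<in> carrier ?A" for c p
  proof -
    have "p \<in> {p \<in> carrier ?A. Poly_Mapping.single 0 c * p = p * Poly_Mapping.single 0 c}"
    proof (rule spansD[OF spans_free_algebra _ _ that])
      show "subsp ?A {p \<in> carrier ?A. Poly_Mapping.single 0 c * p = p * Poly_Mapping.single 0 c}"
      proof (rule subspI)
        fix d p assume "p \<in> {p \<in> carrier ?A. Poly_Mapping.single 0 c * p = p * Poly_Mapping.single 0 c}"
        then have p: "p \<in> carrier ?A" "Poly_Mapping.single 0 c * p = p * Poly_Mapping.single 0 c" by auto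
        have "Poly_Mapping.single 0 c * (Poly_Mapping.single 0 d * p) =
          Poly_Mapping.single 0 d * (Poly_Mapping.single 0 c * p)"
          by (simp add: mult_single mult.commute flip: mult.assoc)
        then show "d \<odot>\<^bsub>?A\<^esub> p \<in>
          {p \<in> carrier ?A. Poly_Mapping.single 0 c * p = p * Poly_Mapping.single 0 c}"
          using p vs_closed(3)[OF vs_free_algebra p(1), of d]
          by (simp add: scale) (simp add: p(2) mult.assoc)
      qed (blast, use vs_closed(1,2)[OF vs_free_algebra[of Y]] in
          \<open>simp_all add: free_algebra_def algebra_simps\<close>)
      show "(\<lambda>w. Poly_Mapping.single w 1) ` lists Y \<subseteq>
        {p \<in> carrier ?A. Poly_Mapping.single 0 c * p = p * Poly_Mapping.single 0 c}"
        by (auto simp: mult_single free_algebra_def)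
    qed
    then show ?thesis by simp
  qed
  have "ring ?A"
  proof (rule ringI)
    show "abelian_group ?A" using vs_free_algebra by (rule module.axioms(2))
    have "1 \<in> carrier ?A" by (simp add: free_algebra_def zero_list_def)
    then show "Group.monoid ?A"
      by (intro monoidI) (simp_all add: free_algebra_mult mult_closed mult.assoc)
  qed (simp_all add: free_algebra_def distrib_left distrib_right)
  moreover have "bilin ?A ?A ?A (\<lambda>x y. x \<otimes>\<^bsub>?A\<^esub> y)"
  proof (intro bilinI linI; unfold free_algebra_mult)
    fix c v x assume v: "v \<in> carrier ?A"
    show "v * (c \<odot>\<^bsub>?A\<^esub> x) = c \<odot>\<^bsub>?A\<^esub> (v * x)"
      using central[OF v] by (simp add: scale flip: mult.assoc)
    show "(c \<odot>\<^bsub>?A\<^esub> x) * v = c \<odot>\<^bsub>?A\<^esub> (x * v)" by (simp add: scale mult.assoc)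
  qed (auto simp: mult_closed, auto simp: free_algebra_def distrib_left distrib_right)
  ultimately show ?thesis using vs_free_algebra by (simp add: complex_algebra_def)
qed

lemma single_in_free_algebra: "xs \<in> lists Y \<Longrightarrow> Poly_Mapping.single xs c \<in> carrier (free_algebra Y)"
  by (simp add: free_algebra_lin single_in_free_space)

lemma left_generates_free_algebra: "left_generates (free_algebra Y) ((\<lambda>y. Poly_Mapping.single [y] 1) ` Y)"
  unfolding left_generates_def
proof (intro conjI allI impI)
  show "(\<lambda>y. Poly_Mapping.single [y] 1) ` Y \<subseteq> carrier (free_algebra Y)"
    by (auto intro: single_in_free_algebra)
  fix S assume S: "subsp (free_algebra Y) S" "\<one>\<^bsub>free_algebra Y\<^esub> \<in> S"
    "\<forall>g\<in>(\<lambda>y. Poly_Mapping.single [y] 1) ` Y. \<forall>x\<in>S. g \<otimes>\<^bsub>free_algebra Y\<^esub> x \<in> S"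
  have "Poly_Mapping.single w 1 \<in> S" if "w \<in> lists Y" for w
    using that
  proof (induction w)
    case Nil
    then show ?case using S(2) by (simp add: free_algebra_mult one_eq_single_Nil)
  next
    case (Cons y w)
    then have "Poly_Mapping.single [y] 1 * Poly_Mapping.single w 1 \<in> S"
      using S(3) by (auto simp: free_algebra_mult)
    then show ?case by (simp add: single_mult_word)
  qed
  then show "carrier (free_algebra Y) \<subseteq> S"
    using spansD[OF spans_free_algebra S(1)] by blast
qed

text \<open>The universal property of the free algebra: one operator per letter may be prescribed
  freely, and a word then acts as the composite \<open>foldr b xs\<close>, rightmost letter
  first.\<close>

lemma left_module_free_algebra:
  assumes "vs W" "\<And>y. y \<in> Y \<Longrightarrow> lin W W (b y)"
  obtains act where "left_module (free_algebra Y) W act"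
    "\<And>y w. y \<in> Y \<Longrightarrow> w \<in> carrier W \<Longrightarrow> act (Poly_Mapping.single [y] 1) w = b y w"
proof -
  let ?A = "free_algebra Y"
  have foldr_lin: "lin W W (foldr b xs)" if "xs \<in> lists Y" for xs
    using that
  proof (induction xs)
    case Nil
    then show ?case using lin_id by (simp add: id_def)
  next
    case (Cons y xs)
    then show ?case using lin_comp[OF Cons.IH assms(2)[of y]] by (simp add: comp_def)
  qed
  have "\<exists>f. lin ?A W f \<and> (\<forall>xs\<in>lists Y. f (Poly_Mapping.single xs 1) = foldr b xs w)"
    if "w \<in> carrier W" for w
    using lin_free_ext[OF assms(1), of "lists Y" "\<lambda>xs. foldr b xs w"] linD(1)[OF foldr_lin that]
    unfolding free_algebra_lin by metis
  then obtain f where f: "\<And>w. w \<in> carrier W \<Longrightarrow> lin ?A W (f w)"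
    "\<And>xs w. w \<in> carrier W \<Longrightarrow> xs \<in> lists Y \<Longrightarrow> f w (Poly_Mapping.single xs 1) = foldr b xs w"
    by metis
  note A = complex_algebraD[OF complex_algebra_free_algebra, of Y]
  have bi: "bilin ?A W W (\<lambda>p w. f w p)"
  proof (rule bilin_on_spans[OF A(2) assms(1) assms(1) spans_free_algebra f(1)])
    fix p assume "p \<in> (\<lambda>w. Poly_Mapping.single w (1::complex)) ` lists Y"
    then obtain xs where xs: "xs \<in> lists Y" "p = Poly_Mapping.single xs 1" by auto
    show "lin W W (\<lambda>w. f w p)"
      using lin_cong[OF assms(1) foldr_lin[OF xs(1)]] f(2) xs by simp
  qed
  have cl: "f w p \<in> carrier W" if "w \<in> carrier W" "p \<in> carrier ?A" for w p
    using linD(1)[OF f(1)] that .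
  \<comment> \<open>Both sides are linear in \<open>p\<close> and in \<open>q\<close>, so they are
    compared on words, where the claim is that \<open>foldr\<close> over a concatenation is a
    composite.\<close>
  have mult: "f w (p * q) = f (f w q) p"
    if w: "w \<in> carrier W" and p: "p \<in> carrier ?A" and q: "q \<in> carrier ?A" for p q w
  proof (rule lin_eq_on_spans[OF A(2) assms(1) _ f(1)[OF cl[OF w q]] spans_free_algebra _ p])
    show "lin ?A W (\<lambda>p. f w (p * q))"
      using lin_comp[OF bilinD(2)[OF A(3) q] f(1)[OF w]] by (simp add: free_algebra_mult)
    fix p' assume "p' \<in> (\<lambda>w. Poly_Mapping.single w (1::complex)) ` lists Y"
    then obtain xs where xs: "xs \<in> lists Y" "p' = Poly_Mapping.single xs 1" by auto
    then have p': "p' \<in> carrier ?A" by (simp add: single_in_free_algebra)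
    show "f w (p' * q) = f (f w q) p'"
    proof (rule lin_eq_on_spans[OF A(2) assms(1) _ _ spans_free_algebra _ q])
      show "lin ?A W (\<lambda>q. f w (p' * q))"
        using lin_comp[OF bilinD(1)[OF A(3) p'] f(1)[OF w]] by (simp add: free_algebra_mult)
      show "lin ?A W (\<lambda>q. f (f w q) p')"
        by (rule lin_comp[OF f(1)[OF w] bilinD(1)[OF bi p']])
      fix q' assume "q' \<in> (\<lambda>w. Poly_Mapping.single w (1::complex)) ` lists Y"
      then obtain ys where ys: "ys \<in> lists Y" "q' = Poly_Mapping.single ys 1" by auto
      have "foldr b ys w \<in> carrier W" using linD(1)[OF foldr_lin] ys(1) w by blast
      then show "f w (p' * q') = f (f w q') p'"
        using xs ys w by (simp add: single_mult_word f(2))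
    qed
  qed
  show thesis
  proof (rule that[of "\<lambda>p w. f w p"])
    show "left_module ?A W (\<lambda>p w. f w p)"
      by (rule left_module_of_bilin[OF assms(1) bi])
        (simp_all add: free_algebra_mult mult one_eq_single_Nil f(2))
  qed (simp add: f(2))
qed

section \<open>Tensor algebras\<close>

abbreviation tensor_algebra_relations :: "(complex, 'v) module \<Rightarrow> ('v list \<Rightarrow>\<^sub>0 complex) set"
  where "tensor_algebra_relations V \<equiv>
    {Poly_Mapping.single [v \<oplus>\<^bsub>V\<^esub> w] 1 - Poly_Mapping.single [v] 1 - Poly_Mapping.single [w] 1
        | v w. v \<in> carrier V \<and> w \<in> carrier V} \<union>
     {Poly_Mapping.single [c \<odot>\<^bsub>V\<^esub> v] 1 - Poly_Mapping.single [v] c | c v. v \<in> carrier V}"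

lemma tensor_algebra_relations_closed:
  assumes "vs V" shows "tensor_algebra_relations V \<subseteq> carrier (free_algebra (carrier V))"
  unfolding free_algebra_lin
  by (auto intro!: free_space_diff_closed single_in_free_space simp: vs_closed[OF assms])

lemma complex_algebra_tensor_algebra: "vs V \<Longrightarrow> complex_algebra (tensor_algebra V)"
  unfolding tensor_algebra_def tensor_algebra_ideal_def
  by (rule quotient_algebra(5)[OF complex_algebra_free_algebra tensor_algebra_relations_closed])

lemma left_generates_tensor_algebra:
  assumes "vs V" shows "left_generates (tensor_algebra V) (tensor_incl V ` carrier V)"
  using left_generates_quotient[OF complex_algebra_free_algebra tensor_algebra_relations_closed[OF assms]
      left_generates_free_algebra]
  unfolding tensor_algebra_def tensor_algebra_ideal_def tensor_incl_def image_image .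

lemma lin_tensor_incl:
  assumes "vs V" shows "lin V (tensor_algebra V) (tensor_incl V)"
proof -
  let ?A = "free_algebra (carrier V)"
  let ?J = "tensor_algebra_ideal V"
  note A = complex_algebraD[OF complex_algebra_free_algebra[of "carrier V"]]
  note Q = quotient_algebra[OF complex_algebra_free_algebra tensor_algebra_relations_closed[OF assms],
      folded tensor_algebra_ideal_def tensor_algebra_def]
  note q = quotient_space_simps[OF A(2) Q(1), folded tensor_algebra_def]
  have s: "Poly_Mapping.single [v] c \<in> carrier ?A" if "v \<in> carrier V" for v c
    using that by (simp add: single_in_free_algebra)
  have eq: "?J +>\<^bsub>?A\<^esub> x = ?J +>\<^bsub>?A\<^esub> y"
    if "x \<in> carrier ?A" "y \<in> carrier ?A" "x - y \<in> tensor_algebra_relations V" for x y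
    unfolding coset_eq_iff[OF A(2) Q(1) that(1,2)]
    using that(3) Q(2) by (intro bexI[of _ "x - y"]) (auto simp: free_algebra_def)
  show ?thesis
  proof (rule linI)
    fix v assume v: "v \<in> carrier V"
    then show "tensor_incl V v \<in> carrier (tensor_algebra V)"
      using s[OF v] by (auto simp: tensor_incl_def q(1))
    fix c
    have "Poly_Mapping.single [c \<odot>\<^bsub>V\<^esub> v] 1 - Poly_Mapping.single [v] c \<in> tensor_algebra_relations V"
      using v by blast
    then have "tensor_incl V (c \<odot>\<^bsub>V\<^esub> v) = ?J +>\<^bsub>?A\<^esub> Poly_Mapping.single [v] c"
      unfolding tensor_incl_def using v by (intro eq s) (auto simp: vs_closed[OF assms])
    then show "tensor_incl V (c \<odot>\<^bsub>V\<^esub> v) = c \<odot>\<^bsub>tensor_algebra V\<^esub> tensor_incl V v"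
      using s[OF v] by (simp add: tensor_incl_def q(4)) (simp add: free_algebra_def)
  next
    fix v w assume v: "v \<in> carrier V" "w \<in> carrier V"
    have "Poly_Mapping.single [v \<oplus>\<^bsub>V\<^esub> w] 1 - (Poly_Mapping.single [v] 1 + Poly_Mapping.single [w] 1)
      \<in> tensor_algebra_relations V"
      using v by (auto simp: diff_diff_eq[symmetric])
    moreover have "Poly_Mapping.single [v] 1 + Poly_Mapping.single [w] 1 \<in> carrier ?A"
      using vs_closed(1)[OF A(2) s s] v by (simp add: free_algebra_def)
    ultimately have "tensor_incl V (v \<oplus>\<^bsub>V\<^esub> w) =
      ?J +>\<^bsub>?A\<^esub> (Poly_Mapping.single [v] 1 + Poly_Mapping.single [w] 1)"
      unfolding tensor_incl_def using v by (intro eq s) (auto simp: vs_closed[OF assms])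
    then show "tensor_incl V (v \<oplus>\<^bsub>V\<^esub> w) = tensor_incl V v \<oplus>\<^bsub>tensor_algebra V\<^esub> tensor_incl V w"
      using s v by (simp add: tensor_incl_def q(3)) (simp add: free_algebra_def)
  qed
qed

text \<open>The universal property of the tensor algebra, with \<open>b\<close> read as a linear map
  from \<open>V\<close> to the operators on \<open>W\<close>. The contraction operators, the
  evaluation at 1, the modules over \<open>N_algebra\<close> and the map from the negative tensor
  algebra into it all arise from this.\<close>

lemma left_module_tensor_algebra:
  assumes "vs V" "vs W" "bilin V W W b"
  obtains act where "left_module (tensor_algebra V) W act"
    "\<And>v w. v \<in> carrier V \<Longrightarrow> w \<in> carrier W \<Longrightarrow> act (tensor_incl V v) w = b v w"
proof -
  let ?A = "free_algebra (carrier V)"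
  obtain act where act: "left_module ?A W act"
    "\<And>v w. v \<in> carrier V \<Longrightarrow> w \<in> carrier W \<Longrightarrow> act (Poly_Mapping.single [v] 1) w = b v w"
    using left_module_free_algebra[of W "carrier V" b, OF assms(2) bilinD(1)[OF assms(3)]] by metis
  note bl = left_module_bilin[OF vs_free_algebra act(1)]
  have s: "Poly_Mapping.single [v] c \<in> carrier (free_space (lists (carrier V)))"
    if "v \<in> carrier V" for v c
    using that by (simp add: single_in_free_space)
  have act_c: "act (Poly_Mapping.single [v] c) w = c \<odot>\<^bsub>W\<^esub> b v w"
    if "v \<in> carrier V" "w \<in> carrier W" for v c w
    using linD(3)[OF bilinD(2)[OF bl that(2)], of "Poly_Mapping.single [v] 1" c] act(2) that
    by (simp add: single_in_free_algebra) (simp add: free_algebra_def)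
  have diff: "act (p - q) w = act p w \<ominus>\<^bsub>W\<^esub> act q w"
    if "w \<in> carrier W" "p \<in> carrier (free_space (lists (carrier V)))"
      "q \<in> carrier (free_space (lists (carrier V)))" for p q w
    using lin_free_diff[OF assms(2) bilinD(2)[OF bl that(1), unfolded free_algebra_lin] that(2,3)] .
  have rel: "act r w = \<zero>\<^bsub>W\<^esub>" if "r \<in> tensor_algebra_relations V" "w \<in> carrier W" for r w
    using that
    by (elim UnE CollectE exE conjE)
      (simp_all add: diff free_space_diff_closed s act(2) act_c vs_closed[OF assms(1)]
        linD[OF bilinD(2)[OF assms(3)]] bilinD(3)[OF assms(3)] vs_diff(1,2)[OF assms(2)]
        vs_closed[OF assms(2)] vs_smult(2)[OF assms(2)])
  from left_module_quotient[OF complex_algebra_free_algebra tensor_algebra_relations_closed[OF assms(1)]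
      act(1) rel]
  obtain act' where act': "left_module (tensor_algebra V) W act'"
    "\<And>a x. a \<in> carrier ?A \<Longrightarrow> x \<in> carrier W \<Longrightarrow> act' (tensor_algebra_ideal V +>\<^bsub>?A\<^esub> a) x = act a x"
    unfolding tensor_algebra_def tensor_algebra_ideal_def by blast
  show thesis
    by (rule that[OF act'(1)]) (simp add: tensor_incl_def act'(2) single_in_free_algebra act(2))
qed

text \<open>The constant Laurent polynomial is \<open>single 0 1\<close>. Left active, this rule
  would rewrite it to \<open>1\<close>, and facts about \<open>hat_elem H a n\<close> would no
  longer match at \<open>n = 0\<close>.\<close>

declare single_one [simp del]

section \<open>The space \<open>\<hat>\<h>\<close>\<close>

lemma vs_complex_line: "vs complex_line"
  by (rule vsI) (simp_all add: complex_line_def ring.defs module.defs algebra_simps)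

lemma complex_line_simps [simp]:
  "carrier complex_line = UNIV" "\<zero>\<^bsub>complex_line\<^esub> = 0" "a \<oplus>\<^bsub>complex_line\<^esub> b = a + b"
  "a \<odot>\<^bsub>complex_line\<^esub> b = a * b"
  by (simp_all add: complex_line_def ring.defs module.defs)

lemma direct_sum_simps [simp]:
  "carrier (direct_sum V W) = carrier V \<times> carrier W"
  "\<zero>\<^bsub>direct_sum V W\<^esub> = (\<zero>\<^bsub>V\<^esub>, \<zero>\<^bsub>W\<^esub>)"
  "(v, w) \<oplus>\<^bsub>direct_sum V W\<^esub> (v', w') = (v \<oplus>\<^bsub>V\<^esub> v', w \<oplus>\<^bsub>W\<^esub> w')"
  "c \<odot>\<^bsub>direct_sum V W\<^esub> (v, w) = (c \<odot>\<^bsub>V\<^esub> v, c \<odot>\<^bsub>W\<^esub> w)"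
  by (simp_all add: direct_sum_def)

lemma vs_direct_sum:
  assumes "vs V" "vs W" shows "vs (direct_sum V W)"
proof -
  note c = vs_closed[OF assms(1)] vs_closed[OF assms(2)]
  note a = c vs_add_ac[OF assms(1)] vs_add_ac[OF assms(2)]
  note m = c vs_smult[OF assms(1)] vs_smult[OF assms(2)]
  show ?thesis
    by (rule vsI; ((clarsimp simp: c; fail) | (clarsimp simp: a; fail) | (clarsimp simp: m; fail)))
qed

lemma lin_fst: "lin (direct_sum V W) V fst" and lin_snd: "lin (direct_sum V W) W snd"
  by (auto intro!: linI)

lemma lin_pair:
  assumes "lin U V f" "lin U W g" shows "lin U (direct_sum V W) (\<lambda>x. (f x, g x))"
  using linD[OF assms(1)] linD[OF assms(2)] by (auto intro!: linI)

lemma vs_laurent: "vs laurent"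
  unfolding laurent_def by (rule vs_free_space)

lemma in_laurent: "f \<in> carrier laurent"
  by (simp add: laurent_def free_space_def)

context
  fixes H :: "(complex, 'h) module"
  assumes H: "vs H"
begin

lemma vs_hat: "vs (hat H)"
  unfolding hat_def by (intro vs_direct_sum vs_tensor H vs_laurent vs_complex_line)

lemma lin_inl: "lin (tensor H laurent) (hat H) (\<lambda>z. (z, 0))"
  unfolding hat_def
  using lin_pair[OF lin_id lin_const_zero[OF vs_complex_line]] by simp

lemma bilin_hat_tensor: "bilin H laurent (hat H) (hat_tensor H)"
  using bilin_comp_target[OF bilin_pure_tensor[OF H vs_laurent] lin_inl]
  by (simp add: hat_tensor_def[abs_def])

lemma hat_elem_closed: "a \<in> carrier H \<Longrightarrow> hat_elem H a n \<in> carrier (hat H)"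
  using bilinD(3)[OF bilin_hat_tensor _ in_laurent] .

lemma hat_k_closed: "hat_k H \<in> carrier (hat H)"
  by (simp add: hat_k_def hat_def vs_closed[OF vs_tensor[OF H vs_laurent]])

text \<open>Reduces an arbitrary Laurent polynomial to the powers of \<open>t\<close> in its
  support. The set \<open>Y\<close> is later everything, the negative or the positive integers,
  according to the part of \<open>hat H\<close> in question.\<close>

lemma hat_tensor_in_subsp:
  assumes S: "subsp (hat H) S" and a: "a \<in> carrier H"
    and Y: "\<And>n. n \<in> Y \<Longrightarrow> hat_elem H a n \<in> S" "Poly_Mapping.keys f \<subseteq> Y"
  shows "hat_tensor H a f \<in> S"
proof -
  have l: "lin (free_space Y) (hat H) (hat_tensor H a)"
    using bilinD(1)[OF bilin_hat_tensor a] by (auto simp: lin_def laurent_def free_space_def)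
  have "f \<in> {f \<in> carrier (free_space Y). hat_tensor H a f \<in> S}"
    using Y
    by (intro spansD[OF spans_free_space subsp_vimage[OF vs_free_space vs_hat l S]])
      (auto simp: single_in_free_space, auto simp: free_space_def)
  then show ?thesis by simp
qed

lemma spans_hat: "spans (hat H) ({hat_elem H a n | a n. a \<in> carrier H} \<union> {hat_k H})"
  unfolding spans_def
proof (intro conjI allI impI subsetI)
  fix x assume "x \<in> {hat_elem H a n | a n. a \<in> carrier H} \<union> {hat_k H}"
  then show "x \<in> carrier (hat H)" by (auto simp: hat_elem_closed hat_k_closed)
next
  fix S x
  assume S: "subsp (hat H) S" "{hat_elem H a n | a n. a \<in> carrier H} \<union> {hat_k H} \<subseteq> S"
    and x: "x \<in> carrier (hat H)"
  obtain z c where zc: "x = (z, c)" "z \<in> carrier (tensor H laurent)"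
    using x by (auto simp: hat_def)
  have ht: "hat_tensor H a f \<in> S" if "a \<in> carrier H" for a f
    by (rule hat_tensor_in_subsp[OF S(1) that, of UNIV]) (use S(2) that in auto)
  have "z \<in> {z \<in> carrier (tensor H laurent). (z, 0) \<in> S}"
  proof (rule spansD[OF spans_tensor[OF H vs_laurent] _ _ zc(2)])
    show "subsp (tensor H laurent) {z \<in> carrier (tensor H laurent). (z, 0) \<in> S}"
      by (rule subsp_vimage[OF vs_tensor[OF H vs_laurent] vs_hat lin_inl S(1)])
    show "{pure_tensor H laurent v w |v w. v \<in> carrier H \<and> w \<in> carrier laurent}
      \<subseteq> {z \<in> carrier (tensor H laurent). (z, 0) \<in> S}"
      using ht bilinD(3)[OF bilin_pure_tensor[OF H vs_laurent]] by (auto simp: hat_tensor_def)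
  qed
  moreover have "c \<odot>\<^bsub>hat H\<^esub> hat_k H \<in> S" using subspD(4)[OF S(1)] S(2) by blast
  ultimately have "(z, 0) \<oplus>\<^bsub>hat H\<^esub> (c \<odot>\<^bsub>hat H\<^esub> hat_k H) \<in> S" using subspD(3)[OF S(1)] by blast
  moreover have "(z, 0) \<oplus>\<^bsub>hat H\<^esub> (c \<odot>\<^bsub>hat H\<^esub> hat_k H) = x"
    using zc(2) by (simp add: zc(1) hat_def hat_k_def vs_smult[OF vs_tensor[OF H vs_laurent]]
        vs_add_ac(3)[OF vs_tensor[OF H vs_laurent]])
  ultimately show "x \<in> S" by simp
qed

text \<open>As a vector space \<open>hat H\<close> is a direct sum of copies of \<open>H\<close>,
  one for each integer mode, and the line through \<open>hat_k H\<close>; a linear map may be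
  prescribed on each summand independently.\<close>

lemma lin_hat_ext:
  assumes "vs U" "\<And>n. lin H U (g n)" "u \<in> carrier U"
  obtains G where "lin (hat H) U G" "\<And>a n. a \<in> carrier H \<Longrightarrow> G (hat_elem H a n) = g n a"
    "G (hat_k H) = u"
proof -
  have "\<exists>\<beta>. lin laurent U \<beta> \<and> (\<forall>n. \<beta> (Poly_Mapping.single n 1) = g n a)" if "a \<in> carrier H" for a
    using lin_free_ext[OF assms(1), of UNIV "\<lambda>n. g n a"] linD(1)[OF assms(2) that]
    unfolding laurent_def by (metis UNIV_I)
  then obtain \<beta> where \<beta>: "\<And>a. a \<in> carrier H \<Longrightarrow> lin laurent U (\<beta> a)"
    "\<And>a n. a \<in> carrier H \<Longrightarrow> \<beta> a (Poly_Mapping.single n 1) = g n a" by metis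
  \<comment> \<open>The extension was made for each \<open>a\<close> separately. Its linearity in
    \<open>a\<close> is known on powers of \<open>t\<close>, which span the Laurent
    polynomials.\<close>
  have "bilin laurent H U (\<lambda>f a. \<beta> a f)"
  proof (rule bilin_on_spans[OF vs_laurent H assms(1) _ \<beta>(1)])
    show "spans laurent ((\<lambda>n. Poly_Mapping.single n 1) ` UNIV)"
      unfolding laurent_def by (rule spans_free_space)
    fix f :: "int \<Rightarrow>\<^sub>0 complex" assume "f \<in> (\<lambda>n. Poly_Mapping.single n 1) ` UNIV"
    then obtain n where f: "f = Poly_Mapping.single n 1" by auto
    show "lin H U (\<lambda>a. \<beta> a f)"
      using lin_cong[OF H assms(2)[of n]] \<beta>(2) f by metis
  qed
  then have b: "bilin H laurent U \<beta>" by (auto simp: bilin_def)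
  obtain \<gamma> where \<gamma>: "lin (tensor H laurent) U \<gamma>"
    "\<And>a f. a \<in> carrier H \<Longrightarrow> \<gamma> (pure_tensor H laurent a f) = \<beta> a f"
    using lin_tensor_ext[OF H vs_laurent assms(1) b] in_laurent by metis
  have l: "lin (hat H) U (\<lambda>x. \<gamma> (fst x) \<oplus>\<^bsub>U\<^esub> snd x \<odot>\<^bsub>U\<^esub> u)"
    unfolding hat_def
    by (intro lin_plus[OF assms(1)] lin_comp[OF lin_fst \<gamma>(1)] lin_smult_vec assms lin_snd)
  show thesis
  proof (rule that[OF l])
    note U = vs_add_ac[OF assms(1)] vs_smult[OF assms(1)]
    show "\<gamma> (fst (hat_elem H a n)) \<oplus>\<^bsub>U\<^esub> snd (hat_elem H a n) \<odot>\<^bsub>U\<^esub> u = g n a"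
      if "a \<in> carrier H" for a n
      using that assms(3) linD(1)[OF assms(2) that]
      by (simp add: hat_tensor_def \<gamma>(2) \<beta>(2) U(6) U(3))
    show "\<gamma> (fst (hat_k H)) \<oplus>\<^bsub>U\<^esub> snd (hat_k H) \<odot>\<^bsub>U\<^esub> u = u"
      using lin_zero[OF vs_tensor[OF H vs_laurent] assms(1) \<gamma>(1)] assms(3)
      by (simp add: hat_k_def vs_smult(2)[OF assms(1)] vs_add_ac(2)[OF assms(1)])
  qed
qed

section \<open>The negative, positive and zero parts of \<open>hat H\<close>\<close>

abbreviation hat_neg :: "(complex, 'h hat) module"
  where "hat_neg \<equiv> (hat H)\<lparr>carrier := hat_minus H\<rparr>"

lemma hat_tensor_gens_closed:
  "{hat_tensor H a f | a f. a \<in> carrier H \<and> Poly_Mapping.keys f \<subseteq> K} \<subseteq> carrier (hat H)"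
  using bilinD(3)[OF bilin_hat_tensor _ in_laurent] by auto

lemma subsp_hat_minus: "subsp (hat H) (hat_minus H)"
  unfolding hat_minus_def by (rule subsp_lin_span(1)[OF vs_hat hat_tensor_gens_closed])

lemma vs_hat_neg: "vs hat_neg"
  by (rule vs_restrict[OF vs_hat subsp_hat_minus])

lemma lin_hat_neg_incl: "lin hat_neg (hat H) (\<lambda>x. x)"
  using subspD(1)[OF subsp_hat_minus] by (auto intro!: linI)

lemma hat_elem_in_hat_minus: "a \<in> carrier H \<Longrightarrow> n < 0 \<Longrightarrow> hat_elem H a n \<in> hat_minus H"
  unfolding hat_minus_def
  by (rule subsetD[OF subsp_lin_span(2)[OF vs_hat hat_tensor_gens_closed]],
      intro CollectI exI[of _ a] exI[of _ "Poly_Mapping.single n 1"]) auto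

lemma spans_hat_neg: "spans hat_neg {hat_elem H a n | a n. a \<in> carrier H \<and> n < 0}"
  unfolding spans_def
proof (intro conjI allI impI)
  show "{hat_elem H a n | a n. a \<in> carrier H \<and> n < 0} \<subseteq> carrier hat_neg"
    by (auto simp: hat_elem_in_hat_minus)
  fix S assume S: "subsp hat_neg S" "{hat_elem H a n | a n. a \<in> carrier H \<and> n < 0} \<subseteq> S"
  have S': "subsp (hat H) S"
    using S(1) subspD(1)[OF subsp_hat_minus] by (auto simp: subsp_def)
  have "hat_tensor H a f \<in> S" if "a \<in> carrier H" "Poly_Mapping.keys f \<subseteq> {..<0}" for a f
    by (rule hat_tensor_in_subsp[OF S' that(1) _ that(2)]) (use S(2) that in auto)
  then have "hat_minus H \<subseteq> S"
    unfolding hat_minus_def by (intro lin_span_minimal[OF vs_hat S']) auto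
  then show "carrier hat_neg \<subseteq> S" by simp
qed

lemma hat_plus_subset:
  assumes "subsp (hat H) S" "\<And>a n. a \<in> carrier H \<Longrightarrow> n > 0 \<Longrightarrow> hat_elem H a n \<in> S"
  shows "hat_plus H \<subseteq> S"
proof -
  have "hat_tensor H a f \<in> S" if "a \<in> carrier H" "Poly_Mapping.keys f \<subseteq> {0<..}" for a f
    by (rule hat_tensor_in_subsp[OF assms(1) that(1) _ that(2)]) (use assms(2) that in auto)
  then show ?thesis
    unfolding hat_plus_def by (intro lin_span_minimal[OF vs_hat assms(1)]) auto
qed

lemma hat_zero_subset:
  assumes "subsp (hat H) S" "\<And>a. a \<in> carrier H \<Longrightarrow> hat_elem H a 0 \<in> S" "hat_k H \<in> S"
  shows "hat_zero H \<subseteq> S"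
  unfolding hat_zero_def using assms by (intro lin_span_minimal[OF vs_hat]) auto

lemma hat_elem_in_hat_plus: "a \<in> carrier H \<Longrightarrow> n > 0 \<Longrightarrow> hat_elem H a n \<in> hat_plus H"
  unfolding hat_plus_def
  by (rule subsetD[OF subsp_lin_span(2)[OF vs_hat hat_tensor_gens_closed]],
      intro CollectI exI[of _ a] exI[of _ "Poly_Mapping.single n 1"]) auto

lemma hat_zero_mem: "a \<in> carrier H \<Longrightarrow> hat_elem H a 0 \<in> hat_zero H" "hat_k H \<in> hat_zero H"
proof -
  have "{hat_elem H a 0 | a. a \<in> carrier H} \<union> {hat_k H} \<subseteq> hat_zero H"
    unfolding hat_zero_def by (rule subsp_lin_span(2)[OF vs_hat])
      (auto simp: hat_elem_closed hat_k_closed)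
  then show "a \<in> carrier H \<Longrightarrow> hat_elem H a 0 \<in> hat_zero H" "hat_k H \<in> hat_zero H" by blast+
qed

section \<open>The algebra \<open>N(\<hat>\<h>)\<close>\<close>

context
  fixes B :: "'h \<Rightarrow> 'h \<Rightarrow> complex"
begin

abbreviation (input) th where "th \<equiv> tensor_algebra (hat H)"

lemmas complex_algebra_th = complex_algebra_tensor_algebra[OF vs_hat]

lemma incl_closed: "x \<in> carrier (hat H) \<Longrightarrow> tensor_incl (hat H) x \<in> carrier th"
  by (rule linD(1)[OF lin_tensor_incl[OF vs_hat]])

lemma N_relations_closed: "N_relations H B \<subseteq> carrier th"
proof -
  interpret T: module "\<complex>\<F>" th by (rule complex_algebraD[OF complex_algebra_th])
  note c = incl_closed hat_elem_closed hat_k_closed bilinD(3)[OF complex_algebraD(3)[OF complex_algebra_th]] T.minus_closed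
  show ?thesis by (auto simp: N_relations_def Let_def c)
qed

lemmas N_quotient = quotient_algebra[OF complex_algebra_th N_relations_closed,
    folded N_ideal_def N_algebra_def]

lemma complex_algebra_N: "complex_algebra (N_algebra H B)"
  by (rule N_quotient(5))

lemma lin_N_incl: "lin (hat H) (N_algebra H B) (N_incl H B)"
  using lin_comp[OF lin_tensor_incl[OF vs_hat] lin_coset[OF complex_algebraD(2)[OF complex_algebra_th] N_quotient(1)]]
  by (simp add: N_incl_def[abs_def] N_algebra_def)

lemma left_generates_N: "left_generates (N_algebra H B) (N_incl H B ` carrier (hat H))"
  using left_generates_quotient[OF complex_algebra_th N_relations_closed left_generates_tensor_algebra[OF vs_hat]]
  unfolding N_algebra_def N_ideal_def N_incl_def image_image .

lemma N_relations_cases: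
  assumes "r \<in> N_relations H B"
  obtains (pm) a b m n where "a \<in> carrier H" "b \<in> carrier H" "m > 0" "n < 0"
      "r = (tensor_incl (hat H) (hat_elem H a m) \<otimes>\<^bsub>th\<^esub> tensor_incl (hat H) (hat_elem H b n))
        \<ominus>\<^bsub>th\<^esub> (tensor_incl (hat H) (hat_elem H b n) \<otimes>\<^bsub>th\<^esub> tensor_incl (hat H) (hat_elem H a m))
        \<ominus>\<^bsub>th\<^esub> ((of_int m * B a b * (if m + n = 0 then 1 else 0)) \<odot>\<^bsub>th\<^esub> tensor_incl (hat H) (hat_k H))"
  | (zero) a b j where "a \<in> carrier H" "b \<in> carrier H" "j \<noteq> 0"
      "r = (tensor_incl (hat H) (hat_elem H a j) \<otimes>\<^bsub>th\<^esub> tensor_incl (hat H) (hat_elem H b 0))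
        \<ominus>\<^bsub>th\<^esub> (tensor_incl (hat H) (hat_elem H b 0) \<otimes>\<^bsub>th\<^esub> tensor_incl (hat H) (hat_elem H a j))"
  | (k) a j where "a \<in> carrier H"
      "r = (tensor_incl (hat H) (hat_elem H a j) \<otimes>\<^bsub>th\<^esub> tensor_incl (hat H) (hat_k H))
        \<ominus>\<^bsub>th\<^esub> (tensor_incl (hat H) (hat_k H) \<otimes>\<^bsub>th\<^esub> tensor_incl (hat H) (hat_elem H a j))"
  using assms unfolding N_relations_def Let_def by blast

text \<open>The universal property of \<open>N_algebra\<close>: operators attached linearly to
  \<open>hat H\<close> define a module as soon as they satisfy the three families of relations.
  Representations are constructed through this criterion alone.\<close>

lemma left_module_N:
  assumes W: "vs W" "bilin (hat H) W W b"
    and pm: "\<And>a c m n w. \<lbrakk>a \<in> carrier H; c \<in> carrier H; m > 0; n < 0; w \<in> carrier W\<rbrakk> \<Longrightarrow>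
      b (hat_elem H a m) (b (hat_elem H c n) w) =
        b (hat_elem H c n) (b (hat_elem H a m) w) \<oplus>\<^bsub>W\<^esub>
        (of_int m * B a c * (if m + n = 0 then 1 else 0)) \<odot>\<^bsub>W\<^esub> b (hat_k H) w"
    and zero: "\<And>a c j w. \<lbrakk>a \<in> carrier H; c \<in> carrier H; j \<noteq> 0; w \<in> carrier W\<rbrakk> \<Longrightarrow>
      b (hat_elem H a j) (b (hat_elem H c 0) w) = b (hat_elem H c 0) (b (hat_elem H a j) w)"
    and k: "\<And>a j w. \<lbrakk>a \<in> carrier H; w \<in> carrier W\<rbrakk> \<Longrightarrow>
      b (hat_elem H a j) (b (hat_k H) w) = b (hat_k H) (b (hat_elem H a j) w)"
  obtains act where "left_module (N_algebra H B) W act"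
    "\<And>x w. x \<in> carrier (hat H) \<Longrightarrow> w \<in> carrier W \<Longrightarrow> act (N_incl H B x) w = b x w"
proof -
  let ?i = "tensor_incl (hat H)"
  obtain act where act: "left_module th W act"
    "\<And>x w. x \<in> carrier (hat H) \<Longrightarrow> w \<in> carrier W \<Longrightarrow> act (?i x) w = b x w"
    using left_module_tensor_algebra[OF vs_hat W] by metis
  interpret W: left_module th W act by (rule act)
  interpret T: module "\<complex>\<F>" th by (rule complex_algebraD[OF complex_algebra_th])
  note bl = left_module_bilin[OF complex_algebraD(2)[OF complex_algebra_th] act(1)]
  note c = incl_closed hat_elem_closed hat_k_closed bilinD(3)[OF complex_algebraD(3)[OF complex_algebra_th]]
    T.minus_closed bilinD(3)[OF W(2)] vs_closed[OF W(1)]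
  have diff: "act (x \<ominus>\<^bsub>th\<^esub> y) w = act x w \<ominus>\<^bsub>W\<^esub> act y w"
    if "x \<in> carrier th" "y \<in> carrier th" "w \<in> carrier W" for x y w
    using lin_minus[OF complex_algebraD(2)[OF complex_algebra_th] W(1) bilinD(2)[OF bl that(3)] that(1,2)] .
  have "act r w = \<zero>\<^bsub>W\<^esub>" if "r \<in> N_relations H B" and w: "w \<in> carrier W" for r w
    using that(1)
  proof (cases rule: N_relations_cases)
    case (pm a b m n)
    then show ?thesis using assms(3)[OF pm(1-4) w] w
      by (simp add: diff c W.act_mult W.act_smult_left act(2) vs_diff(4)[OF W(1)])
  next
    case (zero a b j)
    then show ?thesis using assms(4)[OF zero(1-3) w] w
      by (simp add: diff c W.act_mult act(2) vs_diff(3)[OF W(1)])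
  next
    case (k a j)
    then show ?thesis using assms(5)[OF k(1) w] w
      by (simp add: diff c W.act_mult act(2) vs_diff(3)[OF W(1)])
  qed
  from left_module_quotient[OF complex_algebra_th N_relations_closed act(1) this]
  obtain act' where act': "left_module (N_algebra H B) W act'"
    "\<And>a x. a \<in> carrier th \<Longrightarrow> x \<in> carrier W \<Longrightarrow> act' (N_ideal H B +>\<^bsub>th\<^esub> a) x = act a x"
    unfolding N_algebra_def N_ideal_def by metis
  show thesis
    by (rule that[OF act'(1)]) (simp add: N_incl_def act'(2) c act(2))
qed

text \<open>The cosets of the defining relations vanish in the quotient; the resulting equations are
  rearranged into rules for exchanging two factors.\<close>

lemma N_commutators:
  defines "e \<equiv> \<lambda>a n. N_incl H B (hat_elem H a n)" and "k \<equiv> N_incl H B (hat_k H)"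
    and "N \<equiv> N_algebra H B"
  shows "\<lbrakk>a \<in> carrier H; c \<in> carrier H; m > 0; n < 0\<rbrakk> \<Longrightarrow> e a m \<otimes>\<^bsub>N\<^esub> e c n =
      (e c n \<otimes>\<^bsub>N\<^esub> e a m) \<oplus>\<^bsub>N\<^esub> (of_int m * B a c * (if m + n = 0 then 1 else 0)) \<odot>\<^bsub>N\<^esub> k"
    and "\<lbrakk>a \<in> carrier H; c \<in> carrier H; j \<noteq> 0\<rbrakk> \<Longrightarrow> e a j \<otimes>\<^bsub>N\<^esub> e c 0 = e c 0 \<otimes>\<^bsub>N\<^esub> e a j"
    and "a \<in> carrier H \<Longrightarrow> e a j \<otimes>\<^bsub>N\<^esub> k = k \<otimes>\<^bsub>N\<^esub> e a j"
proof -
  let ?i = "tensor_incl (hat H)" and ?p = "\<lambda>x. N_ideal H B +>\<^bsub>th\<^esub> x"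
  interpret T: module "\<complex>\<F>" th by (rule complex_algebraD[OF complex_algebra_th])
  have N: "vs N" unfolding N_def by (rule complex_algebraD[OF complex_algebra_N])
  have p: "lin th N ?p"
    unfolding N_def N_algebra_def by (rule lin_coset[OF complex_algebraD(2)[OF complex_algebra_th] N_quotient(1)])
  have mult: "?p x \<otimes>\<^bsub>N\<^esub> ?p y = ?p (x \<otimes>\<^bsub>th\<^esub> y)" if "x \<in> carrier th" "y \<in> carrier th" for x y
    using N_quotient(4)[OF that] by (simp add: N_def)
  have 0: "?p r = \<zero>\<^bsub>N\<^esub>" if "r \<in> N_relations H B" for r
  proof -
    have r: "r \<in> carrier th" "r \<in> N_ideal H B"
      using N_relations_closed N_quotient(2) that by auto
    have "?p r = ?p \<zero>\<^bsub>th\<^esub>"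
      unfolding coset_eq_iff[OF complex_algebraD(2)[OF complex_algebra_th] N_quotient(1) r(1) T.zero_closed]
      using r by (intro bexI[of _ r]) simp_all
    then show ?thesis using lin_zero[OF complex_algebraD(2)[OF complex_algebra_th] N p] by simp
  qed
  have mc: "?i x \<otimes>\<^bsub>th\<^esub> ?i y \<in> carrier th" if "x \<in> carrier (hat H)" "y \<in> carrier (hat H)" for x y
    using bilinD(3)[OF complex_algebraD(3)[OF complex_algebra_th]] incl_closed that by simp
  note c = incl_closed hat_elem_closed hat_k_closed mc
    T.minus_closed linD(1)[OF p]
  note diff = lin_minus[OF complex_algebraD(2)[OF complex_algebra_th] N p]
  have ek: "e a n = ?p (?i (hat_elem H a n))" "k = ?p (?i (hat_k H))" for a n
    by (simp_all add: e_def k_def N_incl_def)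
  {
    assume a: "a \<in> carrier H" "c \<in> carrier H" "m > 0" "n < 0"
    then have "(?i (hat_elem H a m) \<otimes>\<^bsub>th\<^esub> ?i (hat_elem H c n))
        \<ominus>\<^bsub>th\<^esub> (?i (hat_elem H c n) \<otimes>\<^bsub>th\<^esub> ?i (hat_elem H a m))
        \<ominus>\<^bsub>th\<^esub> ((of_int m * B a c * (if m + n = 0 then 1 else 0)) \<odot>\<^bsub>th\<^esub> ?i (hat_k H)) \<in> N_relations H B"
      unfolding N_relations_def Let_def by blast
    from 0[OF this] a show "e a m \<otimes>\<^bsub>N\<^esub> e c n =
      (e c n \<otimes>\<^bsub>N\<^esub> e a m) \<oplus>\<^bsub>N\<^esub> (of_int m * B a c * (if m + n = 0 then 1 else 0)) \<odot>\<^bsub>N\<^esub> k"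
      by (simp add: ek mult c diff vs_diff(4)[OF N] linD(3)[OF p] vs_closed[OF N] split del: if_split)
  next
    assume a: "a \<in> carrier H" "c \<in> carrier H" "j \<noteq> 0"
    then have "(?i (hat_elem H a j) \<otimes>\<^bsub>th\<^esub> ?i (hat_elem H c 0))
        \<ominus>\<^bsub>th\<^esub> (?i (hat_elem H c 0) \<otimes>\<^bsub>th\<^esub> ?i (hat_elem H a j)) \<in> N_relations H B"
      unfolding N_relations_def Let_def by blast
    from 0[OF this] a show "e a j \<otimes>\<^bsub>N\<^esub> e c 0 = e c 0 \<otimes>\<^bsub>N\<^esub> e a j"
      by (simp add: ek mult c diff vs_diff(3)[OF N])
  next
    assume a: "a \<in> carrier H"
    then have "(?i (hat_elem H a j) \<otimes>\<^bsub>th\<^esub> ?i (hat_k H))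
        \<ominus>\<^bsub>th\<^esub> (?i (hat_k H) \<otimes>\<^bsub>th\<^esub> ?i (hat_elem H a j)) \<in> N_relations H B"
      unfolding N_relations_def Let_def by blast
    from 0[OF this] a show "e a j \<otimes>\<^bsub>N\<^esub> k = k \<otimes>\<^bsub>N\<^esub> e a j"
      by (simp add: ek mult c diff vs_diff(3)[OF N])
  }
qed

end

end

section \<open>Contraction operators on a tensor algebra\<close>

text \<open>
  The operator \<open>D\<close> attached to a functional \<open>d\<close> is read off from the action of \<open>T(V)\<close> on
  \<open>T(V) \<oplus> T(V)\<close> in which \<open>v\<close> acts by \<open>(u, u') \<mapsto> (v u, d(v) u + v u')\<close>.
\<close>

lemma contraction_ext:
  assumes Y: "vs Y" and V: "vs V" and d: "bilin Y V complex_line d"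
  defines "T \<equiv> tensor_algebra V"
  obtains D where "bilin Y T T D" "\<And>x. x \<in> carrier Y \<Longrightarrow> D x \<one>\<^bsub>T\<^esub> = \<zero>\<^bsub>T\<^esub>"
    "\<And>x v u. x \<in> carrier Y \<Longrightarrow> v \<in> carrier V \<Longrightarrow> u \<in> carrier T \<Longrightarrow>
      D x (tensor_incl V v \<otimes>\<^bsub>T\<^esub> u) = d x v \<odot>\<^bsub>T\<^esub> u \<oplus>\<^bsub>T\<^esub> tensor_incl V v \<otimes>\<^bsub>T\<^esub> D x u"
proof -
  note T = complex_algebraD[OF complex_algebra_tensor_algebra[OF V], folded T_def]
  interpret T: ring T by (rule T)
  note i = lin_tensor_incl[OF V, folded T_def]
  note ic = linD(1)[OF i]
  let ?i = "tensor_incl V"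
  let ?TT = "direct_sum T T"
  have TT: "vs ?TT" by (intro vs_direct_sum T)
  note ivT = bilin_comp_left[OF T(3) i]
  have "\<exists>f. lin T T f \<and> f \<one>\<^bsub>T\<^esub> = \<zero>\<^bsub>T\<^esub> \<and> (\<forall>v\<in>carrier V. \<forall>u\<in>carrier T.
      f (?i v \<otimes>\<^bsub>T\<^esub> u) = d x v \<odot>\<^bsub>T\<^esub> u \<oplus>\<^bsub>T\<^esub> ?i v \<otimes>\<^bsub>T\<^esub> f u)" if x: "x \<in> carrier Y" for x
  proof -
    let ?b = "\<lambda>v p. (?i v \<otimes>\<^bsub>T\<^esub> fst p, d x v \<odot>\<^bsub>T\<^esub> fst p \<oplus>\<^bsub>T\<^esub> ?i v \<otimes>\<^bsub>T\<^esub> snd p)"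
    have "bilin V ?TT ?TT ?b"
    proof (rule bilinI)
      fix v assume v: "v \<in> carrier V"
      show "lin ?TT ?TT (?b v)"
        by (intro lin_pair lin_plus lin_scale T lin_fst lin_comp[OF lin_fst bilinD(1)[OF ivT v]]
            lin_comp[OF lin_snd bilinD(1)[OF ivT v]])
    next
      fix p assume "p \<in> carrier ?TT"
      then have p: "fst p \<in> carrier T" "snd p \<in> carrier T" by auto
      show "lin V ?TT (\<lambda>v. ?b v p)"
        by (intro lin_pair lin_plus T lin_smult_vec p bilinD(1)[OF d x] bilinD(2)[OF ivT])
    qed
    from left_module_tensor_algebra[OF V TT this]
    obtain act where act: "left_module T ?TT act"
      "\<And>v w. v \<in> carrier V \<Longrightarrow> w \<in> carrier ?TT \<Longrightarrow> act (?i v) w = ?b v w"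
      unfolding T_def by metis
    interpret A: left_module T ?TT act by (rule act)
    \<comment> \<open>Acting on this vector, \<open>u\<close> yields the pair of \<open>u\<close>
      and \<open>D(u)\<close>. Once the first coordinate is known to reproduce \<open>u\<close>, the
      second satisfies the required recursion.\<close>
    let ?o = "(\<one>\<^bsub>T\<^esub>, \<zero>\<^bsub>T\<^esub>)"
    have o: "?o \<in> carrier ?TT" by simp
    note l = bilinD(2)[OF left_module_bilin[OF T(2) act(1)] o]
    have step: "act (?i v \<otimes>\<^bsub>T\<^esub> u) ?o = ?b v (act u ?o)" if "v \<in> carrier V" "u \<in> carrier T" for v u
      using that A.act_mult[OF ic[OF that(1)] that(2) o] act(2)[OF that(1) A.act_closed[OF that(2) o]]
      by simp
    have fst: "fst (act u ?o) = u" if u: "u \<in> carrier T" for u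
    proof -
      have "u \<in> {u \<in> carrier T. fst (act u ?o) = u}"
      proof (rule left_generatesD[OF left_generates_tensor_algebra[OF V, folded T_def]
            subsp_equalizer[OF T(2) T(2) lin_comp[OF l lin_fst] lin_id] _ _ u])
        show "\<one>\<^bsub>T\<^esub> \<in> {u \<in> carrier T. fst (act u ?o) = u}" using A.act_one[OF o] by simp
      qed (use step ic in auto)
      then show ?thesis by simp
    qed
    show ?thesis
    proof (intro exI conjI ballI)
      show "lin T T (\<lambda>u. snd (act u ?o))" by (rule lin_comp[OF l lin_snd])
      show "snd (act \<one>\<^bsub>T\<^esub> ?o) = \<zero>\<^bsub>T\<^esub>" using A.act_one[OF o] by simp
    qed (simp add: step fst)
  qed
  then obtain D where D: "\<And>x. x \<in> carrier Y \<Longrightarrow> lin T T (D x)"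
    "\<And>x. x \<in> carrier Y \<Longrightarrow> D x \<one>\<^bsub>T\<^esub> = \<zero>\<^bsub>T\<^esub>"
    "\<And>x v u. x \<in> carrier Y \<Longrightarrow> v \<in> carrier V \<Longrightarrow> u \<in> carrier T \<Longrightarrow>
      D x (?i v \<otimes>\<^bsub>T\<^esub> u) = d x v \<odot>\<^bsub>T\<^esub> u \<oplus>\<^bsub>T\<^esub> ?i v \<otimes>\<^bsub>T\<^esub> D x u"
    by metis
  \<comment> \<open>Uniqueness for the recursion: \<open>V\<close> left-generates its tensor
    algebra, so agreement at 1 that persists under left multiplication is agreement everywhere. As
    each \<open>D x\<close> was chosen separately, linearity in \<open>x\<close> is derived from
    this.\<close>
  have eq: "f u = g u" if u: "u \<in> carrier T" and f: "lin T T f" "lin T T g" "f \<one>\<^bsub>T\<^esub> = g \<one>\<^bsub>T\<^esub>"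
    "\<And>v u. v \<in> carrier V \<Longrightarrow> u \<in> carrier T \<Longrightarrow> f u = g u \<Longrightarrow> f (?i v \<otimes>\<^bsub>T\<^esub> u) = g (?i v \<otimes>\<^bsub>T\<^esub> u)"
    for f g u
  proof -
    have "u \<in> {u \<in> carrier T. f u = g u}"
      by (rule left_generatesD[OF left_generates_tensor_algebra[OF V, folded T_def]
            subsp_equalizer[OF T(2) T(2) f(1,2)] _ _ u]) (use f(3,4) ic in auto)
    then show ?thesis by simp
  qed
  note Dc = linD(1)[OF D(1)]
  note Ys = vs_closed[OF Y] and Ts = vs_closed[OF T(2)]
  have "bilin Y T T D"
  proof (intro bilinI D(1) linI)
    fix u x x' assume u: "u \<in> carrier T" and x: "x \<in> carrier Y" "x' \<in> carrier Y"
    show "D (x \<oplus>\<^bsub>Y\<^esub> x') u = D x u \<oplus>\<^bsub>T\<^esub> D x' u"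
    proof (rule eq[OF u D(1) lin_plus[OF T(2) D(1) D(1)]])
      fix v u assume v: "v \<in> carrier V" and u: "u \<in> carrier T"
        and IH: "D (x \<oplus>\<^bsub>Y\<^esub> x') u = D x u \<oplus>\<^bsub>T\<^esub> D x' u"
      have "D (x \<oplus>\<^bsub>Y\<^esub> x') (?i v \<otimes>\<^bsub>T\<^esub> u) = (d x v \<odot>\<^bsub>T\<^esub> u \<oplus>\<^bsub>T\<^esub> d x' v \<odot>\<^bsub>T\<^esub> u) \<oplus>\<^bsub>T\<^esub>
          (?i v \<otimes>\<^bsub>T\<^esub> D x u \<oplus>\<^bsub>T\<^esub> ?i v \<otimes>\<^bsub>T\<^esub> D x' u)"
        using v u x by (simp add: D(3) Ys IH linD(2)[OF bilinD(2)[OF d]] vs_smult(3)[OF T(2)]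
            T.r_distr Dc ic)
      also have "\<dots> = D x (?i v \<otimes>\<^bsub>T\<^esub> u) \<oplus>\<^bsub>T\<^esub> D x' (?i v \<otimes>\<^bsub>T\<^esub> u)"
        using v u x by (simp add: D(3) Ts ic Dc vs_add_swap[OF T(2)])
      finally show "D (x \<oplus>\<^bsub>Y\<^esub> x') (?i v \<otimes>\<^bsub>T\<^esub> u) =
        D x (?i v \<otimes>\<^bsub>T\<^esub> u) \<oplus>\<^bsub>T\<^esub> D x' (?i v \<otimes>\<^bsub>T\<^esub> u)" .
    qed (use x in \<open>auto simp: Ys D(2)\<close>)
  next
    fix u c x assume u: "u \<in> carrier T" and x: "x \<in> carrier Y"
    show "D (c \<odot>\<^bsub>Y\<^esub> x) u = c \<odot>\<^bsub>T\<^esub> D x u"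
    proof (rule eq[OF u D(1) lin_scale[OF T(2) D(1)]])
      fix v u assume v: "v \<in> carrier V" and u: "u \<in> carrier T"
        and IH: "D (c \<odot>\<^bsub>Y\<^esub> x) u = c \<odot>\<^bsub>T\<^esub> D x u"
      show "D (c \<odot>\<^bsub>Y\<^esub> x) (?i v \<otimes>\<^bsub>T\<^esub> u) = c \<odot>\<^bsub>T\<^esub> D x (?i v \<otimes>\<^bsub>T\<^esub> u)"
        using v u x by (simp add: D(3) Ys IH linD(3)[OF bilinD(2)[OF d]] vs_smult(4,5)[OF T(2)]
            linD(3)[OF bilinD(1)[OF T(3)]] Dc ic Ts)
    qed (use x in \<open>auto simp: Ys D(2) vs_smult(6)[OF T(2)]\<close>)
  qed (auto simp: Dc)
  then show thesis using that D(2,3) by blast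
qed

section \<open>The Fock-type module\<close>

text \<open>Together with \<open>zero_projection\<close> and \<open>snd\<close> this isolates one
  kind of mode, so that operators meant for that kind extend by 0 to a bilinear operation of all of
  \<open>hat H\<close>.\<close>

lemma minus_projection:
  assumes H: "vs H"
  obtains \<pi> where "lin (hat H) (hat_neg H) \<pi>"
    "\<And>a n. a \<in> carrier H \<Longrightarrow> \<pi> (hat_elem H a n) = (if n < 0 then hat_elem H a n else \<zero>\<^bsub>hat H\<^esub>)"
    "\<pi> (hat_k H) = \<zero>\<^bsub>hat H\<^esub>"
proof -
  have g: "lin H (hat_neg H) (\<lambda>a. if n < 0 then hat_elem H a n else \<zero>\<^bsub>hat H\<^esub>)" for n :: int
  proof (cases "n < 0")
    case True
    then show ?thesis
      using bilinD(2)[OF bilin_hat_tensor[OF H] in_laurent] hat_elem_in_hat_minus[OF H]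
      by (auto simp: lin_def)
  next
    case False
    then show ?thesis using lin_const_zero[OF vs_hat_neg[OF H], of H] by simp
  qed
  have "\<zero>\<^bsub>hat H\<^esub> \<in> carrier (hat_neg H)" using vs_closed(2)[OF vs_hat_neg[OF H]] by simp
  then show thesis
  proof (rule lin_hat_ext[OF H vs_hat_neg[OF H] g])
    fix G assume G: "lin (hat H) (hat_neg H) G" "G (hat_k H) = \<zero>\<^bsub>hat H\<^esub>"
      "\<And>a n. a \<in> carrier H \<Longrightarrow> G (hat_elem H a n) = (if n < 0 then hat_elem H a n else \<zero>\<^bsub>hat H\<^esub>)"
    show thesis by (rule that[OF G(1)]) (simp_all add: G(2,3))
  qed
qed

lemma zero_projection:
  assumes H: "vs H"
  obtains \<rho> where "lin (hat H) H \<rho>"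
    "\<And>a n. a \<in> carrier H \<Longrightarrow> \<rho> (hat_elem H a n) = (if n = 0 then a else \<zero>\<^bsub>H\<^esub>)"
    "\<rho> (hat_k H) = \<zero>\<^bsub>H\<^esub>"
proof -
  have g: "lin H H (\<lambda>a. if n = 0 then a else \<zero>\<^bsub>H\<^esub>)" for n :: int
    using lin_id lin_const_zero[OF H, of H] by (cases "n = 0") simp_all
  show thesis
  proof (rule lin_hat_ext[OF H H g vs_closed(2)[OF H]])
    fix G assume G: "lin (hat H) H G" "G (hat_k H) = \<zero>\<^bsub>H\<^esub>"
      "\<And>a n. a \<in> carrier H \<Longrightarrow> G (hat_elem H a n) = (if n = 0 then a else \<zero>\<^bsub>H\<^esub>)"
    show thesis by (rule that[OF G(1)]) (simp_all add: G(2,3))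
  qed
qed

text \<open>The pairing is the coefficient of the central element in the commutator of a positive
  with a negative mode. The guard \<open>m > 0\<close> makes it vanish when the first argument is a
  negative mode, so that negative modes act by multiplication alone.\<close>

lemma mode_pairing:
  assumes "nondegenerate_form H B"
  obtains d where "bilin (hat H) (hat H) complex_line d"
    "\<And>a c m n. a \<in> carrier H \<Longrightarrow> c \<in> carrier H \<Longrightarrow>
      d (hat_elem H a m) (hat_elem H c n) = (if m > 0 \<and> m + n = 0 then of_int m * B a c else 0)"
    "\<And>x. x \<in> carrier (hat H) \<Longrightarrow> d (hat_k H) x = 0"
proof -
  interpret nondegenerate_form H B by fact
  note H = vector_space
  note C = vs_complex_line
  have B1: "lin H complex_line (B a)" if "a \<in> carrier H" for a
    using that by (auto intro!: linI simp: add_right smult_right)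
  have B2: "lin H complex_line (\<lambda>a. B a c)" if "c \<in> carrier H" for c
    using that by (auto intro!: linI simp: add_left smult_left)
  define g :: "int \<Rightarrow> int \<Rightarrow> 'a \<Rightarrow> 'a \<Rightarrow> complex"
    where "g m n a c = (if m > 0 \<and> m + n = 0 then of_int m * B a c else 0)" for m n a c
  have g1: "lin H complex_line (g m n a)" if "a \<in> carrier H" for m n a
    using lin_scale[OF C B1[OF that], of "of_int m"] lin_const_zero[OF C, of H]
    unfolding g_def by (cases "m > 0 \<and> m + n = 0") (simp_all only: if_True if_False simp_thms complex_line_simps)
  have g2: "lin H complex_line (\<lambda>a. g m n a c)" if "c \<in> carrier H" for m n c
    using lin_scale[OF C B2[OF that], of "of_int m"] lin_const_zero[OF C, of H]
    unfolding g_def by (cases "m > 0 \<and> m + n = 0") (simp_all only: if_True if_False simp_thms complex_line_simps)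
  have "\<exists>\<phi>. lin (hat H) complex_line \<phi> \<and> (\<forall>c\<in>carrier H. \<forall>n. \<phi> (hat_elem H c n) = g m n a c) \<and>
      \<phi> (hat_k H) = 0" if "a \<in> carrier H" for a m
  proof (rule lin_hat_ext[where u = 0, OF H C g1[OF that, of m]])
    fix G assume "lin (hat H) complex_line G" "G (hat_k H) = 0"
      "\<And>c n. c \<in> carrier H \<Longrightarrow> G (hat_elem H c n) = g m n a c"
    then show ?thesis by (intro exI[of _ G]) simp
  qed simp
  note ex = this
  define \<phi> where "\<phi> m a = (SOME \<phi>. lin (hat H) complex_line \<phi> \<and>
    (\<forall>c\<in>carrier H. \<forall>n. \<phi> (hat_elem H c n) = g m n a c) \<and> \<phi> (hat_k H) = 0)" for m a
  have \<phi>: "lin (hat H) complex_line (\<phi> m a)"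
    "\<And>c n. c \<in> carrier H \<Longrightarrow> \<phi> m a (hat_elem H c n) = g m n a c" "\<phi> m a (hat_k H) = 0"
    if "a \<in> carrier H" for m a
    using someI_ex[OF ex[OF that, of m], folded \<phi>_def] by blast+
  \<comment> \<open>The functional was chosen for each \<open>a\<close> separately. On each mode
    \<open>x\<close> its value is given by \<open>g\<close>, which is linear in \<open>a\<close>,
    and the modes and \<open>hat_k H\<close> span.\<close>
  have \<phi>a: "lin H complex_line (\<lambda>a. \<phi> m a x)" if "x \<in> carrier (hat H)" for m x
  proof (rule lin_on_spans[OF vs_hat[OF H] H C spans_hat[OF H] \<phi>(1) _ that])
    fix x assume "x \<in> {hat_elem H a n |a n. a \<in> carrier H} \<union> {hat_k H}"
    then consider c n where "c \<in> carrier H" "x = hat_elem H c n" | "x = hat_k H" by auto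
    then show "lin H complex_line (\<lambda>a. \<phi> m a x)"
    proof cases
      case 1
      show ?thesis by (rule lin_cong[OF H g2[OF 1(1), of m n]]) (simp add: 1 \<phi>(2))
    next
      case 2
      then show ?thesis using lin_cong[OF H lin_const_zero[OF C]] \<phi>(3) by simp
    qed
  qed
  \<comment> \<open>With the second argument fixed, the same extension is now made in the first
    argument.\<close>
  have "\<exists>G. lin (hat H) complex_line G \<and> (\<forall>a\<in>carrier H. \<forall>m. G (hat_elem H a m) = \<phi> m a x) \<and>
      G (hat_k H) = 0" if "x \<in> carrier (hat H)" for x
  proof (rule lin_hat_ext[where u = 0, OF H C \<phi>a[OF that]])
    fix G assume "lin (hat H) complex_line G" "G (hat_k H) = 0"
      "\<And>a m. a \<in> carrier H \<Longrightarrow> G (hat_elem H a m) = \<phi> m a x"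
    then show ?thesis by (intro exI[of _ G]) simp
  qed simp
  then obtain G where G: "\<And>x. x \<in> carrier (hat H) \<Longrightarrow> lin (hat H) complex_line (G x)"
    "\<And>x a m. x \<in> carrier (hat H) \<Longrightarrow> a \<in> carrier H \<Longrightarrow> G x (hat_elem H a m) = \<phi> m a x"
    "\<And>x. x \<in> carrier (hat H) \<Longrightarrow> G x (hat_k H) = 0"
    by metis
  show thesis
  proof (rule that[of "\<lambda>x y. G y x"])
    show "bilin (hat H) (hat H) complex_line (\<lambda>x y. G y x)"
    proof (rule bilin_on_spans[OF vs_hat[OF H] vs_hat[OF H] C spans_hat[OF H] G(1)])
      fix x assume "x \<in> {hat_elem H a n |a n. a \<in> carrier H} \<union> {hat_k H}"
      then consider a m where "a \<in> carrier H" "x = hat_elem H a m" | "x = hat_k H" by auto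
      then show "lin (hat H) complex_line (\<lambda>y. G y x)"
      proof cases
        case 1
        show ?thesis by (rule lin_cong[OF vs_hat[OF H] \<phi>(1)[OF 1(1), of m]]) (simp add: 1 G(2))
      next
        case 2
        then show ?thesis using lin_cong[OF vs_hat[OF H] lin_const_zero[OF C]] G(3) by simp
      qed
    qed
  qed (simp_all add: G \<phi> g_def hat_elem_closed[OF H])
qed

text \<open>For nonnegative modes only the effect on \<open>1 \<otimes> x\<close> is recorded; on
  other tensors it follows from the exchange rules with negative modes. That is all the comparison
  with \<open>M\<close> requires.\<close>

lemma fock_module:
  assumes nd: "nondegenerate_form H B" and M: "left_module (tensor_algebra H) M \<tau>"
  defines "T \<equiv> tensor_algebra (hat_neg H)"
  obtains act where "left_module (N_algebra H B) (tensor T M) act"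
    "\<And>v u x. v \<in> hat_minus H \<Longrightarrow> u \<in> carrier T \<Longrightarrow> x \<in> carrier M \<Longrightarrow>
      act (N_incl H B v) (pure_tensor T M u x) = pure_tensor T M (tensor_incl (hat_neg H) v \<otimes>\<^bsub>T\<^esub> u) x"
    "\<And>a n x. a \<in> carrier H \<Longrightarrow> n > 0 \<Longrightarrow> x \<in> carrier M \<Longrightarrow>
      act (N_incl H B (hat_elem H a n)) (pure_tensor T M \<one>\<^bsub>T\<^esub> x) = \<zero>\<^bsub>tensor T M\<^esub>"
    "\<And>a x. a \<in> carrier H \<Longrightarrow> x \<in> carrier M \<Longrightarrow>
      act (N_incl H B (hat_elem H a 0)) (pure_tensor T M \<one>\<^bsub>T\<^esub> x) =
        pure_tensor T M \<one>\<^bsub>T\<^esub> (\<tau> (tensor_incl H a) x)"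
    "\<And>w. w \<in> carrier (tensor T M) \<Longrightarrow> act (N_incl H B (hat_k H)) w = w"
proof -
  interpret nondegenerate_form H B by (rule nd)
  interpret M: left_module "tensor_algebra H" M \<tau> by (rule M)
  note H = vector_space
  note T = complex_algebraD[OF complex_algebra_tensor_algebra[OF vs_hat_neg[OF H]], folded T_def]
  interpret T: ring T by (rule T)
  note MM = M.vector_space
  let ?W = "tensor T M" and ?i = "tensor_incl (hat_neg H)"
  let ?p = "pure_tensor T M"
  have W: "vs ?W" by (rule vs_tensor[OF T(2) MM])
  note p = bilin_pure_tensor[OF T(2) MM]
  note pc = bilinD(3)[OF p]
  note i = lin_tensor_incl[OF vs_hat_neg[OF H], folded T_def]
  note ic = linD(1)[OF i]
  note Ws = vs_closed[OF W]
  note hk = hat_k_closed[OF H] and he = hat_elem_closed[OF H]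
  obtain \<pi> where \<pi>: "lin (hat H) (hat_neg H) \<pi>"
    "\<And>a n. a \<in> carrier H \<Longrightarrow> \<pi> (hat_elem H a n) = (if n < 0 then hat_elem H a n else \<zero>\<^bsub>hat H\<^esub>)"
    "\<pi> (hat_k H) = \<zero>\<^bsub>hat H\<^esub>"
    using minus_projection[OF H] by metis
  obtain \<rho> where \<rho>: "lin (hat H) H \<rho>"
    "\<And>a n. a \<in> carrier H \<Longrightarrow> \<rho> (hat_elem H a n) = (if n = 0 then a else \<zero>\<^bsub>H\<^esub>)"
    "\<rho> (hat_k H) = \<zero>\<^bsub>H\<^esub>"
    using zero_projection[OF H] by metis
  obtain d where d: "bilin (hat H) (hat H) complex_line d"
    "\<And>a c m n. a \<in> carrier H \<Longrightarrow> c \<in> carrier H \<Longrightarrow>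
      d (hat_elem H a m) (hat_elem H c n) = (if m > 0 \<and> m + n = 0 then of_int m * B a c else 0)"
    "\<And>x. x \<in> carrier (hat H) \<Longrightarrow> d (hat_k H) x = 0"
    using mode_pairing[OF nd] by metis
  note dhm = bilin_comp_right[OF d(1) lin_hat_neg_incl[OF H]]
  have d0: "d (hat_elem H a n) v = 0" if "a \<in> carrier H" "n \<le> 0" "v \<in> hat_minus H" for a n v
    by (rule lin_eq_on_spans[OF vs_hat_neg[OF H] vs_complex_line bilinD(1)[OF dhm he[OF that(1)]]
          lin_const_zero[OF vs_complex_line, unfolded complex_line_simps] spans_hat_neg[OF H]])
      (use that d(2) in auto)
  obtain D where D: "bilin (hat H) T T D" "\<And>x. x \<in> carrier (hat H) \<Longrightarrow> D x \<one>\<^bsub>T\<^esub> = \<zero>\<^bsub>T\<^esub>"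
    "\<And>x v u. x \<in> carrier (hat H) \<Longrightarrow> v \<in> hat_minus H \<Longrightarrow> u \<in> carrier T \<Longrightarrow>
      D x (?i v \<otimes>\<^bsub>T\<^esub> u) = d x v \<odot>\<^bsub>T\<^esub> u \<oplus>\<^bsub>T\<^esub> ?i v \<otimes>\<^bsub>T\<^esub> D x u"
  proof (rule contraction_ext[OF vs_hat[OF H] vs_hat_neg[OF H] dhm, folded T_def])
    fix D assume D: "bilin (hat H) T T D" "\<And>x. x \<in> carrier (hat H) \<Longrightarrow> D x \<one>\<^bsub>T\<^esub> = \<zero>\<^bsub>T\<^esub>"
      "\<And>x v u. x \<in> carrier (hat H) \<Longrightarrow> v \<in> carrier (hat_neg H) \<Longrightarrow> u \<in> carrier T \<Longrightarrow>
        D x (?i v \<otimes>\<^bsub>T\<^esub> u) = d x v \<odot>\<^bsub>T\<^esub> u \<oplus>\<^bsub>T\<^esub> ?i v \<otimes>\<^bsub>T\<^esub> D x u"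
    show thesis by (rule that[OF D(1)]) (simp_all add: D(2,3))
  qed
  \<comment> \<open>If the functional \<open>d x\<close> vanishes on negative modes, then so does
    the operator it determines. This switches off the summand \<open>E\<close> in \<open>b\<close>
    below for zero modes, negative modes and the central element.\<close>
  have D0: "D x u = \<zero>\<^bsub>T\<^esub>"
    if x: "x \<in> carrier (hat H)" and dx: "\<And>v. v \<in> hat_minus H \<Longrightarrow> d x v = 0" and u: "u \<in> carrier T"
    for x u
  proof -
    have "u \<in> {u \<in> carrier T. D x u = \<zero>\<^bsub>T\<^esub>}"
      by (rule left_generatesD[OF left_generates_tensor_algebra[OF vs_hat_neg[OF H], folded T_def]
            subsp_equalizer[OF T(2) T(2) bilinD(1)[OF D(1) x] lin_const_zero[OF T(2)]] _ _ u])
        (use x ic in \<open>auto simp: D(2,3) dx vs_smult(1)[OF T(2)]\<close>)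
    then show ?thesis by simp
  qed
  obtain L where L: "bilin (hat_neg H) ?W ?W L"
    "\<And>v u x. v \<in> hat_minus H \<Longrightarrow> u \<in> carrier T \<Longrightarrow> x \<in> carrier M \<Longrightarrow>
      L v (?p u x) = ?p (?i v \<otimes>\<^bsub>T\<^esub> u) x"
  proof (rule bilin_tensor_map_left[OF vs_hat_neg[OF H] T(2) MM T(2) bilin_comp_left[OF T(3) i]])
    fix b assume b: "bilin (hat_neg H) ?W ?W b" "\<And>v u x. v \<in> carrier (hat_neg H) \<Longrightarrow> u \<in> carrier T \<Longrightarrow>
      x \<in> carrier M \<Longrightarrow> b v (?p u x) = ?p (?i v \<otimes>\<^bsub>T\<^esub> u) x"
    show thesis by (rule that[OF b(1)]) (simp add: b(2))
  qed
  obtain E where E: "bilin (hat H) ?W ?W E"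
    "\<And>y u x. y \<in> carrier (hat H) \<Longrightarrow> u \<in> carrier T \<Longrightarrow> x \<in> carrier M \<Longrightarrow> E y (?p u x) = ?p (D y u) x"
    using bilin_tensor_map_left[OF vs_hat[OF H] T(2) MM T(2) D(1)] by metis
  obtain Z where Z: "bilin H ?W ?W Z"
    "\<And>a u x. a \<in> carrier H \<Longrightarrow> u \<in> carrier T \<Longrightarrow> x \<in> carrier M \<Longrightarrow>
      Z a (?p u x) = ?p u (\<tau> (tensor_incl H a) x)"
    using bilin_tensor_map_right[OF H T(2) MM MM bilin_comp_left[OF
          left_module_bilin[OF complex_algebraD(2)[OF complex_algebra_tensor_algebra[OF H]] M] lin_tensor_incl[OF H]]]
    by metis
  note tc = M.act_closed[OF linD(1)[OF lin_tensor_incl[OF H]]]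
  note Lc = bilinD(3)[OF L(1), simplified] and Ec = bilinD(3)[OF E(1)] and Zc = bilinD(3)[OF Z(1)]
  note L1 = bilinD(1)[OF L(1), simplified] and E1 = bilinD(1)[OF E(1)] and Z1 = bilinD(1)[OF Z(1)]
  \<comment> \<open>One bilinear formula serves all modes: on a single mode, or on
    \<open>hat_k H\<close>, at most one of the four summands survives, namely \<open>L\<close> for
    negative, \<open>E\<close> for positive and \<open>Z\<close> for zero modes, and the scalar for
    the central element.\<close>
  define b where "b x w = (L (\<pi> x) w \<oplus>\<^bsub>?W\<^esub> E x w) \<oplus>\<^bsub>?W\<^esub> (Z (\<rho> x) w \<oplus>\<^bsub>?W\<^esub> snd x \<odot>\<^bsub>?W\<^esub> w)" for x w
  have b: "bilin (hat H) ?W ?W b"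
    unfolding b_def[abs_def]
  proof (intro bilin_plus W E(1) bilin_comp_left[OF L(1) \<pi>(1)] bilin_comp_left[OF Z(1) \<rho>(1)])
    show "bilin (hat H) ?W ?W (\<lambda>x w. snd x \<odot>\<^bsub>?W\<^esub> w)"
      unfolding hat_def by (intro bilinI lin_scale lin_smult_vec lin_snd lin_id W)
  qed
  have E0: "E x w = \<zero>\<^bsub>?W\<^esub>"
    if x: "x \<in> carrier (hat H)" and dx: "\<And>v. v \<in> hat_minus H \<Longrightarrow> d x v = 0" and w: "w \<in> carrier ?W"
    for x w
  proof (rule lin_eq_on_tensor[OF T(2) MM W E1[OF x] lin_const_zero[OF W] _ w])
    fix u m assume um: "u \<in> carrier T" "m \<in> carrier M"
    then show "E x (?p u m) = \<zero>\<^bsub>?W\<^esub>"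
      using lin_zero[OF T(2) W bilinD(2)[OF p um(2)]] by (simp add: E(2) x D0[OF x dx])
  qed
  have L0: "L \<zero>\<^bsub>hat H\<^esub> w = \<zero>\<^bsub>?W\<^esub>" and Z0: "Z \<zero>\<^bsub>H\<^esub> w = \<zero>\<^bsub>?W\<^esub>" if w: "w \<in> carrier ?W" for w
    using lin_zero[OF vs_hat_neg[OF H] W bilinD(2)[OF L(1) w]] lin_zero[OF H W bilinD(2)[OF Z(1) w]]
    by simp_all
  have snd_e: "snd (hat_elem H a n) = 0" and snd_k: "snd (hat_k H) = 1" for a n
    by (simp_all add: hat_tensor_def hat_k_def)
  note W0 = vs_add_ac(2,3)[OF W] vs_smult(1,2)[OF W]
  have b_neg: "b (hat_elem H a n) w = L (hat_elem H a n) w"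
    if "a \<in> carrier H" "n < 0" "w \<in> carrier ?W" for a n w
    using that hat_elem_in_hat_minus[OF H that(1,2)]
    by (simp add: b_def \<pi>(2) \<rho>(2) Z0 snd_e E0[OF he d0] W0 Ws Lc)
  have b_zero: "b (hat_elem H a 0) w = Z a w"
    if "a \<in> carrier H" "w \<in> carrier ?W" for a w
    using that by (simp add: b_def \<pi>(2) \<rho>(2) L0 snd_e E0[OF he d0] W0 Ws Zc)
  have b_pos: "b (hat_elem H a n) w = E (hat_elem H a n) w"
    if "a \<in> carrier H" "n > 0" "w \<in> carrier ?W" for a n w
    using that he[OF that(1), of n] by (simp add: b_def \<pi>(2) \<rho>(2) L0 Z0 snd_e W0 Ws Ec)
  have b_k: "b (hat_k H) w = w" if "w \<in> carrier ?W" for w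
  proof -
    have "E (hat_k H) w = \<zero>\<^bsub>?W\<^esub>"
      by (rule E0[OF hk _ that]) (use subspD(1)[OF subsp_hat_minus[OF H]] d(3) in blast)
    then show ?thesis using that by (simp add: b_def \<pi>(3) \<rho>(3) L0 Z0 snd_k W0 Ws)
  qed
  \<comment> \<open>This is the recursion for \<open>D\<close> carried over to the tensor product;
    the summand with \<open>d y v\<close> becomes the central term of the relation between a
    positive and a negative mode.\<close>
  have EL: "E y (L v w) = L v (E y w) \<oplus>\<^bsub>?W\<^esub> d y v \<odot>\<^bsub>?W\<^esub> w"
    if y: "y \<in> carrier (hat H)" and v: "v \<in> hat_minus H" and w: "w \<in> carrier ?W" for y v w
  proof (rule lin_eq_on_tensor[OF T(2) MM W lin_comp[OF L1[OF v] E1[OF y]]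
        lin_plus[OF W lin_comp[OF E1[OF y] L1[OF v]] lin_scale[OF W lin_id]] _ w])
    fix u m assume um: "u \<in> carrier T" "m \<in> carrier M"
    have iv: "?i v \<in> carrier T" using ic v by simp
    have Du: "D y u \<in> carrier T" using bilinD(3)[OF D(1) y um(1)] .
    have "E y (L v (?p u m)) = ?p (d y v \<odot>\<^bsub>T\<^esub> u \<oplus>\<^bsub>T\<^esub> ?i v \<otimes>\<^bsub>T\<^esub> D y u) m"
      using um v y iv by (simp add: L(2) E(2) D(3))
    also have "\<dots> = d y v \<odot>\<^bsub>?W\<^esub> ?p u m \<oplus>\<^bsub>?W\<^esub> ?p (?i v \<otimes>\<^bsub>T\<^esub> D y u) m"
      using um iv Du by (simp add: linD(2,3)[OF bilinD(2)[OF p]] vs_closed[OF T(2)])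
    also have "\<dots> = L v (E y (?p u m)) \<oplus>\<^bsub>?W\<^esub> d y v \<odot>\<^bsub>?W\<^esub> ?p u m"
      using um v y iv Du by (simp add: L(2) E(2) vs_add_ac(1)[OF W] pc Ws)
    finally show "E y (L v (?p u m)) = L v (E y (?p u m)) \<oplus>\<^bsub>?W\<^esub> d y v \<odot>\<^bsub>?W\<^esub> ?p u m" .
  qed
  \<comment> \<open>\<open>L\<close> and \<open>E\<close> act on the left tensor factor and
    \<open>Z\<close> on the right one, so they commute; this gives the relations with zero
    modes.\<close>
  have LZ: "L v (Z a w) = Z a (L v w)"
    if v: "v \<in> hat_minus H" and a: "a \<in> carrier H" and w: "w \<in> carrier ?W" for v a w
    by (rule lin_eq_on_tensor[OF T(2) MM W lin_comp[OF Z1[OF a] L1[OF v]]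
          lin_comp[OF L1[OF v] Z1[OF a]] _ w])
      (use v a ic in \<open>simp add: L(2) Z(2) tc\<close>)
  have EZ: "E y (Z a w) = Z a (E y w)"
    if y: "y \<in> carrier (hat H)" and a: "a \<in> carrier H" and w: "w \<in> carrier ?W" for y a w
    by (rule lin_eq_on_tensor[OF T(2) MM W lin_comp[OF Z1[OF a] E1[OF y]]
          lin_comp[OF E1[OF y] Z1[OF a]] _ w])
      (use y a bilinD(3)[OF D(1)] in \<open>simp add: E(2) Z(2) tc\<close>)
  note bc = bilinD(3)[OF b]
  obtain act where act: "left_module (N_algebra H B) ?W act"
    "\<And>x w. x \<in> carrier (hat H) \<Longrightarrow> w \<in> carrier ?W \<Longrightarrow> act (N_incl H B x) w = b x w"
  proof (rule left_module_N[OF H W b])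
    fix a c m n w
    assume a: "a \<in> carrier H" "c \<in> carrier H" "m > (0::int)" "n < (0::int)" "w \<in> carrier ?W"
    have v: "hat_elem H c n \<in> hat_minus H" using hat_elem_in_hat_minus[OF H] a by simp
    show "b (hat_elem H a m) (b (hat_elem H c n) w) =
        b (hat_elem H c n) (b (hat_elem H a m) w) \<oplus>\<^bsub>?W\<^esub>
        (of_int m * B a c * (if m + n = 0 then 1 else 0)) \<odot>\<^bsub>?W\<^esub> b (hat_k H) w"
      using a v EL[OF he[OF a(1)] v a(5)] by (simp add: b_pos b_neg b_k bc he Lc Ec d(2))
  next
    fix a c j w
    assume a: "a \<in> carrier H" "c \<in> carrier H" "j \<noteq> (0::int)" "w \<in> carrier ?W"
    have v: "hat_elem H a j \<in> hat_minus H" if "j < 0" using hat_elem_in_hat_minus[OF H] a that by simp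
    show "b (hat_elem H a j) (b (hat_elem H c 0) w) = b (hat_elem H c 0) (b (hat_elem H a j) w)"
      using a v by (cases "j < 0") (simp_all add: b_pos b_neg b_zero LZ EZ he Zc Lc Ec)
  next
    fix a j w assume "a \<in> carrier H" "w \<in> carrier ?W"
    then show "b (hat_elem H a j) (b (hat_k H) w) = b (hat_k H) (b (hat_elem H a j) w)"
      by (simp add: b_k bc he)
  next
    fix act assume act: "left_module (N_algebra H B) ?W act"
      "\<And>x w. x \<in> carrier (hat H) \<Longrightarrow> w \<in> carrier ?W \<Longrightarrow> act (N_incl H B x) w = b x w"
    show thesis by (rule that[OF act(1)]) (simp add: act(2))
  qed
  show thesis
  proof (rule that[OF act(1)])
    fix v u x assume v: "v \<in> hat_minus H" and u: "u \<in> carrier T" "x \<in> carrier M"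
    have vh: "v \<in> carrier (hat H)" using v subspD(1)[OF subsp_hat_minus[OF H]] by blast
    \<comment> \<open>So far \<open>b\<close> is known on single modes only; a general element of
      \<open>hat_minus H\<close> is reached by linearity.\<close>
    have "b v (?p u x) = L v (?p u x)"
      by (rule lin_eq_on_spans[OF vs_hat_neg[OF H] W lin_comp[OF lin_hat_neg_incl[OF H] bilinD(2)[OF b pc[OF u]]]
            bilinD(2)[OF L(1) pc[OF u]] spans_hat_neg[OF H]])
        (use b_neg pc u v in auto)
    then show "act (N_incl H B v) (?p u x) = ?p (?i v \<otimes>\<^bsub>T\<^esub> u) x"
      using v vh u by (simp add: act(2) pc L(2))
  next
    fix a n x assume a: "a \<in> carrier H" "n > (0::int)" "x \<in> carrier M"
    then show "act (N_incl H B (hat_elem H a n)) (?p \<one>\<^bsub>T\<^esub> x) = \<zero>\<^bsub>?W\<^esub>"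
      using lin_zero[OF T(2) W bilinD(2)[OF p a(3)]]
      by (simp add: act(2) he pc b_pos E(2) D(2))
  next
    fix a x assume "a \<in> carrier H" "x \<in> carrier M"
    then show "act (N_incl H B (hat_elem H a 0)) (?p \<one>\<^bsub>T\<^esub> x) = ?p \<one>\<^bsub>T\<^esub> (\<tau> (tensor_incl H a) x)"
      by (simp add: act(2) he pc b_zero Z(2))
  next
    fix w assume "w \<in> carrier ?W"
    then show "act (N_incl H B (hat_k H)) w = w" by (simp add: act(2) hk b_k)
  qed
qed

section \<open>Generated subalgebras\<close>

text \<open>Negatives, demanded by \<open>subring\<close>, come from scaling by -1, so both library
  notions together reduce to three closure conditions.\<close>

lemma subalgebra_iff:
  assumes "complex_algebra A"
  shows "subring P A \<and> submodule P \<complex>\<F> A \<longleftrightarrow>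
    subsp A P \<and> \<one>\<^bsub>A\<^esub> \<in> P \<and> (\<forall>x\<in>P. \<forall>y\<in>P. x \<otimes>\<^bsub>A\<^esub> y \<in> P)"
proof -
  interpret A: ring A by (rule complex_algebraD[OF assms])
  show ?thesis
  proof (intro iffI conjI; (elim conjE)?)
    assume P: "subring P A" "submodule P \<complex>\<F> A"
    show "subsp A P" using P(2) by (simp add: submodule_iff_subsp[OF complex_algebraD(2)[OF assms]])
    show "\<one>\<^bsub>A\<^esub> \<in> P" "\<forall>x\<in>P. \<forall>y\<in>P. x \<otimes>\<^bsub>A\<^esub> y \<in> P"
      using subringE(3,6)[OF P(1)] by auto
  next
    assume P: "subsp A P" "\<one>\<^bsub>A\<^esub> \<in> P" "\<forall>x\<in>P. \<forall>y\<in>P. x \<otimes>\<^bsub>A\<^esub> y \<in> P"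
    then show "submodule P \<complex>\<F> A" by (simp add: submodule_iff_subsp[OF complex_algebraD(2)[OF assms]])
    show "subring P A"
    proof (rule A.subringI)
      fix h assume "h \<in> P"
      then show "\<ominus>\<^bsub>A\<^esub> h \<in> P"
        using subspD(1,4)[OF P(1)] vs_smult(7)[OF complex_algebraD(2)[OF assms], of h] by auto
    qed (use P subspD[OF P(1)] in auto)
  qed
qed

lemma generated_subalgebra:
  assumes "complex_algebra A" "S \<subseteq> carrier A"
  defines "P \<equiv> generated_subalgebra A S"
  shows "subsp A P" "\<one>\<^bsub>A\<^esub> \<in> P" "\<And>x y. x \<in> P \<Longrightarrow> y \<in> P \<Longrightarrow> x \<otimes>\<^bsub>A\<^esub> y \<in> P" "S \<subseteq> P"
proof -
  have P: "P = \<Inter>{P. subsp A P \<and> \<one>\<^bsub>A\<^esub> \<in> P \<and> (\<forall>x\<in>P. \<forall>y\<in>P. x \<otimes>\<^bsub>A\<^esub> y \<in> P) \<and> S \<subseteq> P}"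
    unfolding P_def generated_subalgebra_def conj_assoc[symmetric] subalgebra_iff[OF assms(1)] ..
  interpret A: ring A by (rule complex_algebraD[OF assms(1)])
  have C: "subsp A (carrier A) \<and> \<one>\<^bsub>A\<^esub> \<in> carrier A \<and>
      (\<forall>x\<in>carrier A. \<forall>y\<in>carrier A. x \<otimes>\<^bsub>A\<^esub> y \<in> carrier A) \<and> S \<subseteq> carrier A"
    using subsp_carrier[OF complex_algebraD(2)[OF assms(1)]] assms(2) by simp
  show "subsp A P"
  proof (rule subspI)
    show "P \<subseteq> carrier A" using C unfolding P by blast
  qed (auto simp: P subspD)
  show "\<one>\<^bsub>A\<^esub> \<in> P" "\<And>x y. x \<in> P \<Longrightarrow> y \<in> P \<Longrightarrow> x \<otimes>\<^bsub>A\<^esub> y \<in> P" "S \<subseteq> P"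
    unfolding P by blast+
qed

lemma generated_subalgebra_minimal:
  assumes "complex_algebra A" "subsp A Q" "\<one>\<^bsub>A\<^esub> \<in> Q" "\<And>x y. x \<in> Q \<Longrightarrow> y \<in> Q \<Longrightarrow> x \<otimes>\<^bsub>A\<^esub> y \<in> Q" "S \<subseteq> Q"
  shows "generated_subalgebra A S \<subseteq> Q"
proof -
  have "subring Q A \<and> submodule Q \<complex>\<F> A" using assms by (simp add: subalgebra_iff)
  then show ?thesis using assms(5) unfolding generated_subalgebra_def by blast
qed

text \<open>A left inverse of \<open>x \<mapsto> 1 \<otimes> x\<close>, namely the augmentation of
  the tensor algebra applied to the left factor. It shows that \<open>M\<close> embeds and lets
  vectors of \<open>1 \<otimes> M\<close> be read back in \<open>M\<close>.\<close>

lemma tensor_eval_one: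
  assumes V: "vs V" and M: "vs M"
  defines "T \<equiv> tensor_algebra V"
  obtains E where "lin (tensor T M) M E" "\<And>x. x \<in> carrier M \<Longrightarrow> E (pure_tensor T M \<one>\<^bsub>T\<^esub> x) = x"
proof -
  note T = complex_algebraD[OF complex_algebra_tensor_algebra[OF V], folded T_def]
  interpret T: ring T by (rule T)
  \<comment> \<open>Letting \<open>V\<close> act by 0 on the line turns the line into the trivial
    module, and the action on 1 is the augmentation.\<close>
  have z: "bilin V complex_line complex_line (\<lambda>v c. 0)"
    by (intro bilinI lin_const_zero[OF vs_complex_line, unfolded complex_line_simps])
  obtain e where e: "left_module T complex_line e"
    using left_module_tensor_algebra[OF V vs_complex_line z] unfolding T_def by metis
  interpret e: left_module T complex_line e by (rule e)
  have l: "lin T complex_line (\<lambda>u. e u 1)"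
    using bilinD(2)[OF left_module_bilin[OF T(2) e]] by simp
  have b: "bilin T M M (\<lambda>u x. e u 1 \<odot>\<^bsub>M\<^esub> x)"
    by (intro bilinI lin_scale M lin_id lin_smult_vec l)
  show thesis
  proof (rule lin_tensor_ext[OF T(2) M M b])
    fix E assume E: "lin (tensor T M) M E"
      "\<And>u x. u \<in> carrier T \<Longrightarrow> x \<in> carrier M \<Longrightarrow> E (pure_tensor T M u x) = e u 1 \<odot>\<^bsub>M\<^esub> x"
    show thesis
      by (rule that[OF E(1)]) (simp add: E(2) e.act_one vs_smult(2)[OF M])
  qed
qed

text \<open>The constant depends on \<open>v\<close>. Asking only for its existence gives a
  condition that is stable under sums and multiples, so it is enough to find the constant for a
  single negative mode.\<close>

lemma N_normal_order:
  assumes H: "vs H" and a: "a \<in> carrier H" and j: "j \<ge> 0" and v: "v \<in> hat_minus H"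
  shows "\<exists>c. N_incl H B (hat_elem H a j) \<otimes>\<^bsub>N_algebra H B\<^esub> N_incl H B v =
    (N_incl H B v \<otimes>\<^bsub>N_algebra H B\<^esub> N_incl H B (hat_elem H a j))
      \<oplus>\<^bsub>N_algebra H B\<^esub> c \<odot>\<^bsub>N_algebra H B\<^esub> N_incl H B (hat_k H)"
proof -
  let ?N = "N_algebra H B" and ?n = "N_incl H B"
  let ?y = "?n (hat_elem H a j)" and ?k = "?n (hat_k H)"
  note N = complex_algebraD[OF complex_algebra_N[OF H, of B]]
  interpret N: ring ?N by (rule N)
  note n = lin_N_incl[OF H, of B]
  have y: "?y \<in> carrier ?N" and k: "?k \<in> carrier ?N"
    using linD(1)[OF n] hat_elem_closed[OF H a] hat_k_closed[OF H] by auto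
  note nm = lin_comp[OF lin_hat_neg_incl[OF H] n]
  note nc = linD(1)[OF nm, simplified]
  note Nc = vs_closed[OF N(2)]
  let ?S = "{v \<in> hat_minus H. \<exists>c. ?y \<otimes>\<^bsub>?N\<^esub> ?n v = (?n v \<otimes>\<^bsub>?N\<^esub> ?y) \<oplus>\<^bsub>?N\<^esub> c \<odot>\<^bsub>?N\<^esub> ?k}"
  have "v \<in> ?S"
  proof (rule spansD[OF spans_hat_neg[OF H]])
    show "subsp (hat_neg H) ?S"
    proof (rule subspI)
      have "?n \<zero>\<^bsub>hat H\<^esub> = \<zero>\<^bsub>?N\<^esub>" by (rule lin_zero[OF vs_hat[OF H] N(2) n])
      then have "?y \<otimes>\<^bsub>?N\<^esub> ?n \<zero>\<^bsub>hat H\<^esub> = (?n \<zero>\<^bsub>hat H\<^esub> \<otimes>\<^bsub>?N\<^esub> ?y) \<oplus>\<^bsub>?N\<^esub> 0 \<odot>\<^bsub>?N\<^esub> ?k"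
        using y k by (simp add: vs_smult(1)[OF N(2)])
      then show "\<zero>\<^bsub>hat_neg H\<^esub> \<in> ?S"
        using subspD(2)[OF subsp_hat_minus[OF H]] by auto
    next
      fix v w assume "v \<in> ?S" "w \<in> ?S"
      then obtain c d where vw: "v \<in> hat_minus H" "w \<in> hat_minus H"
        "?y \<otimes>\<^bsub>?N\<^esub> ?n v = (?n v \<otimes>\<^bsub>?N\<^esub> ?y) \<oplus>\<^bsub>?N\<^esub> c \<odot>\<^bsub>?N\<^esub> ?k"
        "?y \<otimes>\<^bsub>?N\<^esub> ?n w = (?n w \<otimes>\<^bsub>?N\<^esub> ?y) \<oplus>\<^bsub>?N\<^esub> d \<odot>\<^bsub>?N\<^esub> ?k" by auto
      have "?y \<otimes>\<^bsub>?N\<^esub> ?n (v \<oplus>\<^bsub>hat H\<^esub> w) =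
        (?n (v \<oplus>\<^bsub>hat H\<^esub> w) \<otimes>\<^bsub>?N\<^esub> ?y) \<oplus>\<^bsub>?N\<^esub> (c + d) \<odot>\<^bsub>?N\<^esub> ?k"
        using vw y k linD(2)[OF nm, simplified]
        by (simp add: N.r_distr N.l_distr nc vs_smult(3)[OF N(2)] vs_add_swap[OF N(2)] Nc)
      then show "v \<oplus>\<^bsub>hat_neg H\<^esub> w \<in> ?S" using vw subspD(3)[OF subsp_hat_minus[OF H]] by auto
    next
      fix d v assume "v \<in> ?S"
      then obtain c where v: "v \<in> hat_minus H"
        "?y \<otimes>\<^bsub>?N\<^esub> ?n v = (?n v \<otimes>\<^bsub>?N\<^esub> ?y) \<oplus>\<^bsub>?N\<^esub> c \<odot>\<^bsub>?N\<^esub> ?k" by auto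
      have "?y \<otimes>\<^bsub>?N\<^esub> ?n (d \<odot>\<^bsub>hat H\<^esub> v) =
        (?n (d \<odot>\<^bsub>hat H\<^esub> v) \<otimes>\<^bsub>?N\<^esub> ?y) \<oplus>\<^bsub>?N\<^esub> (d * c) \<odot>\<^bsub>?N\<^esub> ?k"
        using v y k linD(3)[OF nm, simplified]
        by (simp add: linD(3)[OF bilinD(1)[OF N(3)]] linD(3)[OF bilinD(2)[OF N(3)]] nc
            vs_smult(4,5)[OF N(2)] Nc)
      then show "d \<odot>\<^bsub>hat_neg H\<^esub> v \<in> ?S" using v subspD(4)[OF subsp_hat_minus[OF H]] by auto
    qed auto
    show "{hat_elem H a n |a n. a \<in> carrier H \<and> n < 0} \<subseteq> ?S"
    proof (rule subsetI)
      fix x assume "x \<in> {hat_elem H a n |a n. a \<in> carrier H \<and> n < 0}"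
      then obtain c n where c: "c \<in> carrier H" "n < 0" and x: "x = hat_elem H c n" by auto
      have m: "hat_elem H c n \<in> hat_minus H" by (rule hat_elem_in_hat_minus[OF H c])
      have "hat_elem H c n \<in> ?S"
      \<comment> \<open>For \<open>j = 0\<close> the second family of relations applies with the
        negative mode as its nonzero mode, read backwards, and the constant is 0. For
        \<open>j > 0\<close> the first family gives the constant.\<close>
      proof (cases "j = 0")
        case True
        then show ?thesis
          using N_commutators(2)[OF H c(1) a, of n B] c m y k nc[OF m]
          by (intro CollectI conjI exI[of _ 0]) (simp_all add: vs_smult(1)[OF N(2)])
      next
        case False
        then show ?thesis using N_commutators(1)[OF H a c(1) _ c(2), of j B] j m by auto
      qed
      then show "x \<in> ?S" unfolding x .
    qed
  qed (use v in simp)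
  then show ?thesis by auto
qed

section \<open>The action of the nonnegative subalgebra on \<open>M\<close>\<close>

context
  fixes H :: "(complex, 'h) module" and B :: "'h \<Rightarrow> 'h \<Rightarrow> complex"
    and M :: "(complex, 'm) module" and \<tau> :: "('h list \<Rightarrow>\<^sub>0 complex) set \<Rightarrow> 'm \<Rightarrow> 'm"
  assumes nd: "nondegenerate_form H B" and M: "left_module (tensor_algebra H) M \<tau>"
begin

lemma vs_H: "vs H"
  using nd by (rule nondegenerate_form.vector_space)

lemma vs_M: "vs M"
  using M by (rule left_module.vector_space)

abbreviation (input) N where "N \<equiv> N_algebra H B"
abbreviation (input) P where "P \<equiv> N_nonneg H B"
abbreviation (input) \<nu> where "\<nu> \<equiv> N_incl H B"
abbreviation (input) T where "T \<equiv> tensor_algebra (hat_neg H)"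

lemma hat_nonneg_closed: "hat_plus H \<union> hat_zero H \<subseteq> carrier (hat H)"
  using hat_plus_subset[OF vs_H subsp_carrier[OF vs_hat[OF vs_H]]]
    hat_zero_subset[OF vs_H subsp_carrier[OF vs_hat[OF vs_H]]]
    hat_elem_closed[OF vs_H] hat_k_closed[OF vs_H] by blast

lemma N_nonneg:
  "subsp N P" "\<one>\<^bsub>N\<^esub> \<in> P" "\<And>x y. x \<in> P \<Longrightarrow> y \<in> P \<Longrightarrow> x \<otimes>\<^bsub>N\<^esub> y \<in> P"
  "\<And>u. u \<in> hat_plus H \<union> hat_zero H \<Longrightarrow> \<nu> u \<in> P"
proof -
  have "\<nu> ` (hat_plus H \<union> hat_zero H) \<subseteq> carrier N"
    using hat_nonneg_closed linD(1)[OF lin_N_incl[OF vs_H]] by auto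
  note * = generated_subalgebra[OF complex_algebra_N[OF vs_H] this, folded N_nonneg_def]
  show "subsp N P" "\<one>\<^bsub>N\<^esub> \<in> P" "\<And>x y. x \<in> P \<Longrightarrow> y \<in> P \<Longrightarrow> x \<otimes>\<^bsub>N\<^esub> y \<in> P"
    "\<And>u. u \<in> hat_plus H \<union> hat_zero H \<Longrightarrow> \<nu> u \<in> P"
    using * by (blast | rule *)+
qed

text \<open>Induction over the nonnegative subalgebra from its modes. It is applied to the elements
  that preserve \<open>1 \<otimes> M\<close>, and later to those that act there as
  \<open>act\<close> prescribes.\<close>

lemma N_nonneg_subset:
  assumes "subsp N Q" "\<one>\<^bsub>N\<^esub> \<in> Q" "\<And>x y. x \<in> Q \<Longrightarrow> y \<in> Q \<Longrightarrow> x \<otimes>\<^bsub>N\<^esub> y \<in> Q"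
    "\<And>a n. a \<in> carrier H \<Longrightarrow> n \<ge> 0 \<Longrightarrow> \<nu> (hat_elem H a n) \<in> Q" "\<nu> (hat_k H) \<in> Q"
  shows "P \<subseteq> Q"
  unfolding N_nonneg_def
proof (rule generated_subalgebra_minimal[OF complex_algebra_N[OF vs_H] assms(1-3)])
  let ?S = "{x \<in> carrier (hat H). \<nu> x \<in> Q}"
  have S: "subsp (hat H) ?S"
    by (rule subsp_vimage[OF vs_hat[OF vs_H] complex_algebraD(2)[OF complex_algebra_N[OF vs_H]] lin_N_incl[OF vs_H] assms(1)])
  have "hat_plus H \<subseteq> ?S" "hat_zero H \<subseteq> ?S"
    using assms(4,5) hat_elem_closed[OF vs_H] hat_k_closed[OF vs_H]
    by (intro hat_plus_subset[OF vs_H S] hat_zero_subset[OF vs_H S]; simp)+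
  then show "\<nu> ` (hat_plus H \<union> hat_zero H) \<subseteq> Q" by auto
qed

text \<open>The action is the Fock action restricted to \<open>1 \<otimes> M\<close> and transported
  to \<open>M\<close>; its compatibility with the relations among nonnegative elements is inherited
  from the whole algebra.\<close>

lemma extension_exists: "\<exists>act. extends_action H B M \<tau> act"
proof -
  note T = complex_algebraD[OF complex_algebra_tensor_algebra[OF vs_hat_neg[OF vs_H]]]
  note N = complex_algebraD[OF complex_algebra_N[OF vs_H, of B]]
  interpret T: ring T by (rule T)
  interpret N: ring N by (rule N)
  let ?W = "tensor T M" and ?j = "pure_tensor T M \<one>\<^bsub>T\<^esub>"
  have W: "vs ?W" by (rule vs_tensor[OF T(2) vs_M])
  have j: "lin M ?W ?j" by (rule bilinD(1)[OF bilin_pure_tensor[OF T(2) vs_M]]) simp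
  note jc = linD(1)[OF j]
  obtain f where f: "left_module N ?W f"
    "\<And>a n x. a \<in> carrier H \<Longrightarrow> n > 0 \<Longrightarrow> x \<in> carrier M \<Longrightarrow> f (\<nu> (hat_elem H a n)) (?j x) = \<zero>\<^bsub>?W\<^esub>"
    "\<And>a x. a \<in> carrier H \<Longrightarrow> x \<in> carrier M \<Longrightarrow>
      f (\<nu> (hat_elem H a 0)) (?j x) = ?j (\<tau> (tensor_incl H a) x)"
    "\<And>w. w \<in> carrier ?W \<Longrightarrow> f (\<nu> (hat_k H)) w = w"
    using fock_module[OF nd M] by metis
  interpret f: left_module N ?W f by (rule f)
  note fb = left_module_bilin[OF N(2) f(1)]
  obtain E where E: "lin ?W M E" "\<And>x. x \<in> carrier M \<Longrightarrow> E (?j x) = x"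
    using tensor_eval_one[OF vs_hat_neg[OF vs_H] vs_M] by metis
  note Ec = linD(1)[OF E(1)]
  have jE: "lin ?W ?W (\<lambda>w. ?j (E w))" by (rule lin_comp[OF E(1) j])
  \<comment> \<open>As \<open>E\<close> inverts \<open>?j\<close> on \<open>1 \<otimes> M\<close>,
    the equation says that \<open>p\<close> maps \<open>1 \<otimes> M\<close> into itself. Written
    this way it is an equation between linear maps.\<close>
  let ?Q = "{p \<in> carrier N. \<forall>x\<in>carrier M. f p (?j x) = ?j (E (f p (?j x)))}"
  have \<nu>c: "\<nu> y \<in> carrier N" if "y \<in> carrier (hat H)" for y
    using linD(1)[OF lin_N_incl[OF vs_H] that] .
  note he = hat_elem_closed[OF vs_H] and hk = hat_k_closed[OF vs_H]
  note tc = left_module.act_closed[OF M linD(1)[OF lin_tensor_incl[OF vs_H]]]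
  have PQ: "P \<subseteq> ?Q"
  proof (rule N_nonneg_subset)
    show "subsp N ?Q"
    proof (rule subspI)
      show "\<zero>\<^bsub>N\<^esub> \<in> ?Q"
        using lin_zero[OF N(2) W bilinD(2)[OF fb]] lin_zero[OF W W jE] by (auto simp: jc)
    qed (auto simp: vs_closed[OF N(2)] f.act_add_left f.act_smult_left linD(2,3)[OF jE] f.act_closed jc)
    show "\<one>\<^bsub>N\<^esub> \<in> ?Q" by (simp add: f.act_one jc E(2))
    fix p q assume p: "p \<in> ?Q" and q: "q \<in> ?Q"
    have "f (p \<otimes>\<^bsub>N\<^esub> q) (?j x) = ?j (E (f (p \<otimes>\<^bsub>N\<^esub> q) (?j x)))" if x: "x \<in> carrier M" for x
    proof -
      define y where "y = E (f q (?j x))"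
      have y: "y \<in> carrier M" unfolding y_def using q x by (intro Ec f.act_closed jc) auto
      have "f (p \<otimes>\<^bsub>N\<^esub> q) (?j x) = f p (?j y)"
        using p q x by (simp add: f.act_mult jc y_def)
      then show ?thesis using p y by simp
    qed
    then show "p \<otimes>\<^bsub>N\<^esub> q \<in> ?Q" using p q by simp
  next
    fix a and n :: int assume a: "a \<in> carrier H" "n \<ge> 0"
    have "f (\<nu> (hat_elem H a n)) (?j x) = ?j (E (f (\<nu> (hat_elem H a n)) (?j x)))"
      if x: "x \<in> carrier M" for x
    proof (cases "n = 0")
      case True
      then show ?thesis using a x by (simp add: f(3) E(2) tc)
    next
      case False
      then show ?thesis using a x lin_zero[OF W W jE] by (simp add: f(2))
    qed
    then show "\<nu> (hat_elem H a n) \<in> ?Q" using a by (simp add: \<nu>c he)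
  next
    show "\<nu> (hat_k H) \<in> ?Q" by (simp add: \<nu>c hk f(4) jc E(2))
  qed
  then have PN: "p \<in> carrier N" and Pj: "\<And>x. x \<in> carrier M \<Longrightarrow> f p (?j x) = ?j (E (f p (?j x)))"
    if "p \<in> P" for p using that by auto
  let ?act = "\<lambda>p x. E (f p (?j x))"
  have fj: "bilin N M M ?act"
    by (rule bilin_comp_target[OF bilin_comp_right[OF fb j] E(1)])
  have "left_module (N\<lparr>carrier := P\<rparr>) M ?act"
  proof (rule left_module_of_bilin[OF vs_M])
    show "bilin (N\<lparr>carrier := P\<rparr>) M M ?act"
      using fj PN by (auto simp: bilin_def lin_def)
    fix x assume x: "x \<in> carrier M"
    show "?act \<one>\<^bsub>N\<lparr>carrier := P\<rparr>\<^esub> x = x" using x by (simp add: f.act_one jc E(2))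
    fix p q assume "p \<in> carrier (N\<lparr>carrier := P\<rparr>)" "q \<in> carrier (N\<lparr>carrier := P\<rparr>)"
    then have pq: "p \<in> P" "q \<in> P" by auto
    have "f (p \<otimes>\<^bsub>N\<^esub> q) (?j x) = f p (f q (?j x))"
      using pq x by (simp add: f.act_mult PN jc)
    \<comment> \<open>Projecting with \<open>E\<close> between the two factors loses nothing, since
      \<open>q\<close> keeps \<open>1 \<otimes> x\<close> inside
      \<open>1 \<otimes> M\<close>.\<close>
    then show "?act (p \<otimes>\<^bsub>N\<lparr>carrier := P\<rparr>\<^esub> q) x = ?act p (?act q x)"
      using Pj[OF pq(2) x] by simp
  qed
  moreover have "?act (\<nu> u) x = \<zero>\<^bsub>M\<^esub>" if u: "u \<in> hat_plus H" and x: "x \<in> carrier M" for u x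
  proof -
    have l: "lin (hat H) M (\<lambda>u. ?act (\<nu> u) x)"
      by (rule lin_comp[OF lin_N_incl[OF vs_H] bilinD(2)[OF fj x]])
    have "hat_plus H \<subseteq> {u \<in> carrier (hat H). ?act (\<nu> u) x \<in> {\<zero>\<^bsub>M\<^esub>}}"
      using lin_zero[OF W vs_M E(1)] x
      by (intro hat_plus_subset[OF vs_H subsp_vimage[OF vs_hat[OF vs_H] vs_M l subsp_zero[OF vs_M]]])
        (simp add: he f(2))
    then show ?thesis using u by auto
  qed
  moreover have "?act (\<nu> (hat_k H)) x = x" if "x \<in> carrier M" for x
    using that by (simp add: f(4) jc E(2))
  moreover have "?act (\<nu> (hat_elem H a 0)) x = \<tau> (tensor_incl H a) x"
    if "a \<in> carrier H" "x \<in> carrier M" for a x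
    using that by (simp add: f(3) E(2) tc)
  ultimately have "extends_action H B M \<tau> ?act" unfolding extends_action_def by blast
  then show ?thesis by blast
qed

section \<open>The induced module and its comparison with the Fock-type module\<close>

context
  fixes act :: "('h hat list \<Rightarrow>\<^sub>0 complex) set set \<Rightarrow> 'm \<Rightarrow> 'm"
  assumes act: "extends_action H B M \<tau> act"
begin

abbreviation (input) Ind where "Ind \<equiv> induced_module N P M act"

lemmas NN = complex_algebraD[OF complex_algebra_N[OF vs_H, of B]]
lemmas TT = complex_algebraD[OF complex_algebra_tensor_algebra[OF vs_hat_neg[OF vs_H]]]

lemma PN: "p \<in> P \<Longrightarrow> p \<in> carrier N"
  using subspD(1)[OF N_nonneg(1)] by blast

lemma act_module: "left_module (N\<lparr>carrier := P\<rparr>) M act"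
  using act by (simp add: extends_action_def)

lemma act_closed: "p \<in> P \<Longrightarrow> x \<in> carrier M \<Longrightarrow> act p x \<in> carrier M"
  using left_module.act_closed[OF act_module] by simp

lemma nonneg_mem:
  "\<nu> (hat_k H) \<in> P" "a \<in> carrier H \<Longrightarrow> j \<ge> 0 \<Longrightarrow> \<nu> (hat_elem H a j) \<in> P"
proof -
  show "\<nu> (hat_k H) \<in> P" using N_nonneg(4) hat_zero_mem(2)[OF vs_H] by blast
  assume a: "a \<in> carrier H" "j \<ge> 0"
  have "hat_elem H a j \<in> hat_plus H \<union> hat_zero H"
    using hat_zero_mem(1)[OF vs_H a(1)] hat_elem_in_hat_plus[OF vs_H a(1), of j] a(2)
    by (cases "j = 0") auto
  then show "\<nu> (hat_elem H a j) \<in> P" by (rule N_nonneg(4))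
qed

abbreviation (input) induced_relations where
  "induced_relations \<equiv> {pure_tensor N M (a \<otimes>\<^bsub>N\<^esub> p) x \<ominus>\<^bsub>tensor N M\<^esub> pure_tensor N M a (act p x)
        | a p x. a \<in> carrier N \<and> p \<in> P \<and> x \<in> carrier M}"

lemma vs_NM: "vs (tensor N M)"
  by (rule vs_tensor[OF NN(2) vs_M])

lemma induced_relations_closed: "induced_relations \<subseteq> carrier (tensor N M)"
proof -
  interpret V: module "\<complex>\<F>" "tensor N M" by (rule vs_NM)
  show ?thesis
    using bilinD(3)[OF bilin_pure_tensor[OF NN(2) vs_M]] bilinD(3)[OF NN(3)] PN act_closed
    by auto
qed

lemmas induced_kernel = subsp_lin_span[OF vs_NM induced_relations_closed]

lemma vs_Ind: "vs Ind"
  unfolding induced_module_def by (rule vs_quotient_space[OF vs_NM induced_kernel(1)])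

text \<open>The tensor of \<open>n\<close> and \<open>x\<close> over the nonnegative subalgebra, as
  an element of the induced module.\<close>

definition cls where
  "cls n x = lin_span (tensor N M) induced_relations +>\<^bsub>tensor N M\<^esub> pure_tensor N M n x"

lemma bilin_cls: "bilin N M Ind cls"
  unfolding induced_module_def cls_def[abs_def]
  by (rule bilin_comp_target[OF bilin_pure_tensor[OF NN(2) vs_M] lin_coset[OF vs_NM induced_kernel(1)]])

lemma spans_Ind: "spans Ind {cls n x | n x. n \<in> carrier N \<and> x \<in> carrier M}"
proof -
  have "{cls n x | n x. n \<in> carrier N \<and> x \<in> carrier M} =
    (\<lambda>y. lin_span (tensor N M) induced_relations +>\<^bsub>tensor N M\<^esub> y) `
      {pure_tensor N M n x | n x. n \<in> carrier N \<and> x \<in> carrier M}"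
    by (auto simp: cls_def)
  then show ?thesis
    unfolding induced_module_def
    using spans_quotient_space[OF vs_NM induced_kernel(1) spans_tensor[OF NN(2) vs_M]] by simp
qed

lemma cls_balanced:
  assumes "n \<in> carrier N" "p \<in> P" "x \<in> carrier M"
  shows "cls (n \<otimes>\<^bsub>N\<^esub> p) x = cls n (act p x)"
proof -
  let ?x = "pure_tensor N M (n \<otimes>\<^bsub>N\<^esub> p) x" and ?y = "pure_tensor N M n (act p x)"
  have xy: "?x \<in> carrier (tensor N M)" "?y \<in> carrier (tensor N M)"
    using bilinD(3)[OF bilin_pure_tensor[OF NN(2) vs_M]] bilinD(3)[OF NN(3)] PN act_closed assms
    by auto
  interpret V: module "\<complex>\<F>" "tensor N M" by (rule vs_NM)
  have "?x \<ominus>\<^bsub>tensor N M\<^esub> ?y \<in> lin_span (tensor N M) induced_relations"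
    using induced_kernel(2) assms by blast
  moreover have "?x = (?x \<ominus>\<^bsub>tensor N M\<^esub> ?y) \<oplus>\<^bsub>tensor N M\<^esub> ?y"
    using xy by (simp add: a_minus_def V.a_assoc V.l_neg)
  ultimately show ?thesis
    unfolding cls_def coset_eq_iff[OF vs_NM induced_kernel(1) xy] by blast
qed

text \<open>
  Normal ordering: modulo the span of the classes of \<open>\<iota>(u) \<otimes> x\<close>, nonnegative modes can be moved
  to the right past \<open>\<iota>(u)\<close>, where they act on \<open>M\<close>. Calling \<open>q\<close> good if all \<open>q \<iota>(u) \<otimes> x\<close> lie in the
  span, good elements are stable under right multiplication by the generators of \<open>N\<close>.
\<close>

lemma normal_ordered_span:
  assumes \<iota>: "lin T N \<iota>" "\<iota> \<one>\<^bsub>T\<^esub> = \<one>\<^bsub>N\<^esub>"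
      "\<And>v u. v \<in> hat_minus H \<Longrightarrow> u \<in> carrier T \<Longrightarrow> \<iota> (tensor_incl (hat_neg H) v \<otimes>\<^bsub>T\<^esub> u) = \<nu> v \<otimes>\<^bsub>N\<^esub> \<iota> u"
    and S: "subsp Ind S" "\<And>u x. u \<in> carrier T \<Longrightarrow> x \<in> carrier M \<Longrightarrow> cls (\<iota> u) x \<in> S"
  shows "carrier Ind \<subseteq> S"
proof -
  interpret N: ring N by (rule NN)
  interpret T: ring T by (rule TT)
  let ?i = "tensor_incl (hat_neg H)"
  note \<iota>c = linD(1)[OF \<iota>(1)]
  note ic = linD(1)[OF lin_tensor_incl[OF vs_hat_neg[OF vs_H]], simplified]
  note \<nu>l = lin_N_incl[OF vs_H, of B]
  have \<nu>h: "\<nu> v \<in> carrier N" if "v \<in> hat_minus H" for v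
    using linD(1)[OF \<nu>l] subspD(1)[OF subsp_hat_minus[OF vs_H]] that by blast
  have \<nu>e: "\<nu> (hat_elem H a n) \<in> carrier N" if "a \<in> carrier H" for a n
    by (rule linD(1)[OF \<nu>l hat_elem_closed[OF vs_H that]])
  have \<nu>k: "\<nu> (hat_k H) \<in> carrier N" by (rule linD(1)[OF \<nu>l hat_k_closed[OF vs_H]])
  define good where
    "good q \<longleftrightarrow> q \<in> carrier N \<and> (\<forall>u\<in>carrier T. \<forall>x\<in>carrier M. cls (q \<otimes>\<^bsub>N\<^esub> \<iota> u) x \<in> S)" for q
  have goodD: "q \<in> carrier N" "\<And>u x. u \<in> carrier T \<Longrightarrow> x \<in> carrier M \<Longrightarrow> cls (q \<otimes>\<^bsub>N\<^esub> \<iota> u) x \<in> S"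
    if "good q" for q using that by (auto simp: good_def)
  \<comment> \<open>A negative element is absorbed: its product with \<open>\<iota> u\<close> is
    \<open>\<iota>\<close> of a longer tensor, for which goodness of \<open>q\<close> already
    speaks.\<close>
  have good_neg: "good (q \<otimes>\<^bsub>N\<^esub> \<nu> v)" if q: "good q" and v: "v \<in> hat_minus H" for q v
    using goodD[OF q] \<nu>h[OF v] ic[OF v] \<iota>(3)[OF v]
    by (auto simp: good_def N.m_assoc \<iota>c simp flip: \<iota>(3)[OF v])
  have k_central: "\<nu> (hat_k H) \<otimes>\<^bsub>N\<^esub> \<nu> v = \<nu> v \<otimes>\<^bsub>N\<^esub> \<nu> (hat_k H)" if v: "v \<in> hat_minus H" for v
  proof (rule lin_eq_on_spans[OF vs_hat_neg[OF vs_H] NN(2)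
        lin_comp[OF lin_comp[OF lin_hat_neg_incl[OF vs_H] \<nu>l] bilinD(1)[OF NN(3) \<nu>k]]
        lin_comp[OF lin_comp[OF lin_hat_neg_incl[OF vs_H] \<nu>l] bilinD(2)[OF NN(3) \<nu>k]] spans_hat_neg[OF vs_H]])
    fix x assume "x \<in> {hat_elem H a n |a n. a \<in> carrier H \<and> n < 0}"
    then show "\<nu> (hat_k H) \<otimes>\<^bsub>N\<^esub> \<nu> x = \<nu> x \<otimes>\<^bsub>N\<^esub> \<nu> (hat_k H)"
      using N_commutators(3)[OF vs_H] by auto
  qed (use v in simp)
  have k_central': "\<nu> (hat_k H) \<otimes>\<^bsub>N\<^esub> \<iota> u = \<iota> u \<otimes>\<^bsub>N\<^esub> \<nu> (hat_k H)" if u: "u \<in> carrier T" for u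
  proof -
    have "u \<in> {u \<in> carrier T. \<nu> (hat_k H) \<otimes>\<^bsub>N\<^esub> \<iota> u = \<iota> u \<otimes>\<^bsub>N\<^esub> \<nu> (hat_k H)}"
    proof (rule left_generatesD[OF left_generates_tensor_algebra[OF vs_hat_neg[OF vs_H]] subsp_equalizer[OF TT(2) NN(2)
            lin_comp[OF \<iota>(1) bilinD(1)[OF NN(3) \<nu>k]] lin_comp[OF \<iota>(1) bilinD(2)[OF NN(3) \<nu>k]]] _ _ u])
      show "\<one>\<^bsub>T\<^esub> \<in> {u \<in> carrier T. \<nu> (hat_k H) \<otimes>\<^bsub>N\<^esub> \<iota> u = \<iota> u \<otimes>\<^bsub>N\<^esub> \<nu> (hat_k H)}"
        by (simp add: \<iota>(2) \<nu>k)
      fix g u assume "g \<in> ?i ` carrier (hat_neg H)"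
        and u: "u \<in> {u \<in> carrier T. \<nu> (hat_k H) \<otimes>\<^bsub>N\<^esub> \<iota> u = \<iota> u \<otimes>\<^bsub>N\<^esub> \<nu> (hat_k H)}"
      then obtain v where v: "v \<in> hat_minus H" "g = ?i v" by auto
      have "\<nu> (hat_k H) \<otimes>\<^bsub>N\<^esub> (\<nu> v \<otimes>\<^bsub>N\<^esub> \<iota> u) = (\<nu> (hat_k H) \<otimes>\<^bsub>N\<^esub> \<nu> v) \<otimes>\<^bsub>N\<^esub> \<iota> u"
        using u \<nu>h[OF v(1)] by (simp add: \<nu>k \<iota>c N.m_assoc)
      also have "\<dots> = \<nu> v \<otimes>\<^bsub>N\<^esub> (\<nu> (hat_k H) \<otimes>\<^bsub>N\<^esub> \<iota> u)"
        unfolding k_central[OF v(1)] using u \<nu>h[OF v(1)] \<nu>k \<iota>c by (intro N.m_assoc) auto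
      finally have "\<nu> (hat_k H) \<otimes>\<^bsub>N\<^esub> (\<nu> v \<otimes>\<^bsub>N\<^esub> \<iota> u) = \<nu> v \<otimes>\<^bsub>N\<^esub> (\<nu> (hat_k H) \<otimes>\<^bsub>N\<^esub> \<iota> u)" .
      then show "g \<otimes>\<^bsub>T\<^esub> u \<in> {u \<in> carrier T. \<nu> (hat_k H) \<otimes>\<^bsub>N\<^esub> \<iota> u = \<iota> u \<otimes>\<^bsub>N\<^esub> \<nu> (hat_k H)}"
        using u v ic[OF v(1)] by (simp add: \<iota>(3) \<nu>h \<nu>k \<iota>c N.m_assoc)
    qed
    then show ?thesis by simp
  qed
  have good_k: "good (q \<otimes>\<^bsub>N\<^esub> \<nu> (hat_k H))" if q: "good q" for q
  proof -
    have "cls ((q \<otimes>\<^bsub>N\<^esub> \<nu> (hat_k H)) \<otimes>\<^bsub>N\<^esub> \<iota> u) x \<in> S" if ux: "u \<in> carrier T" "x \<in> carrier M" for u x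
    proof -
      \<comment> \<open>The central element passes \<open>\<iota> u\<close>, crosses the tensor sign
        and acts on \<open>M\<close> as 1.\<close>
      have "(q \<otimes>\<^bsub>N\<^esub> \<nu> (hat_k H)) \<otimes>\<^bsub>N\<^esub> \<iota> u = (q \<otimes>\<^bsub>N\<^esub> \<iota> u) \<otimes>\<^bsub>N\<^esub> \<nu> (hat_k H)"
        using goodD(1)[OF q] ux by (simp add: N.m_assoc \<nu>k \<iota>c k_central')
      then have "cls ((q \<otimes>\<^bsub>N\<^esub> \<nu> (hat_k H)) \<otimes>\<^bsub>N\<^esub> \<iota> u) x = cls (q \<otimes>\<^bsub>N\<^esub> \<iota> u) x"
        using goodD(1)[OF q] ux act cls_balanced[OF _ nonneg_mem(1), of "q \<otimes>\<^bsub>N\<^esub> \<iota> u" x]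
        by (simp add: \<iota>c extends_action_def)
      then show ?thesis using goodD(2)[OF q ux] by simp
    qed
    then show ?thesis using goodD(1)[OF q] \<nu>k by (simp add: good_def)
  qed
  have cl: "lin N Ind (\<lambda>n. cls n x)" if "x \<in> carrier M" for x
    by (rule bilinD(2)[OF bilin_cls that])
  have good_nonneg: "good (q \<otimes>\<^bsub>N\<^esub> \<nu> (hat_elem H a j))"
    if q: "good q" and a: "a \<in> carrier H" and j: "j \<ge> 0" for q a j
  proof -
    let ?y = "\<nu> (hat_elem H a j)"
    note y = \<nu>e[OF a, of j]
    \<comment> \<open>The quantifier over all good \<open>q\<close> belongs inside the induction on
      \<open>u\<close>: moving the mode past a letter \<open>v\<close> leaves
      \<open>q \<nu>(v)\<close> in front of it in place of \<open>q\<close>.\<close>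
    let ?R = "{u \<in> carrier T. \<forall>q x. good q \<longrightarrow> x \<in> carrier M \<longrightarrow> cls ((q \<otimes>\<^bsub>N\<^esub> ?y) \<otimes>\<^bsub>N\<^esub> \<iota> u) x \<in> S}"
    have l: "lin T Ind (\<lambda>u. cls ((q \<otimes>\<^bsub>N\<^esub> ?y) \<otimes>\<^bsub>N\<^esub> \<iota> u) x)" if "good q" "x \<in> carrier M" for q x
      using goodD(1)[OF that(1)] y
      by (intro lin_comp[OF lin_comp[OF \<iota>(1) bilinD(1)[OF NN(3)]] cl[OF that(2)]]) simp
    have "u \<in> ?R" if u: "u \<in> carrier T" for u
    proof (rule left_generatesD[OF left_generates_tensor_algebra[OF vs_hat_neg[OF vs_H]] _ _ _ u])
      show "subsp T ?R"
      proof (rule subspI)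
        show "\<zero>\<^bsub>T\<^esub> \<in> ?R"
          using lin_zero[OF TT(2) vs_Ind l] subspD(2)[OF S(1)] by auto
        show "u \<oplus>\<^bsub>T\<^esub> u' \<in> ?R" if "u \<in> ?R" "u' \<in> ?R" for u u'
          using that linD(2)[OF l] subspD(3)[OF S(1)] by auto
        show "c \<odot>\<^bsub>T\<^esub> u \<in> ?R" if "u \<in> ?R" for c u
          using that linD(3)[OF l] subspD(4)[OF S(1)] vs_closed(3)[OF TT(2)] by auto
      qed auto
      show "\<one>\<^bsub>T\<^esub> \<in> ?R"
      proof (intro CollectI conjI allI impI T.one_closed)
        fix q x assume q: "good q" and x: "x \<in> carrier M"
        note qN = goodD(1)[OF q]
        \<comment> \<open>With no letter left, the mode stands next to the tensor sign and crosses
          it, changing only the vector in \<open>M\<close>.\<close>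
        have "cls ((q \<otimes>\<^bsub>N\<^esub> ?y) \<otimes>\<^bsub>N\<^esub> \<iota> \<one>\<^bsub>T\<^esub>) x = cls (q \<otimes>\<^bsub>N\<^esub> \<iota> \<one>\<^bsub>T\<^esub>) (act ?y x)"
          using qN y by (simp add: \<iota>(2) cls_balanced[OF qN nonneg_mem(2)[OF a j] x])
        then show "cls ((q \<otimes>\<^bsub>N\<^esub> ?y) \<otimes>\<^bsub>N\<^esub> \<iota> \<one>\<^bsub>T\<^esub>) x \<in> S"
          using goodD(2)[OF q T.one_closed] act_closed[OF nonneg_mem(2)[OF a j] x] by simp
      qed
      fix g u assume "g \<in> ?i ` carrier (hat_neg H)" and uR: "u \<in> ?R"
      then obtain v where v: "v \<in> hat_minus H" "g = ?i v" by auto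
      from uR have u: "u \<in> carrier T" by simp
      obtain c where c: "?y \<otimes>\<^bsub>N\<^esub> \<nu> v = (\<nu> v \<otimes>\<^bsub>N\<^esub> ?y) \<oplus>\<^bsub>N\<^esub> c \<odot>\<^bsub>N\<^esub> \<nu> (hat_k H)"
        using N_normal_order[OF vs_H a j v(1)] by blast
      show "g \<otimes>\<^bsub>T\<^esub> u \<in> ?R"
      proof (intro CollectI conjI allI impI)
        show "g \<otimes>\<^bsub>T\<^esub> u \<in> carrier T" using v u ic by simp
        fix q x assume q: "good q" and x: "x \<in> carrier M"
        note qN = goodD(1)[OF q] and vN = \<nu>h[OF v(1)]
        have "(q \<otimes>\<^bsub>N\<^esub> ?y) \<otimes>\<^bsub>N\<^esub> \<iota> (g \<otimes>\<^bsub>T\<^esub> u) = q \<otimes>\<^bsub>N\<^esub> ((?y \<otimes>\<^bsub>N\<^esub> \<nu> v) \<otimes>\<^bsub>N\<^esub> \<iota> u)"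
          using qN vN y u v by (simp add: \<iota>(3) \<iota>c N.m_assoc)
        \<comment> \<open>The first term falls under the induction hypothesis for the good element
          \<open>q \<nu>(v)\<close>; in the second the central element has replaced both the mode
          and \<open>v\<close>, and \<open>good_k\<close> applies.\<close>
        also have "\<dots> = (((q \<otimes>\<^bsub>N\<^esub> \<nu> v) \<otimes>\<^bsub>N\<^esub> ?y) \<otimes>\<^bsub>N\<^esub> \<iota> u) \<oplus>\<^bsub>N\<^esub>
            c \<odot>\<^bsub>N\<^esub> ((q \<otimes>\<^bsub>N\<^esub> \<nu> (hat_k H)) \<otimes>\<^bsub>N\<^esub> \<iota> u)"
          using qN vN y u \<nu>k unfolding c
          by (simp add: N.l_distr N.r_distr N.m_assoc \<iota>c vs_closed(3)[OF NN(2)]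
              linD(3)[OF bilinD(1)[OF NN(3)]] linD(3)[OF bilinD(2)[OF NN(3)]])
        finally have "cls ((q \<otimes>\<^bsub>N\<^esub> ?y) \<otimes>\<^bsub>N\<^esub> \<iota> (g \<otimes>\<^bsub>T\<^esub> u)) x =
            cls (((q \<otimes>\<^bsub>N\<^esub> \<nu> v) \<otimes>\<^bsub>N\<^esub> ?y) \<otimes>\<^bsub>N\<^esub> \<iota> u) x \<oplus>\<^bsub>Ind\<^esub>
            c \<odot>\<^bsub>Ind\<^esub> cls ((q \<otimes>\<^bsub>N\<^esub> \<nu> (hat_k H)) \<otimes>\<^bsub>N\<^esub> \<iota> u) x"
          using qN vN y u \<nu>k by (simp add: linD(2,3)[OF cl[OF x]] \<iota>c vs_closed(3)[OF NN(2)])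
        moreover have "cls (((q \<otimes>\<^bsub>N\<^esub> \<nu> v) \<otimes>\<^bsub>N\<^esub> ?y) \<otimes>\<^bsub>N\<^esub> \<iota> u) x \<in> S"
          using uR good_neg[OF q v(1)] x by blast
        moreover have "cls ((q \<otimes>\<^bsub>N\<^esub> \<nu> (hat_k H)) \<otimes>\<^bsub>N\<^esub> \<iota> u) x \<in> S"
          by (rule goodD(2)[OF good_k[OF q] u x])
        ultimately show "cls ((q \<otimes>\<^bsub>N\<^esub> ?y) \<otimes>\<^bsub>N\<^esub> \<iota> (g \<otimes>\<^bsub>T\<^esub> u)) x \<in> S"
          using subspD(3,4)[OF S(1)] by simp
      qed
    qed
    then show ?thesis using q goodD(1)[OF q] y by (simp add: good_def)
  qed
  have subsp_good: "subsp N {n \<in> carrier N. \<forall>q. good q \<longrightarrow> good (q \<otimes>\<^bsub>N\<^esub> n)}" (is "subsp N ?G")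
  proof (rule subspI)
    have l: "lin N Ind (\<lambda>n. cls ((q \<otimes>\<^bsub>N\<^esub> n) \<otimes>\<^bsub>N\<^esub> \<iota> u) x)"
      if "good q" "u \<in> carrier T" "x \<in> carrier M" for q u x
      using goodD(1)[OF that(1)] \<iota>c[OF that(2)]
      by (intro lin_comp[OF lin_comp[OF bilinD(1)[OF NN(3)] bilinD(2)[OF NN(3)]] cl[OF that(3)]])
    show "\<zero>\<^bsub>N\<^esub> \<in> ?G"
      using lin_zero[OF NN(2) vs_Ind l] subspD(2)[OF S(1)] goodD(1) by (auto simp: good_def[of "_ \<otimes>\<^bsub>N\<^esub> _"])
    show "n \<oplus>\<^bsub>N\<^esub> n' \<in> ?G" if "n \<in> ?G" "n' \<in> ?G" for n n'
      using that linD(2)[OF l] subspD(3)[OF S(1)] goodD(1)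
      by (auto simp: good_def[of "_ \<otimes>\<^bsub>N\<^esub> _"])
    show "c \<odot>\<^bsub>N\<^esub> n \<in> ?G" if "n \<in> ?G" for c n
      using that linD(3)[OF l] subspD(4)[OF S(1)] goodD(1) vs_closed(3)[OF NN(2)]
      by (auto simp: good_def[of "_ \<otimes>\<^bsub>N\<^esub> _"])
  qed auto
  have good_spans: "\<nu> y \<in> ?G" if y: "y \<in> carrier (hat H)" for y
  proof -
    have "y \<in> {y \<in> carrier (hat H). \<nu> y \<in> ?G}"
    proof (rule spansD[OF spans_hat[OF vs_H] subsp_vimage[OF vs_hat[OF vs_H] NN(2) \<nu>l subsp_good] _ y])
      show "{hat_elem H a n |a n. a \<in> carrier H} \<union> {hat_k H} \<subseteq> {y \<in> carrier (hat H). \<nu> y \<in> ?G}"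
      proof (intro Un_least subsetI)
        fix y assume "y \<in> {hat_elem H a n |a n. a \<in> carrier H}"
        then obtain a n where y: "a \<in> carrier H" "y = hat_elem H a n" by auto
        have "good (q \<otimes>\<^bsub>N\<^esub> \<nu> (hat_elem H a n))" if "good q" for q
          using good_neg[OF that hat_elem_in_hat_minus[OF vs_H y(1)], of n]
            good_nonneg[OF that y(1), of n] by (cases "n < 0") auto
        then show "y \<in> {y \<in> carrier (hat H). \<nu> y \<in> ?G}"
          using y \<nu>e hat_elem_closed[OF vs_H] by auto
      next
        fix y assume "y \<in> {hat_k H}"
        then show "y \<in> {y \<in> carrier (hat H). \<nu> y \<in> ?G}"
          using \<nu>k good_k hat_k_closed[OF vs_H] by auto
      qed
    qed
    then show ?thesis by simp
  qed
  \<comment> \<open>Right multiplications compose as \<open>q (g n) = (q g) n\<close>, so the set is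
    stable under left multiplication by generators and left generation covers the whole
    algebra.\<close>
  have "n \<in> ?G" if n: "n \<in> carrier N" for n
  proof (rule left_generatesD[OF left_generates_N[OF vs_H] subsp_good _ _ n])
    show "\<one>\<^bsub>N\<^esub> \<in> ?G" using goodD(1) by simp
    fix g n assume "g \<in> \<nu> ` carrier (hat H)" and n: "n \<in> ?G"
    then have g: "g \<in> ?G" using good_spans by blast
    have "good (q \<otimes>\<^bsub>N\<^esub> (g \<otimes>\<^bsub>N\<^esub> n))" if q: "good q" for q
    proof -
      have "good (q \<otimes>\<^bsub>N\<^esub> g)" using g q by simp
      then have "good ((q \<otimes>\<^bsub>N\<^esub> g) \<otimes>\<^bsub>N\<^esub> n)" using n by simp
      then show ?thesis using goodD(1)[OF q] g n by (simp add: N.m_assoc)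
    qed
    then show "g \<otimes>\<^bsub>N\<^esub> n \<in> ?G" using g n by simp
  qed
  moreover have "good \<one>\<^bsub>N\<^esub>" by (simp add: good_def \<iota>c S(2))
  ultimately have good: "good n" if n: "n \<in> carrier N" for n
    using n N.l_one[OF n] by force
  have "cls n x \<in> S" if "n \<in> carrier N" "x \<in> carrier M" for n x
    using goodD(2)[OF good[OF that(1)] T.one_closed that(2)] that(1) by (simp add: \<iota>(2))
  then show ?thesis using spansD[OF spans_Ind S(1)] by blast
qed

text \<open>Here \<open>act\<close> is any action with the required properties, not the one
  constructed for existence; it is compared with the Fock action through its values on
  generators.\<close>

lemma induced_module_isomorphic: "lin_isomorphic Ind (tensor T M)"
proof -
  interpret N: ring N by (rule NN)
  interpret T: ring T by (rule TT)
  let ?W = "tensor T M" and ?i = "tensor_incl (hat_neg H)"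
  let ?j = "pure_tensor T M \<one>\<^bsub>T\<^esub>" and ?p = "pure_tensor T M"
  have W: "vs ?W" by (rule vs_tensor[OF TT(2) vs_M])
  note pb = bilin_pure_tensor[OF TT(2) vs_M]
  note pc = bilinD(3)[OF pb]
  note ic = linD(1)[OF lin_tensor_incl[OF vs_hat_neg[OF vs_H]], simplified]
  note \<nu>l = lin_N_incl[OF vs_H, of B]
  have \<nu>h: "\<nu> v \<in> carrier N" if "v \<in> hat_minus H" for v
    using linD(1)[OF \<nu>l] subspD(1)[OF subsp_hat_minus[OF vs_H]] that by blast
  obtain f where f: "left_module N ?W f"
    "\<And>v u x. v \<in> hat_minus H \<Longrightarrow> u \<in> carrier T \<Longrightarrow> x \<in> carrier M \<Longrightarrow>
      f (\<nu> v) (?p u x) = ?p (?i v \<otimes>\<^bsub>T\<^esub> u) x"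
    "\<And>a n x. a \<in> carrier H \<Longrightarrow> n > 0 \<Longrightarrow> x \<in> carrier M \<Longrightarrow> f (\<nu> (hat_elem H a n)) (?j x) = \<zero>\<^bsub>?W\<^esub>"
    "\<And>a x. a \<in> carrier H \<Longrightarrow> x \<in> carrier M \<Longrightarrow>
      f (\<nu> (hat_elem H a 0)) (?j x) = ?j (\<tau> (tensor_incl H a) x)"
    "\<And>w. w \<in> carrier ?W \<Longrightarrow> f (\<nu> (hat_k H)) w = w"
    by (rule fock_module[OF nd M]) blast
  interpret f: left_module N ?W f by (rule f)
  note fb = left_module_bilin[OF NN(2) f(1)]
  interpret act: left_module "N\<lparr>carrier := P\<rparr>" M act by (rule act_module)
  note jl = bilinD(1)[OF pb T.one_closed]
  note jc = linD(1)[OF jl]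

  \<comment> \<open>Agreement of the Fock action on \<open>1 \<otimes> M\<close> with
    \<open>act\<close>. Membership in \<open>P\<close> is part of the condition because the module
    laws of \<open>act\<close> are available only there.\<close>
  let ?Q = "{p \<in> P. \<forall>x\<in>carrier M. f p (?j x) = ?j (act p x)}"
  have "P \<subseteq> ?Q"
  proof (rule N_nonneg_subset)
    note P = N_nonneg
    show "subsp N ?Q"
    proof (rule subspI)
      have b: "bilin (N\<lparr>carrier := P\<rparr>) M M act"
        by (rule left_module_bilin[OF vs_restrict[OF NN(2) P(1)] act_module])
      show "\<zero>\<^bsub>N\<^esub> \<in> ?Q"
        using lin_zero[OF NN(2) W bilinD(2)[OF fb jc]] lin_zero[OF vs_M W jl] subspD(2)[OF P(1)]
          lin_zero[OF vs_restrict[OF NN(2) P(1)] vs_M bilinD(2)[OF b]] by auto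
    qed (use subspD[OF P(1)] in \<open>auto simp: f.act_add_left f.act_smult_left jc PN
        act.act_add_left[simplified] act.act_smult_left[simplified] linD(2,3)[OF jl] act_closed\<close>)
    show "\<one>\<^bsub>N\<^esub> \<in> ?Q" using P(2) act.act_one by (simp add: f.act_one jc)
    show "p \<otimes>\<^bsub>N\<^esub> q \<in> ?Q" if "p \<in> ?Q" "q \<in> ?Q" for p q
      using that P(3) act.act_mult by (simp add: f.act_mult jc PN act_closed)
    show "\<nu> (hat_k H) \<in> ?Q"
      using nonneg_mem(1) act by (simp add: f(5) jc extends_action_def)
    fix a and n :: int assume a: "a \<in> carrier H" "n \<ge> 0"
    have "f (\<nu> (hat_elem H a n)) (?j x) = ?j (act (\<nu> (hat_elem H a n)) x)" if x: "x \<in> carrier M" for x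
    proof (cases "n = 0")
      case True
      then show ?thesis using a x act by (simp add: f(4) extends_action_def)
    next
      case False
      then have "act (\<nu> (hat_elem H a n)) x = \<zero>\<^bsub>M\<^esub>"
        using a x act hat_elem_in_hat_plus[OF vs_H a(1), of n] by (simp add: extends_action_def)
      then show ?thesis using False a x lin_zero[OF vs_M W jl] by (simp add: f(3))
    qed
    then show "\<nu> (hat_elem H a n) \<in> ?Q" using nonneg_mem(2)[OF a] by simp
  qed
  then have fP: "f p (?j x) = ?j (act p x)" if "p \<in> P" "x \<in> carrier M" for p x
    using that by auto

  obtain \<Phi>0 where \<Phi>0: "lin (tensor N M) ?W \<Phi>0"
    "\<And>n x. n \<in> carrier N \<Longrightarrow> x \<in> carrier M \<Longrightarrow> \<Phi>0 (pure_tensor N M n x) = f n (?j x)"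
    using lin_tensor_ext[OF NN(2) vs_M W bilin_comp_right[OF fb jl]] by metis
  \<comment> \<open>By the agreement just proved, letting \<open>p\<close> act on
    \<open>1 \<otimes> x\<close> has the same result as replacing \<open>x\<close> by
    \<open>act p x\<close>, so the balancing relations go to 0.\<close>
  have "\<Phi>0 r = \<zero>\<^bsub>?W\<^esub>" if "r \<in> induced_relations" for r
  proof -
    from that obtain a p x where r: "a \<in> carrier N" "p \<in> P" "x \<in> carrier M"
      "r = pure_tensor N M (a \<otimes>\<^bsub>N\<^esub> p) x \<ominus>\<^bsub>tensor N M\<^esub> pure_tensor N M a (act p x)" by auto
    have "\<Phi>0 r = f (a \<otimes>\<^bsub>N\<^esub> p) (?j x) \<ominus>\<^bsub>?W\<^esub> f a (?j (act p x))"
      unfolding r(4) using r(1-3) bilinD(3)[OF bilin_pure_tensor[OF NN(2) vs_M]]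
      by (subst lin_minus[OF vs_NM W \<Phi>0(1)]) (simp_all add: \<Phi>0(2) PN act_closed)
    then show ?thesis
      using r(1-3) by (simp add: f.act_mult PN jc fP vs_diff(1)[OF W] f.act_closed act_closed)
  qed
  then have "lin_span (tensor N M) induced_relations \<subseteq> {y \<in> carrier (tensor N M). \<Phi>0 y \<in> {\<zero>\<^bsub>?W\<^esub>}}"
    using induced_relations_closed
    by (intro lin_span_minimal[OF vs_NM subsp_vimage[OF vs_NM W \<Phi>0(1) subsp_zero[OF W]]]) blast
  then have ker: "\<Phi>0 y = \<zero>\<^bsub>?W\<^esub>" if "y \<in> lin_span (tensor N M) induced_relations" for y
    using that by blast
  obtain \<Phi> where \<Phi>: "lin Ind ?W \<Phi>"
    "\<And>n x. n \<in> carrier N \<Longrightarrow> x \<in> carrier M \<Longrightarrow> \<Phi> (cls n x) = f n (?j x)"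
  proof (rule lin_quotient_lift[OF vs_NM induced_kernel(1) W \<Phi>0(1) ker])
    fix g assume g: "lin (quotient_space (tensor N M) (lin_span (tensor N M) induced_relations)) ?W g"
      "\<And>y. y \<in> carrier (tensor N M) \<Longrightarrow>
        g (lin_span (tensor N M) induced_relations +>\<^bsub>tensor N M\<^esub> y) = \<Phi>0 y"
    show thesis
      by (rule that[OF g(1)[folded induced_module_def]])
        (simp add: cls_def g(2) \<Phi>0(2) bilinD(3)[OF bilin_pure_tensor[OF NN(2) vs_M]])
  qed

  \<comment> \<open>The map from the negative tensor algebra into \<open>N\<close> is obtained from
    a module: negative elements act on \<open>N\<close> by left multiplication, and
    \<open>\<iota> u\<close> is the result of applying \<open>u\<close> to 1.\<close>
  have bN: "bilin (hat_neg H) N N (\<lambda>v n. \<nu> v \<otimes>\<^bsub>N\<^esub> n)"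
    by (rule bilin_comp_left[OF NN(3) lin_comp[OF lin_hat_neg_incl[OF vs_H] \<nu>l]])
  obtain \<kappa> where \<kappa>: "left_module T N \<kappa>"
    "\<And>v n. v \<in> carrier (hat_neg H) \<Longrightarrow> n \<in> carrier N \<Longrightarrow> \<kappa> (?i v) n = \<nu> v \<otimes>\<^bsub>N\<^esub> n"
    using left_module_tensor_algebra[OF vs_hat_neg[OF vs_H] NN(2) bN] by metis
  interpret \<kappa>: left_module T N \<kappa> by (rule \<kappa>)
  define \<iota> where "\<iota> u = \<kappa> u \<one>\<^bsub>N\<^esub>" for u
  have \<iota>: "lin T N \<iota>" "\<iota> \<one>\<^bsub>T\<^esub> = \<one>\<^bsub>N\<^esub>"
    "\<And>v u. v \<in> hat_minus H \<Longrightarrow> u \<in> carrier T \<Longrightarrow> \<iota> (?i v \<otimes>\<^bsub>T\<^esub> u) = \<nu> v \<otimes>\<^bsub>N\<^esub> \<iota> u"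
    unfolding \<iota>_def[abs_def]
    using bilinD(2)[OF left_module_bilin[OF TT(2) \<kappa>(1)] N.one_closed]
    by (simp_all add: \<kappa>.act_one \<kappa>.act_mult ic \<kappa>(2) \<kappa>.act_closed)
  note \<iota>c = linD(1)[OF \<iota>(1)]
  obtain \<Psi> where \<Psi>: "lin ?W Ind \<Psi>"
    "\<And>u x. u \<in> carrier T \<Longrightarrow> x \<in> carrier M \<Longrightarrow> \<Psi> (?p u x) = cls (\<iota> u) x"
    using lin_tensor_ext[OF TT(2) vs_M vs_Ind bilin_comp_left[OF bilin_cls \<iota>(1)]] by metis

  have \<iota>f: "f (\<iota> u) (?j x) = ?p u x" if u: "u \<in> carrier T" and x: "x \<in> carrier M" for u x
  proof -
    have "u \<in> {u \<in> carrier T. f (\<iota> u) (?j x) = ?p u x}"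
    proof (rule left_generatesD[OF left_generates_tensor_algebra[OF vs_hat_neg[OF vs_H]] subsp_equalizer[OF TT(2) W
            lin_comp[OF \<iota>(1) bilinD(2)[OF fb jc[OF x]]] bilinD(2)[OF pb x]] _ _ u])
      show "\<one>\<^bsub>T\<^esub> \<in> {u \<in> carrier T. f (\<iota> u) (?j x) = ?p u x}"
        using x by (simp add: \<iota>(2) f.act_one jc)
      fix g u assume "g \<in> ?i ` carrier (hat_neg H)" "u \<in> {u \<in> carrier T. f (\<iota> u) (?j x) = ?p u x}"
      then show "g \<otimes>\<^bsub>T\<^esub> u \<in> {u \<in> carrier T. f (\<iota> u) (?j x) = ?p u x}"
        using x by (auto simp: \<iota>(3) ic f.act_mult \<nu>h \<iota>c jc f(2))
    qed
    then show ?thesis by simp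
  qed
  have \<Phi>\<Psi>: "\<Phi> (\<Psi> w) = w" if w: "w \<in> carrier ?W" for w
    by (rule lin_eq_on_tensor[OF TT(2) vs_M W lin_comp[OF \<Psi>(1) \<Phi>(1)] lin_id _ w])
      (simp add: \<Psi>(2) \<Phi>(2) \<iota>c \<iota>f)
  have surj: "carrier Ind \<subseteq> \<Psi> ` carrier ?W"
  proof (rule normal_ordered_span[OF \<iota> subsp_image[OF W vs_Ind \<Psi>(1)]])
    show "cls (\<iota> u) x \<in> \<Psi> ` carrier ?W" if "u \<in> carrier T" "x \<in> carrier M" for u x
      using \<Psi>(2)[OF that] pc[OF that] by (metis imageI)
  qed
  \<comment> \<open>\<open>\<Psi>\<close> is surjective and has the left inverse
    \<open>\<Phi>\<close>, so the two are inverse to each other.\<close>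
  have \<Psi>\<Phi>: "\<Psi> (\<Phi> y) = y" if "y \<in> carrier Ind" for y
    using surj that \<Phi>\<Psi> by force
  have "bij_betw \<Phi> (carrier Ind) (carrier ?W)"
    by (rule bij_betw_byWitness[of _ \<Psi>]) (use \<Phi>\<Psi> \<Psi>\<Phi> linD(1)[OF \<Phi>(1)] linD(1)[OF \<Psi>(1)] in auto)
  then show ?thesis
    unfolding lin_isomorphic_def using linD(2,3)[OF \<Phi>(1)] by blast
qed

end

end

text \<open>The existence clause keeps the second clause from being vacuous. As a function
  \<open>act\<close> is arbitrary outside the nonnegative subalgebra and \<open>M\<close>, so it is
  quantified over rather than named.\<close>

theorem mainTheorem3:
  fixes H :: "(complex, 'h) module" and B :: "'h \<Rightarrow> 'h \<Rightarrow> complex"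
    and M :: "(complex, 'm) module"
    and \<tau> :: "('h list \<Rightarrow>\<^sub>0 complex) set \<Rightarrow> 'm \<Rightarrow> 'm"
  assumes "nondegenerate_form H B"
    and "left_module (tensor_algebra H) M \<tau>"
  shows "(\<exists>act. extends_action H B M \<tau> act) \<and>
    (\<forall>act. extends_action H B M \<tau> act \<longrightarrow>
      lin_isomorphic (induced_module (N_algebra H B) (N_nonneg H B) M act)
        (tensor (tensor_algebra ((hat H)\<lparr>carrier := hat_minus H\<rparr>)) M))"
  using extension_exists[OF assms] induced_module_isomorphic[OF assms] by blast

end
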